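(* Fix $A\geq 0$, $B>A+5$ and $\gamma >2A+6$. Given $x \geq 2$, let $Q=x^{1/2}/(\log x)^{B}$ and $y = x/(\log x)^{\gamma}$. Let $\mathcal A$ be the set of all primitive Dirichlet characters of conductor at most $(\log x)^{B}$. If $f\in \mathcal C$ is supported only on the $y$-smooth integers then $$\sum_{q \leq Q} \max_{(a,q)=1} |\Delta_{\mathcal A}(f,x; q,a)| \ll \frac x{(\log x)^A},$$ where the implied constant depends only on $A$, $B$, $\gamma$.
   Context: An integer $n\ge 1$ is $y$-smooth if all of its prime factors are $\le y$. For an arithmetic function $h$ and a Dirichlet character $\chi$, put $S_h(x,\chi):=\sum_{n\le x}h(n)\overline{\chi}(n)$. For a finite set $\Xi$ of primitive Dirichlet characters (the trivial character of conductor $1$ counts as primitive), let $\Xi_q$ be the set of characters mod $q$ that are induced by the characters in $\Xi$. For $(a,q)=1$ define $$\Delta_\Xi(h,x;q,a):= \sum_{\substack{n\leq x \\ n\equiv a \pmod q}} h(n) - \frac 1{\varphi(q)} \sum_{\chi \in \Xi_q} \chi(a) S_h(x,\chi).$$ For a multiplicative function $f$ let $F(s)=\sum_{n\ge1} f(n)n^{-s}$, and define $\Lambda_f$ by $-F'(s)/F(s)=\sum_{n\ge2}\Lambda_f(n)n^{-s}$ for $\mathrm{Re}(s)>1$ (equivalently $f(n)\log n=\sum_{d\mid n}\Lambda_f(d)f(n/d)$ for all $n\geq 1$). $\mathcal C$ is the class of multiplicative functions $f$ with $|\Lambda_f(n)|\le\Lambda(n)$ for all $n\ge1$, where $\Lambda$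 is the von Mangoldt function. *)

theory Defs
  imports Complex_Main "HOL-Number_Theory.Number_Theory"
begin

text \<open>Arithmetic functions are total functions \<^typ>\<open>nat \<Rightarrow> complex\<close>; their value at \<open>0\<close> is irrelevant.\<close>

definition smooth :: "real \<Rightarrow> nat \<Rightarrow> bool" where
  "smooth y n \<longleftrightarrow> n \<ge> 1 \<and> (\<forall>p. prime p \<and> p dvd n \<longrightarrow> real p \<le> y)"

definition multiplicative :: "(nat \<Rightarrow> complex) \<Rightarrow> bool" where
  "multiplicative f \<longleftrightarrow> f 1 = 1 \<and>
     (\<forall>m n. m > 0 \<and> n > 0 \<and> coprime m n \<longrightarrow> f (m * n) = f m * f n)"

text \<open>
  \<open>Lambda_of f\<close> gives the coefficients of \<open>-F'(s)/F(s)\<close>, where \<open>F(s)\<close> is the Dirichlet series of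
  \<open>f\<close>. Comparing coefficients in \<open>-F' = (-F'/F) F\<close> yields the identity \<open>Lambda_of_conv\<close> below,
  which is solved here for its term \<open>d = n\<close> (using \<open>f 1 = 1\<close>) to obtain a recursion.
\<close>

function Lambda_of :: "(nat \<Rightarrow> complex) \<Rightarrow> nat \<Rightarrow> complex" where
  "Lambda_of f n = (if n = 0 then 0 else
     f n * complex_of_real (ln (real n)) -
     (\<Sum>d \<in> {d. d dvd n \<and> d < n}. Lambda_of f d * f (n div d)))"
  by auto
termination by (relation "measure snd") auto

declare Lambda_of.simps [simp del]

lemma Lambda_of_conv:
  assumes "f 1 = 1" "n \<ge> 1"
  shows   "f n * complex_of_real (ln (real n)) = (\<Sum>d | d dvd n. Lambda_of f d * f (n div d))"
proof -
  have *: "{d. d dvd n} = insert n {d. d dvd n \<and> d < n}"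
    using assms by (auto dest: dvd_imp_le)
  show ?thesis
    using assms by (subst *, subst sum.insert) (auto simp: Lambda_of.simps[of f n])
qed

lemma Lambda_of_unique:
  assumes "f 1 = 1"
    and g: "\<And>n. n \<ge> 1 \<Longrightarrow>
          f n * complex_of_real (ln (real n)) = (\<Sum>d | d dvd n. g d * f (n div d))"
    and "n \<ge> 1"
  shows "g n = Lambda_of f n"
  using \<open>n \<ge> 1\<close>
proof (induction n rule: less_induct)
  case (less n)
  have *: "{d. d dvd n} = insert n {d. d dvd n \<and> d < n}"
    using less.prems by (auto dest: dvd_imp_le)
  have "(\<Sum>d \<in> {d. d dvd n \<and> d < n}. g d * f (n div d)) =
        (\<Sum>d \<in> {d. d dvd n \<and> d < n}. Lambda_of f d * f (n div d))"
  proof (intro sum.cong refl)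
    fix d assume "d \<in> {d. d dvd n \<and> d < n}"
    then have "d < n" "d \<ge> 1"
      using less.prems by (auto intro: Nat.gr0I)
    then show "g d * f (n div d) = Lambda_of f d * f (n div d)"
      by (simp add: less.IH)
  qed
  moreover have "f n * complex_of_real (ln (real n)) =
      g n + (\<Sum>d \<in> {d. d dvd n \<and> d < n}. g d * f (n div d))"
    unfolding g[OF less.prems] using less.prems assms(1) by (subst *, subst sum.insert) auto
  ultimately show ?case
    using less.prems by (simp add: Lambda_of.simps[of f n])
qed

definition class_C :: "(nat \<Rightarrow> complex) set" where
  "class_C = {f. multiplicative f \<and> (\<forall>n\<ge>1. norm (Lambda_of f n) \<le> (mangoldt n :: real))}"

definition dcharacter :: "nat \<Rightarrow> (nat \<Rightarrow> complex) \<Rightarrow> bool" where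
  "dcharacter q \<chi> \<longleftrightarrow> q > 0 \<and> (\<forall>n. \<chi> (n + q) = \<chi> n) \<and> (\<forall>m n. \<chi> (m * n) = \<chi> m * \<chi> n) \<and>
     (\<forall>n. \<chi> n \<noteq> 0 \<longleftrightarrow> coprime n q)"

text \<open>The character \<open>\<chi>\<close> modulo \<open>q\<close> is induced by the character \<open>\<psi>\<close> modulo \<open>d\<close>.\<close>

definition induced_by :: "nat \<Rightarrow> (nat \<Rightarrow> complex) \<Rightarrow> nat \<Rightarrow> (nat \<Rightarrow> complex) \<Rightarrow> bool" where
  "induced_by d \<psi> q \<chi> \<longleftrightarrow> d dvd q \<and> dcharacter d \<psi> \<and> dcharacter q \<chi> \<and>
     (\<forall>n. coprime n q \<longrightarrow> \<chi> n = \<psi> n)"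

definition conductor :: "nat \<Rightarrow> (nat \<Rightarrow> complex) \<Rightarrow> nat" where
  "conductor q \<chi> = (LEAST d. \<exists>\<psi>. induced_by d \<psi> q \<chi>)"

definition primitive_dcharacter :: "nat \<Rightarrow> (nat \<Rightarrow> complex) \<Rightarrow> bool" where
  "primitive_dcharacter q \<chi> \<longleftrightarrow> dcharacter q \<chi> \<and> conductor q \<chi> = q"

text \<open>
  A primitive character, viewed as a function on \<^typ>\<open>nat\<close>, determines its modulus, so sets of
  primitive characters are represented as sets of functions.
\<close>

definition primitives_upto :: "real \<Rightarrow> (nat \<Rightarrow> complex) set" where
  "primitives_upto z = {\<psi>. \<exists>m. primitive_dcharacter m \<psi> \<and> real (conductor m \<psi>) \<le> z}"

definition induced_set :: "(nat \<Rightarrow> complex) set \<Rightarrow> nat \<Rightarrow> (nat \<Rightarrow> complex) set" where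
  "induced_set \<Xi> q = {\<chi>. \<exists>\<psi>\<in>\<Xi>. \<exists>m. primitive_dcharacter m \<psi> \<and> induced_by m \<psi> q \<chi>}"

definition char_sum :: "(nat \<Rightarrow> complex) \<Rightarrow> real \<Rightarrow> (nat \<Rightarrow> complex) \<Rightarrow> complex" where
  "char_sum h x \<chi> = (\<Sum>n \<in> {1..nat \<lfloor>x\<rfloor>}. h n * cnj (\<chi> n))"

definition Delta ::
  "(nat \<Rightarrow> complex) set \<Rightarrow> (nat \<Rightarrow> complex) \<Rightarrow> real \<Rightarrow> nat \<Rightarrow> nat \<Rightarrow> complex" where
  "Delta \<Xi> h x q a =
     (\<Sum>n \<in> {n \<in> {1..nat \<lfloor>x\<rfloor>}. [n = a] (mod q)}. h n) -
     1 / of_nat (totient q) * (\<Sum>\<chi> \<in> induced_set \<Xi> q. \<chi> a * char_sum h x \<chi>)"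

end

theory Submission
  imports Defs "HOL-Analysis.L2_Norm" "HOL-Real_Asymp.Real_Asymp"
begin

text \<open>
  By orthogonality of characters the discrepancy is at most an average of \<open>\<bar>S\<^sub>f(x, \<chi>)\<bar>\<close> over the
  characters that are induced by primitive ones of conductor \<open>> (log x)\<^sup>B\<close>. Writing \<open>q = r s\<close> with
  \<open>r\<close> the conductor, the condition \<open>(n, s) = 1\<close> can be absorbed into \<open>f\<close>, so that it remains to
  bound averages over primitive characters. Let \<open>P\<close> be the primes between a power of \<open>log x\<close> and \<open>y\<close>.
  Ramare's identity
  \<open>f(n) = \<Sum>\<^bsub>p m = n, p \<in> P\<^esub> f(p) f(m) / (1 + \<omega>\<^sub>P(m))\<close> holds unless \<open>n\<close> has no prime factor in \<open>P\<close> or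
  is divisible by the square of one; since \<open>f\<close> is supported on \<open>y\<close>-smooth numbers, the first kind of
  exceptions is \<open>(log x)\<^sup>c\<close>-smooth, and both kinds are rare. The bilinear sums are then estimated by the large sieve, where
  \<open>p \<le> y = x / (log x)\<^sup>\<gamma>\<close> is what makes the estimate nontrivial for large \<open>p\<close>.
\<close>

section \<open>Dirichlet characters\<close>

text \<open>The obstacle in the bilinear sums is the condition \<open>p * m \<le> N\<close>, which
  ties \<open>m\<close> to \<open>p\<close>, whereas the large sieve needs a product of two
  independent sums. The range of \<open>m\<close> is therefore cut along the binary digits of its
  length: at each digit place the piece depends on \<open>p\<close> only through the leading digits,
  so that grouping the \<open>p\<close> accordingly gives products, at the price of one factor log
  x. With primes of size T and conductors up to R, the estimate consists of terms of the orders N, R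
  sqrt(N T), R N / sqrt T and R^2 sqrt N. The first is beaten by omitting conductors below a power
  of log x, the last by the choice of Q. The second is geometric in T, so it loses only three
  logarithms: from the digits, from partial summation over the conductor and from the sum of 1 /
  phi(s). As it saves (log x)^(gamma/2), this is the origin of the bound 2 A + 6 for gamma. The
  third term also loses the number of dyadic ranges of \<open>p\<close>, which leads to the lower
  end (log x)^(2 A + 8) for the primes.\<close>

definition dchars :: "nat \<Rightarrow> (nat \<Rightarrow> complex) set" where
  "dchars q = {\<chi>. dcharacter q \<chi>}"

lemma cong_mod_iff: "[m = n] (mod q) \<longleftrightarrow> m mod q = n mod (q::nat)"
  by (simp add: unique_euclidean_semiring_class.cong_def)

lemma dcharacterD:
  assumes "dcharacter q \<chi>"
  shows "q > 0" "\<chi> (n + q) = \<chi> n" "\<chi> (m * n) = \<chi> m * \<chi> n" "\<chi> n \<noteq> 0 \<longleftrightarrow> coprime n q"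
  using assms unfolding dcharacter_def by blast+

lemma dcharacter_mod:
  assumes "dcharacter q \<chi>"
  shows "\<chi> (n mod q) = \<chi> n"
proof -
  have "\<chi> (m + k * q) = \<chi> m" for m k
  proof (induction k)
    case (Suc k)
    have "m + Suc k * q = (m + k * q) + q" by simp
    then show ?case using dcharacterD(2)[OF assms] Suc by metis
  qed simp
  from this[of "n mod q" "n div q"] show ?thesis by (simp add: mult.commute)
qed

lemma dcharacter_cong:
  assumes "dcharacter q \<chi>" "[m = n] (mod q)"
  shows "\<chi> m = \<chi> n"
  using dcharacter_mod[OF assms(1), of m] dcharacter_mod[OF assms(1), of n] assms(2)
  by (simp add: cong_mod_iff)

lemma dcharacter_1:
  assumes "dcharacter q \<chi>"
  shows "\<chi> 1 = 1" "\<chi> (Suc 0) = 1"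
proof -
  have "\<chi> 1 = \<chi> 1 * \<chi> 1" using dcharacterD(3)[OF assms, of 1 1] by simp
  moreover have "\<chi> 1 \<noteq> 0" using dcharacterD(4)[OF assms, of 1] by simp
  ultimately show "\<chi> 1 = 1" by simp
  then show "\<chi> (Suc 0) = 1" by simp
qed

lemma dcharacter_power:
  assumes "dcharacter q \<chi>"
  shows "\<chi> (n ^ k) = \<chi> n ^ k"
  by (induction k) (simp_all add: dcharacter_1[OF assms] dcharacterD(3)[OF assms])

lemma dcharacter_totient:
  assumes "dcharacter q \<chi>" "coprime n q"
  shows "\<chi> n ^ totient q = 1"
  using dcharacter_cong[OF assms(1) euler_theorem[OF assms(2)]]
  by (simp add: dcharacter_power[OF assms(1)] dcharacter_1[OF assms(1)])

lemma norm_dcharacter: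
  assumes "dcharacter q \<chi>"
  shows "norm (\<chi> n) = (if coprime n q then 1 else 0)"
proof (cases "coprime n q")
  case True
  have "norm (\<chi> n) ^ totient q = 1"
    using dcharacter_totient[OF assms True] by (metis norm_one norm_power)
  moreover have "totient q > 0" using dcharacterD(1)[OF assms] by simp
  ultimately have "norm (\<chi> n) = 1"
    by (metis norm_ge_zero power_eq_1_iff real_norm_def abs_of_nonneg less_numeral_extra(3))
  with True show ?thesis by simp
next
  case False
  then show ?thesis using dcharacterD(4)[OF assms, of n] by simp
qed

lemma norm_dcharacter_le: "dcharacter q \<chi> \<Longrightarrow> norm (\<chi> n) \<le> 1"
  by (simp add: norm_dcharacter)

text \<open>A character is determined by its values below \<open>q\<close>, and each of these is 0
  or a root of unity of order dividing \<open>totient q\<close>, so restriction embeds the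
  characters into a finite set of functions.\<close>

lemma finite_dchars [simp]: "finite (dchars q)"
proof (cases "q = 0")
  case True
  then have "dchars q = {}" by (auto simp: dchars_def dcharacter_def)
  then show ?thesis by simp
next
  case False
  define F where "F = PiE {..<q} (\<lambda>_. insert 0 {z::complex. z ^ totient q = 1})"
  have "finite F" unfolding F_def
    using False by (intro finite_PiE) (auto intro!: finite_roots_unity simp: Suc_le_eq)
  moreover have "(\<lambda>\<chi>. restrict \<chi> {..<q}) ` dchars q \<subseteq> F"
    using dcharacter_totient dcharacterD(4)
    by (auto simp: F_def dchars_def PiE_def Pi_def extensional_def) blast
  ultimately have "finite ((\<lambda>\<chi>. restrict \<chi> {..<q}) ` dchars q)" by (rule finite_subset[rotated])
  moreover have "inj_on (\<lambda>\<chi>. restrict \<chi> {..<q}) (dchars q)"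
  proof (rule inj_onI)
    fix \<chi> \<psi> assume A: "\<chi> \<in> dchars q" "\<psi> \<in> dchars q" "restrict \<chi> {..<q} = restrict \<psi> {..<q}"
    show "\<chi> = \<psi>"
    proof
      fix n
      have "n mod q < q" using False by simp
      then have "\<chi> (n mod q) = \<psi> (n mod q)" using A(3) by (metis lessThan_iff restrict_apply)
      then show "\<chi> n = \<psi> n"
        using A(1,2) dcharacter_mod[of q _ n] unfolding dchars_def by (metis mem_Collect_eq)
    qed
  qed
  ultimately show ?thesis by (rule finite_imageD)
qed

text \<open>A character of the subgroup of \<open>(\<int>/q)\<^sup>*\<close> that is given by its preimage \<open>H\<close> in \<open>nat\<close>.\<close>

definition partial_char :: "nat \<Rightarrow> nat set \<Rightarrow> (nat \<Rightarrow> complex) \<Rightarrow> bool" where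
  "partial_char q H \<chi> \<longleftrightarrow> 1 \<in> H \<and> (\<forall>n\<in>H. coprime n q \<and> \<chi> n \<noteq> 0) \<and>
     (\<forall>m\<in>H. \<forall>n\<in>H. m * n \<in> H \<and> \<chi> (m * n) = \<chi> m * \<chi> n) \<and>
     (\<forall>m n. m \<in> H \<and> [m = n] (mod q) \<longrightarrow> n \<in> H \<and> \<chi> m = \<chi> n)"

text \<open>Modulo \<open>q\<close> the subgroup generated by \<open>H\<close> and \<open>g\<close>
  consists of the \<open>h * g ^ i\<close>, and its only new relations come from
  \<open>g ^ k\<close> lying in \<open>H\<close>. Hence \<open>h * g ^ i\<close> may be sent to
  \<open>\<chi> h * z ^ i\<close> for every \<open>z\<close> with
  \<open>z ^ k = \<chi> (g ^ k)\<close>; the freedom in choosing \<open>z\<close> later yields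
  separating characters.\<close>

lemma partial_char_extend:
  assumes pc: "partial_char q H \<chi>" and g: "coprime g q" and q: "q > 0"
    and k: "k > 0" "g ^ k \<in> H" and least: "\<And>j. 0 < j \<Longrightarrow> j < k \<Longrightarrow> g ^ j \<notin> H"
    and z: "z ^ k = \<chi> (g ^ k)"
  shows "\<exists>H' \<chi>'. partial_char q H' \<chi>' \<and> H \<subseteq> H' \<and> g \<in> H' \<and> (\<forall>n\<in>H. \<chi>' n = \<chi> n) \<and> \<chi>' g = z"
proof -
  note H1 = pc[unfolded partial_char_def, THEN conjunct1]
  have Hc: "coprime n q" "\<chi> n \<noteq> 0" if "n \<in> H" for n using pc that unfolding partial_char_def by blast+
  have Hm: "m * n \<in> H" "\<chi> (m * n) = \<chi> m * \<chi> n" if "m \<in> H" "n \<in> H" for m n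
    using pc that unfolding partial_char_def by blast+
  have Hq: "n \<in> H" "\<chi> m = \<chi> n" if "m \<in> H" "[m = n] (mod q)" for m n
    using pc that unfolding partial_char_def by blast+
  have \<chi>1: "\<chi> 1 = 1" using Hm(2)[OF H1 H1] Hc(2)[OF H1] by simp
  have Hp: "n ^ j \<in> H \<and> \<chi> (n ^ j) = \<chi> n ^ j" if "n \<in> H" for n j
    by (induction j) (use H1 \<chi>1 Hm that in auto)
  have z0: "z \<noteq> 0" using z Hc(2)[OF k(2)] k(1) by (auto simp: power_0_left)
  have cgj: "coprime (g ^ j) q" for j using g by simp
  \<comment> \<open>Elements of \<open>H\<close> can be cancelled inside \<open>H\<close>, because their inverses are powers.\<close>
  have Hcancel: "n \<in> H" if "m \<in> H" "m * n \<in> H" for m n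
  proof -
    have "m ^ (totient q - 1) * (m * n) \<in> H" using Hp Hm that by blast
    moreover have "m ^ (totient q - 1) * (m * n) = m ^ totient q * n"
      using q by (metis mult.assoc power_minus_mult totient_gt_0_iff)
    moreover have "[m ^ totient q * n = 1 * n] (mod q)"
      by (intro cong_mult euler_theorem Hc that cong_refl)
    ultimately show ?thesis using Hq(1)[of "m ^ totient q * n" n] by (simp only: mult_1_left)
  qed
  \<comment> \<open>Divide \<open>j\<close> by \<open>k\<close>: cancelling a power of
    \<open>g ^ k\<close> leaves \<open>g ^ (j mod k)\<close> in \<open>H\<close>, and minimality of
    \<open>k\<close> forces the remainder to be 0.\<close>
  have kdvd: "k dvd j" if "g ^ j \<in> H" for j
  proof -
    have "(g ^ k) ^ (j div k) \<in> H" using Hp k(2) by blast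
    moreover have "(g ^ k) ^ (j div k) * g ^ (j mod k) = g ^ j"
      by (metis mult_div_mod_eq power_add power_mult)
    ultimately have "g ^ (j mod k) \<in> H" using Hcancel that by metis
    then have "\<not> 0 < j mod k" using least[of "j mod k"] k(1) by auto
    then show ?thesis by auto
  qed
  have zval: "\<chi> (g ^ j) = z ^ j" if "g ^ j \<in> H" for j
  proof -
    obtain i where i: "j = k * i" using kdvd[OF \<open>g ^ j \<in> H\<close>] by blast
    show ?thesis using Hp[OF k(2), of i] z by (simp add: i power_mult)
  qed
  \<comment> \<open>Well-definedness: two representations of one residue differ by a power of
    \<open>g\<close> that lies in \<open>H\<close>, where \<open>\<chi>\<close> agrees with the
    power of \<open>z\<close>.\<close>
  have wd0: "\<chi> h * z ^ i = \<chi> h' * z ^ j"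
    if "h \<in> H" "h' \<in> H" "[h * g ^ i = h' * g ^ j] (mod q)" "i \<le> j" for h h' i j
  proof -
    have "[h * g ^ i = h' * g ^ (j - i) * g ^ i] (mod q)"
      using that(3,4) by (simp add: mult.assoc flip: power_add)
    then have c: "[h = h' * g ^ (j - i)] (mod q)" using cong_mult_rcancel_nat cgj by blast
    then have "h' * g ^ (j - i) \<in> H" using Hq(1) that(1) by blast
    then have G: "g ^ (j - i) \<in> H" using Hcancel that(2) by blast
    have "\<chi> h = \<chi> h' * z ^ (j - i)"
      using Hq(2)[OF that(1) c] Hm(2)[OF that(2) G] zval[OF G] by simp
    then show ?thesis using that(4) by (simp add: mult.assoc flip: power_add)
  qed
  have wd: "\<chi> h * z ^ i = \<chi> h' * z ^ j"
    if "h \<in> H" "h' \<in> H" "[h * g ^ i = h' * g ^ j] (mod q)" for h h' i j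
  proof (cases "i \<le> j")
    case True then show ?thesis using wd0 that by blast
  next
    case False
    then show ?thesis using wd0[of h' h j i] that by (auto simp: cong_sym)
  qed
  define H' where "H' = {n. \<exists>h i. h \<in> H \<and> [h * g ^ i = n] (mod q)}"
  define \<chi>' where "\<chi>' = (\<lambda>n. SOME w. \<exists>h i. h \<in> H \<and> [h * g ^ i = n] (mod q) \<and> w = \<chi> h * z ^ i)"
  have val: "\<chi>' n = \<chi> h * z ^ i" if "h \<in> H" "[h * g ^ i = n] (mod q)" for n h i
  proof -
    have "\<exists>h i. h \<in> H \<and> [h * g ^ i = n] (mod q) \<and> \<chi>' n = \<chi> h * z ^ i"
      unfolding \<chi>'_def by (rule someI_ex) (use that in blast)
    then obtain h' j where "h' \<in> H" "[h' * g ^ j = n] (mod q)" "\<chi>' n = \<chi> h' * z ^ j" by blast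
    then show ?thesis using wd[of h' h j i] that by (metis cong_sym cong_trans)
  qed
  have "partial_char q H' \<chi>'"
    unfolding partial_char_def
  proof (intro conjI ballI allI impI)
    show "1 \<in> H'"
      unfolding H'_def mem_Collect_eq by (rule exI[of _ 1], rule exI[of _ 0]) (use H1 in simp)
  next
    fix n assume "n \<in> H'"
    then obtain h i where hi: "h \<in> H" "[h * g ^ i = n] (mod q)" unfolding H'_def by blast
    have "coprime (h * g ^ i) q" using Hc(1)[OF hi(1)] cgj by simp
    then show "coprime n q" using cong_imp_coprime hi(2) by blast
    show "\<chi>' n \<noteq> 0" using val[OF hi] Hc(2)[OF hi(1)] z0 by simp
  next
    fix m n assume "m \<in> H'" "n \<in> H'"
    then obtain h i h' j where hi: "h \<in> H" "[h * g ^ i = m] (mod q)" "h' \<in> H" "[h' * g ^ j = n] (mod q)"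
      unfolding H'_def by blast
    have *: "[h * h' * g ^ (i + j) = m * n] (mod q)"
      using cong_mult[OF hi(2,4)] by (simp add: power_add mult_ac)
    then show "m * n \<in> H'" unfolding H'_def using Hm(1)[OF hi(1,3)] by blast
    show "\<chi>' (m * n) = \<chi>' m * \<chi>' n"
      using val[OF Hm(1)[OF hi(1,3)] *] val[OF hi(1,2)] val[OF hi(3,4)] Hm(2)[OF hi(1,3)]
      by (simp add: power_add mult_ac)
  next
    fix m n assume mn: "m \<in> H' \<and> [m = n] (mod q)"
    then obtain h i where hi: "h \<in> H" "[h * g ^ i = m] (mod q)" unfolding H'_def by blast
    then have *: "[h * g ^ i = n] (mod q)" using mn cong_trans by blast
    show "n \<in> H'" unfolding H'_def using hi(1) * by blast
    show "\<chi>' m = \<chi>' n" using val[OF hi] val[OF hi(1) *] by simp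
  qed
  moreover have "n \<in> H'" if "n \<in> H" for n
    unfolding H'_def mem_Collect_eq by (rule exI[of _ n], rule exI[of _ 0]) (use that in simp)
  moreover have "g \<in> H'"
    unfolding H'_def mem_Collect_eq by (rule exI[of _ 1], rule exI[of _ 1]) (use H1 in simp)
  moreover have "\<chi>' n = \<chi> n" if "n \<in> H" for n using val[of n 0 n] that by simp
  moreover have "\<chi>' g = z" using val[of 1 1 g] H1 \<chi>1 by simp
  ultimately show ?thesis by (metis subsetI)
qed

lemma ex_nth_root:
  assumes "k > 0"
  shows "\<exists>z::complex. z ^ k = w"
proof -
  have "rcis (root k (norm w)) (Arg w / k) ^ k = rcis (norm w) (Arg w)"
    using assms by (simp add: DeMoivre2)
  also have "\<dots> = w" by (rule rcis_cmod_Arg)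
  finally show ?thesis by blast
qed

text \<open>Adjoin one missing unit at a time; the number of unit residues outside \<open>H\<close>
  drops because \<open>g mod q\<close> enters. Once all units are covered, extension by 0 gives a
  character.\<close>

lemma partial_char_extend_full:
  assumes "partial_char q H \<chi>" "q > 0"
  shows "\<exists>\<psi>. dcharacter q \<psi> \<and> (\<forall>n\<in>H. \<psi> n = \<chi> n)"
  using assms(1)
proof (induction "card {n. n < q \<and> coprime n q \<and> n \<notin> H}" arbitrary: H \<chi> rule: less_induct)
  case less
  show ?case
  proof (cases "\<exists>g. coprime g q \<and> g \<notin> H")
    case True
    then obtain g where g: "coprime g q" "g \<notin> H" by blast
    have Hq: "n \<in> H" if "m \<in> H" "[m = n] (mod q)" for m n
      using less.prems that unfolding partial_char_def by blast
    have "1 \<in> H" using less.prems unfolding partial_char_def by blast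
    then have ex: "\<exists>k. k > 0 \<and> g ^ k \<in> H"
      using Hq[of 1 "g ^ totient q"] euler_theorem[OF g(1)] \<open>q > 0\<close> cong_sym totient_gt_0_iff by blast
    define k where "k = (LEAST k. k > 0 \<and> g ^ k \<in> H)"
    have k: "k > 0" "g ^ k \<in> H" using LeastI_ex[OF ex] unfolding k_def by blast+
    have lk: "g ^ j \<notin> H" if "0 < j" "j < k" for j
      using not_less_Least[of j "\<lambda>k. k > 0 \<and> g ^ k \<in> H"] that unfolding k_def by blast
    obtain z where z: "z ^ k = \<chi> (g ^ k)" using ex_nth_root[OF k(1)] by blast
    obtain H' \<chi>' where H': "partial_char q H' \<chi>'" "H \<subseteq> H'" "g \<in> H'" "\<forall>n\<in>H. \<chi>' n = \<chi> n"
      using partial_char_extend[OF less.prems g(1) \<open>q > 0\<close> k lk z] by blast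
    have gq: "g mod q \<notin> H" using Hq[of "g mod q" g] g(2) by (auto simp: cong_mod_iff)
    have gq': "g mod q \<in> H'" using H'(1,3) unfolding partial_char_def by (metis cong_mod_right cong_refl)
    have "{n. n < q \<and> coprime n q \<and> n \<notin> H'} \<subset> {n. n < q \<and> coprime n q \<and> n \<notin> H}"
      using H'(2) gq gq' g(1) \<open>q > 0\<close> by (intro psubsetI) (auto simp: set_eq_iff intro!: exI[of _ "g mod q"])
    then have "card {n. n < q \<and> coprime n q \<and> n \<notin> H'} < card {n. n < q \<and> coprime n q \<and> n \<notin> H}"
      by (intro psubset_card_mono) auto
    from less.hyps[OF this H'(1)] show ?thesis using H'(2,4) by (metis subsetD)
  next
    case False
    define \<psi> where "\<psi> = (\<lambda>n. if n \<in> H then \<chi> n else 0)"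
    have HH: "n \<in> H \<longleftrightarrow> coprime n q" for n
      using less.prems False unfolding partial_char_def by blast
    have "dcharacter q \<psi>"
      unfolding dcharacter_def
    proof (intro conjI allI)
      fix n show "\<psi> (n + q) = \<psi> n"
      proof -
        have "[n = n + q] (mod q)" "[n + q = n] (mod q)"
          by (simp_all add: cong_mod_iff)
        then show ?thesis using less.prems unfolding partial_char_def \<psi>_def by metis
      qed
    next
      fix m n show "\<psi> (m * n) = \<psi> m * \<psi> n"
        using less.prems HH unfolding partial_char_def \<psi>_def by auto
    next
      fix n show "\<psi> n \<noteq> 0 \<longleftrightarrow> coprime n q"
        using less.prems HH unfolding partial_char_def \<psi>_def by auto
    qed fact
    then show ?thesis by (auto simp: \<psi>_def)
  qed
qed

text \<open>Let \<open>k\<close> be the order of \<open>a\<close>, which is at least 2. On the class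
  of 1 all values are 1, so any \<open>k\<close>-th root of unity may serve as the value at
  \<open>a\<close>; \<open>cis (2 * pi / k)\<close> is one that differs from 1.\<close>

lemma dcharacter_separates:
  assumes "coprime a q" "q > 0" "\<not> [a = 1] (mod q)"
  shows "\<exists>\<chi>. dcharacter q \<chi> \<and> \<chi> a \<noteq> 1"
proof -
  define H where "H = {n. [n = 1] (mod q)}"
  have pc: "partial_char q H (\<lambda>_. 1)"
  proof -
    have "coprime n q" if "[n = 1] (mod q)" for n
      using cong_imp_coprime[OF cong_sym[OF that]] by simp
    moreover have "[m * n = 1] (mod q)" if "[m = 1] (mod q)" "[n = 1] (mod q)" for m n
      using cong_mult[OF that] by simp
    moreover have "[n = 1] (mod q)" if "[m = 1] (mod q)" "[m = n] (mod q)" for m n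
      using that by (simp add: cong_mod_iff)
    ultimately show ?thesis unfolding partial_char_def H_def by auto
  qed
  have ex: "\<exists>k. k > 0 \<and> a ^ k \<in> H"
    using euler_theorem[OF assms(1)] assms(2) unfolding H_def by (metis mem_Collect_eq totient_gt_0_iff)
  define k where "k = (LEAST k. k > 0 \<and> a ^ k \<in> H)"
  have k: "k > 0" "a ^ k \<in> H" using LeastI_ex[OF ex] unfolding k_def by blast+
  have lk: "a ^ j \<notin> H" if "0 < j" "j < k" for j
    using not_less_Least[of j "\<lambda>k. k > 0 \<and> a ^ k \<in> H"] that unfolding k_def by blast
  have "k \<noteq> 1" using k(2) assms(3) by (auto simp: H_def)
  then have k2: "k \<ge> 2" using k(1) by simp
  define z where "z = cis (2 * pi / k)"
  have z: "z ^ k = 1" unfolding z_def using k(1) by (simp add: DeMoivre)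
  have "z \<noteq> 1"
  proof
    assume "z = 1"
    then have "cos (2 * pi / k) = 1" unfolding z_def by (simp add: complex_eq_iff)
    moreover have "cos (2 * pi / k) < cos 0"
      using k2 by (intro cos_monotone_0_pi) (auto simp: field_simps)
    ultimately show False by simp
  qed
  obtain H' \<chi>' where H': "partial_char q H' \<chi>'" "a \<in> H'" "\<chi>' a = z"
    using partial_char_extend[OF pc assms(1,2) k lk z] by blast
  then show ?thesis using partial_char_extend_full[OF H'(1) assms(2)] \<open>z \<noteq> 1\<close> by metis
qed

section \<open>Orthogonality of characters\<close>

lemma dchars_mult:
  assumes "\<chi> \<in> dchars q" "\<psi> \<in> dchars q"
  shows "(\<lambda>n. \<chi> n * \<psi> n) \<in> dchars q"
  using assms by (auto simp: dchars_def dcharacter_def mult_ac)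

lemma dchars_cnj:
  assumes "\<chi> \<in> dchars q"
  shows "(\<lambda>n. cnj (\<chi> n)) \<in> dchars q"
  using assms by (auto simp: dchars_def dcharacter_def)

lemma norm_eq_1_cnj: "norm z = 1 \<Longrightarrow> z * cnj z = 1"
  by (simp add: complex_norm_square[symmetric])

lemma sum_dchars_eq_0:
  assumes "coprime a q" "q > 0" "\<not> [a = 1] (mod q)"
  shows "(\<Sum>\<chi>\<in>dchars q. \<chi> a) = 0"
proof -
  obtain \<psi> where \<psi>: "dcharacter q \<psi>" "\<psi> a \<noteq> 1" using dcharacter_separates[OF assms] by blast
  have \<psi>': "\<psi> \<in> dchars q" "(\<lambda>n. cnj (\<psi> n)) \<in> dchars q"
    using dchars_cnj \<psi>(1) by (auto simp: dchars_def)
  \<comment> \<open>\<open>\<psi> n * cnj (\<psi> n)\<close> is the indicator of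
    \<open>coprime n q\<close>, not 1; it acts as the identity only on functions that vanish off the
    units, as characters do. This makes multiplication by \<open>\<psi>\<close> a permutation of
    \<open>dchars q\<close>, with the conjugate as inverse.\<close>
  have n1: "\<psi> n * cnj (\<psi> n) * \<chi> n = \<chi> n" if "\<chi> \<in> dchars q" for \<chi> n
  proof (cases "coprime n q")
    case True
    then have "norm (\<psi> n) = 1" using norm_dcharacter[OF \<psi>(1), of n] by simp
    then show ?thesis by (simp add: norm_eq_1_cnj)
  next
    case False
    then have "\<chi> n = 0" using that dcharacterD(4)[of q \<chi> n] by (auto simp: dchars_def)
    then show ?thesis by simp
  qed
  have "bij_betw (\<lambda>\<chi> n. \<psi> n * \<chi> n) (dchars q) (dchars q)"
  proof (rule bij_betwI[where g = "\<lambda>\<chi> n. cnj (\<psi> n) * \<chi> n"])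
    show "(\<lambda>\<chi> n. \<psi> n * \<chi> n) \<in> dchars q \<rightarrow> dchars q"
      using dchars_mult[OF \<psi>'(1)] by blast
    show "(\<lambda>\<chi> n. cnj (\<psi> n) * \<chi> n) \<in> dchars q \<rightarrow> dchars q"
      using dchars_mult[OF \<psi>'(2)] by blast
  next
    fix \<chi> assume "\<chi> \<in> dchars q"
    note n1 = n1[OF this]
    show "(\<lambda>n. cnj (\<psi> n) * (\<psi> n * \<chi> n)) = \<chi>"
      "(\<lambda>n. \<psi> n * (cnj (\<psi> n) * \<chi> n)) = \<chi>"
      using n1 by (simp_all only: fun_eq_iff mult.assoc[symmetric] mult.commute[of "cnj _" "\<psi> _"] simp_thms)
  qed
  from sum.reindex_bij_betw[OF this, of "\<lambda>\<chi>. \<chi> a"]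
  have "\<psi> a * (\<Sum>\<chi>\<in>dchars q. \<chi> a) = (\<Sum>\<chi>\<in>dchars q. \<chi> a)"
    by (simp add: sum_distrib_left)
  then have "(\<psi> a - 1) * (\<Sum>\<chi>\<in>dchars q. \<chi> a) = 0" by (simp add: algebra_simps)
  with \<psi>(2) show ?thesis by simp
qed

section \<open>Sums over residues and the number of characters\<close>

lemma bij_betw_mult_mod:
  assumes "coprime b q" "(q::nat) > 0"
  shows "bij_betw (\<lambda>n. (b * n) mod q) {..<q} {..<q}"
proof -
  have "inj_on (\<lambda>n. (b * n) mod q) {..<q}"
  proof (rule inj_onI)
    fix m n assume mn: "m \<in> {..<q}" "n \<in> {..<q}" "(b * m) mod q = (b * n) mod q"
    then have "[b * m = b * n] (mod q)" by (simp add: cong_mod_iff)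
    then have "[m = n] (mod q)" using assms(1) cong_mult_lcancel_nat by blast
    then show "m = n" using mn by (simp add: cong_mod_iff)
  qed
  moreover have "(\<lambda>n. (b * n) mod q) ` {..<q} \<subseteq> {..<q}" using assms(2) by auto
  ultimately show ?thesis using endo_inj_surj[of "{..<q}"] by (simp add: bij_betw_def)
qed

lemma sum_mult_mod:
  assumes "coprime b q" "(q::nat) > 0" "\<And>n. F (n mod q) = F n"
  shows "(\<Sum>n<q. F (b * n)) = (\<Sum>n<q. F n :: complex)"
  using sum.reindex_bij_betw[OF bij_betw_mult_mod[OF assms(1,2)], of F] assms(3) by simp

lemma card_coprime_lessThan: "card {n. n < q \<and> coprime n q} = totient q"
proof (cases "q \<le> 1")
  case True
  then have "q = 0 \<or> q = 1" by auto
  then show ?thesis by (auto simp: lessThan_Suc)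
next
  case False
  have "{n. n < q \<and> coprime n q} = totatives q"
    using False totatives_less[of _ q] by (force simp: in_totatives_iff intro!: Nat.gr0I)
  then show ?thesis by (simp add: totient_def)
qed

lemma sum_dcharacter_lessThan:
  assumes "dcharacter q \<chi>"
  shows "(\<Sum>n<q. \<chi> n) = (if \<forall>n. coprime n q \<longrightarrow> \<chi> n = 1 then of_nat (totient q) else 0)"
proof (cases "\<forall>n. coprime n q \<longrightarrow> \<chi> n = 1")
  case True
  then have "\<chi> n = (if coprime n q then 1 else 0)" for n using dcharacterD(4)[OF assms, of n] by auto
  then have "(\<Sum>n<q. \<chi> n) = of_nat (card {n. n < q \<and> coprime n q})" by (simp add: sum.If_cases Int_def)
  then show ?thesis using True card_coprime_lessThan by simp
next
  case False
  then obtain b where b: "coprime b q" "\<chi> b \<noteq> 1" by blast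
  have "(\<Sum>n<q. \<chi> (b * n)) = (\<Sum>n<q. \<chi> n)"
    using sum_mult_mod[OF b(1) dcharacterD(1)[OF assms], of \<chi>] dcharacter_mod[OF assms] by blast
  then have "\<chi> b * (\<Sum>n<q. \<chi> n) = (\<Sum>n<q. \<chi> n)"
    by (simp add: dcharacterD(3)[OF assms] sum_distrib_left)
  then have "(\<chi> b - 1) * (\<Sum>n<q. \<chi> n) = 0" by (simp only: left_diff_distrib) simp
  then show ?thesis using b by auto
qed

definition principal :: "nat \<Rightarrow> nat \<Rightarrow> complex" where
  "principal q n = (if coprime n q then 1 else 0)"

lemma coprime_add_self: "coprime (n + q) q \<longleftrightarrow> coprime n (q::nat)"
  by (simp only: coprime_iff_gcd_eq_1 gcd_add1)

lemma principal_in_dchars: "q > 0 \<Longrightarrow> principal q \<in> dchars q"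
  by (auto simp: dchars_def dcharacter_def principal_def coprime_add_self)

text \<open>Double counting of the sum of \<open>\<chi> n\<close> over all characters and residues:
  over the residues only the principal character has a nonzero sum, namely \<open>totient q\<close>;
  over the characters only the class of 1 does, namely their number.\<close>

lemma card_dchars:
  assumes "q > 0"
  shows "card (dchars q) = totient q"
proof -
  have *: "(\<forall>n. coprime n q \<longrightarrow> \<chi> n = 1) \<longleftrightarrow> \<chi> = principal q" if "\<chi> \<in> dchars q" for \<chi>
  proof -
    have "\<chi> n = 0" if "\<not> coprime n q" for n
      using \<open>\<chi> \<in> dchars q\<close> dcharacterD(4)[of q \<chi> n] that by (auto simp: dchars_def)
    then show ?thesis unfolding principal_def fun_eq_iff by metis
  qed
  have "(\<Sum>\<chi>\<in>dchars q. \<Sum>n<q. \<chi> n) = (\<Sum>\<chi>\<in>dchars q. if \<chi> = principal q then of_nat (totient q) else 0)"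
  proof (intro sum.cong refl)
    fix \<chi> assume "\<chi> \<in> dchars q"
    with sum_dcharacter_lessThan[of q \<chi>] *[of \<chi>]
    show "(\<Sum>n<q. \<chi> n) = (if \<chi> = principal q then of_nat (totient q) else 0)"
      by (simp add: dchars_def)
  qed
  also have "\<dots> = of_nat (totient q)" using principal_in_dchars[OF assms] by simp
  also have "(\<Sum>\<chi>\<in>dchars q. \<Sum>n<q. \<chi> n) = (\<Sum>n<q. \<Sum>\<chi>\<in>dchars q. \<chi> n)" by (rule sum.swap)
  finally have "(\<Sum>n<q. \<Sum>\<chi>\<in>dchars q. \<chi> n) = of_nat (totient q)" .
  \<comment> \<open>\<open>1 mod q\<close> rather than 1, because for \<open>q = 1\<close> the class
    of 1 has the representative 0.\<close>
  moreover have "(\<Sum>\<chi>\<in>dchars q. \<chi> n) = (if n = 1 mod q then of_nat (card (dchars q)) else 0)"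
    if "n < q" for n
  proof (cases "n = 1 mod q")
    case True
    have "\<chi> n = 1" if "\<chi> \<in> dchars q" for \<chi>
      using that dcharacter_mod[of q \<chi> 1] dcharacter_1[of q \<chi>] True by (auto simp: dchars_def)
    then have "(\<Sum>\<chi>\<in>dchars q. \<chi> n) = (\<Sum>\<chi>\<in>dchars q. 1)" by (intro sum.cong refl)
    then show ?thesis by (subst if_P[OF True]) simp
  next
    case False
    show ?thesis
    proof (cases "coprime n q")
      case True
      have "\<not> [n = 1] (mod q)" using False \<open>n < q\<close> by (simp add: cong_mod_iff)
      then show ?thesis using sum_dchars_eq_0[OF True assms] False by simp
    next
      case ncop: False
      have "\<chi> n = 0" if "\<chi> \<in> dchars q" for \<chi>
        using that dcharacterD(4)[of q \<chi> n] ncop by (auto simp: dchars_def)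
      then have "(\<Sum>\<chi>\<in>dchars q. \<chi> n) = 0" by (intro sum.neutral ballI)
      then show ?thesis by (subst if_not_P[OF False])
    qed
  qed
  ultimately have "(\<Sum>n<q. if n = 1 mod q then of_nat (card (dchars q)) else 0) = (of_nat (totient q) :: complex)"
    by simp
  moreover have "1 mod q < q" using assms by (rule mod_less_divisor)
  ultimately show ?thesis
    by (simp only: sum.delta finite_lessThan lessThan_iff if_True of_nat_eq_iff)
qed

lemma dcharacter_cnj_inverse:
  assumes "dcharacter q \<chi>" "coprime n q"
  shows "cnj (\<chi> n) = \<chi> (n ^ (totient q - 1))"
proof -
  have "totient q > 0" using dcharacterD(1)[OF assms(1)] by simp
  then have "\<chi> (n ^ (totient q - 1)) * \<chi> n = 1"
    using dcharacter_totient[OF assms] by (simp only: dcharacter_power[OF assms(1)] power_minus_mult)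
  moreover have "\<chi> n * cnj (\<chi> n) = 1"
    using norm_dcharacter[OF assms(1), of n] assms(2) by (intro norm_eq_1_cnj) simp
  ultimately show ?thesis by (metis mult.assoc mult.left_neutral mult.right_neutral)
qed

lemma dchars_orthogonality:
  assumes "q > 0" "coprime a q"
  shows "(\<Sum>\<chi>\<in>dchars q. \<chi> a * cnj (\<chi> n)) = (if [n = a] (mod q) then of_nat (totient q) else 0)"
proof (cases "coprime n q")
  case False
  then have "\<not> [n = a] (mod q)" using assms(2) cong_imp_coprime cong_sym by blast
  moreover have "\<chi> n = 0" if "\<chi> \<in> dchars q" for \<chi>
    using that dcharacterD(4)[of q \<chi> n] False by (auto simp: dchars_def)
  then have "(\<Sum>\<chi>\<in>dchars q. \<chi> a * cnj (\<chi> n)) = 0" by (intro sum.neutral ballI) simp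
  ultimately show ?thesis by simp
next
  case True
  define m where "m = n ^ (totient q - 1)"
  have mn: "[m * n = 1] (mod q)"
    using euler_theorem[OF True] assms(1) unfolding m_def by (metis power_minus_mult totient_gt_0_iff)
  have "(\<Sum>\<chi>\<in>dchars q. \<chi> a * cnj (\<chi> n)) = (\<Sum>\<chi>\<in>dchars q. \<chi> (a * m))"
    by (intro sum.cong refl)
       (auto simp: dchars_def dcharacter_cnj_inverse[OF _ True] dcharacterD(3) m_def)
  moreover have "[a * m = 1] (mod q) \<longleftrightarrow> [n = a] (mod q)"
  proof
    assume "[a * m = 1] (mod q)"
    then have "[a * m * n = 1 * n] (mod q)" by (intro cong_mult cong_refl)
    moreover have "[a * (m * n) = a * 1] (mod q)" using mn by (intro cong_mult cong_refl)
    ultimately show "[n = a] (mod q)" by (metis cong_sym cong_trans mult.assoc mult_1 mult_1_right)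
  next
    assume "[n = a] (mod q)"
    then have "[m * n = m * a] (mod q)" by (intro cong_mult cong_refl)
    then show "[a * m = 1] (mod q)" using mn by (metis cong_sym cong_trans mult.commute)
  qed
  moreover have "coprime (a * m) q" unfolding m_def using assms(2) True by simp
  moreover have "(\<Sum>\<chi>\<in>dchars q. \<chi> (a * m)) = of_nat (totient q)" if "[a * m = 1] (mod q)"
  proof -
    have "\<chi> (a * m) = 1" if "\<chi> \<in> dchars q" for \<chi>
      using dcharacter_cong[of q \<chi> "a * m" 1] dcharacter_1[of q \<chi>] that \<open>[a * m = 1] (mod q)\<close>
      by (auto simp: dchars_def)
    then have "(\<Sum>\<chi>\<in>dchars q. \<chi> (a * m)) = (\<Sum>\<chi>\<in>dchars q. 1)" by (intro sum.cong refl)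
    then show ?thesis using card_dchars[OF assms(1)] by simp
  qed
  ultimately show ?thesis using sum_dchars_eq_0[of "a * m" q, OF _ assms(1)] by (simp split: if_split)
qed

section \<open>Primitive characters and Gauss sums\<close>

lemma induced_by_refl: "dcharacter q \<chi> \<Longrightarrow> induced_by q \<chi> q \<chi>"
  by (simp add: induced_by_def)

lemma induced_by_trans:
  assumes "induced_by c \<theta> d \<psi>" "induced_by d \<psi> q \<chi>"
  shows "induced_by c \<theta> q \<chi>"
  using assms unfolding induced_by_def by (metis coprime_divisors dvd_refl dvd_trans)

lemma ex_inducing_primitive:
  assumes "dcharacter q \<chi>"
  shows "\<exists>d \<psi>. induced_by d \<psi> q \<chi> \<and> primitive_dcharacter d \<psi>"
proof -
  have ex: "\<exists>d \<psi>. induced_by d \<psi> q \<chi>" using induced_by_refl[OF assms] by blast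
  define d where "d = conductor q \<chi>"
  obtain \<psi> where \<psi>: "induced_by d \<psi> q \<chi>"
    using LeastI_ex[OF ex] unfolding d_def conductor_def by blast
  have "dcharacter d \<psi>" using \<psi> unfolding induced_by_def by blast
  moreover have "conductor d \<psi> = d"
    unfolding conductor_def
  proof (rule Least_equality)
    show "\<exists>\<theta>. induced_by d \<theta> d \<psi>" using induced_by_refl[OF \<open>dcharacter d \<psi>\<close>] by blast
  next
    fix c assume "\<exists>\<theta>. induced_by c \<theta> d \<psi>"
    then have "\<exists>\<theta>. induced_by c \<theta> q \<chi>" using induced_by_trans[OF _ \<psi>] by blast
    then show "d \<le> c" unfolding d_def conductor_def by (rule Least_le)
  qed
  ultimately show ?thesis using \<psi> unfolding primitive_dcharacter_def by blast
qed

text \<open>Add to \<open>n\<close> the multiple \<open>d * t\<close>, with \<open>t\<close> the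
  product of the primes dividing \<open>q\<close> but not \<open>n\<close>. A prime of
  \<open>q\<close> then divides exactly one of \<open>n\<close> and \<open>d * t\<close>, hence not
  their sum.\<close>

lemma ex_coprime_in_class:
  assumes "coprime n d" "(q::nat) > 0"
  shows "\<exists>m. [m = n] (mod d) \<and> coprime m q"
proof -
  define t where "t = \<Prod>{p. prime p \<and> p dvd q \<and> \<not> p dvd n}"
  have fin: "finite {p. prime p \<and> p dvd q \<and> \<not> p dvd n}"
    by (rule finite_subset[of _ "{..q}"]) (use assms(2) in \<open>auto dest: dvd_imp_le\<close>)
  have "\<not> p dvd n + d * t" if p: "prime p" "p dvd q" for p
  proof (cases "p dvd n")
    case True
    have "\<not> p dvd d" using assms(1) True p(1) by (metis coprime_common_divisor not_prime_unit)
    moreover have "\<not> p dvd t"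
      unfolding t_def using p(1) True
      by (subst prime_dvd_prod_iff[OF fin p(1)]) (auto dest: primes_dvd_imp_eq)
    ultimately have "\<not> p dvd d * t" using p(1) by (simp add: prime_dvd_mult_iff)
    then show ?thesis using True by (simp add: dvd_add_right_iff)
  next
    case False
    then have "p dvd t" unfolding t_def using p fin by (intro dvd_prodI) auto
    then have "p dvd d * t" by simp
    then show ?thesis using False by (simp add: dvd_add_left_iff)
  qed
  then have "coprime (n + d * t) q"
    using prime_factor_nat[of "gcd (n + d * t) q"] unfolding coprime_iff_gcd_eq_1 gcd_greatest_iff
    by blast
  moreover have "[n + d * t = n] (mod d)" by (simp add: cong_mod_iff)
  ultimately show ?thesis by blast
qed

text \<open>Triviality on the kernel of reduction modulo \<open>d\<close> makes
  \<open>\<chi>\<close> depend only on the residue modulo \<open>d\<close>; every unit class modulo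
  \<open>d\<close> has a representative coprime to \<open>q\<close>, through which the character
  descends. The contrapositive supplies, for a primitive character and a proper divisor
  \<open>d\<close>, an element of the kernel where the character is not 1.\<close>

lemma induced_by_if_trivial_on_kernel:
  assumes \<chi>: "dcharacter q \<chi>" and d: "d dvd q"
    and triv: "\<And>c. coprime c q \<Longrightarrow> [c = 1] (mod d) \<Longrightarrow> \<chi> c = 1"
  shows "\<exists>\<psi>. induced_by d \<psi> q \<chi>"
proof -
  have q: "q > 0" using dcharacterD(1)[OF \<chi>] .
  have d0: "d > 0" using d q by (auto intro: Nat.gr0I)
  have eq: "\<chi> m = \<chi> n" if mn: "coprime m q" "coprime n q" "[m = n] (mod d)" for m n
  proof -
    define k where "k = n ^ (totient q - 1)"
    have k: "[k * n = 1] (mod q)" unfolding k_def using euler_theorem[OF mn(2)] q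
      by (metis power_minus_mult totient_gt_0_iff)
    have "[k * m = k * n] (mod d)" using mn(3) by (intro cong_mult cong_refl)
    then have "[k * m = 1] (mod d)" using cong_dvd_modulus_nat[OF k d] cong_trans by blast
    then have "\<chi> (k * m) = 1" using mn unfolding k_def by (intro triv) auto
    moreover have "\<chi> (k * n) = 1" using dcharacter_cong[OF \<chi> k] dcharacter_1[OF \<chi>] by simp
    ultimately have "\<chi> k * \<chi> m = 1" "\<chi> k * \<chi> n = 1" by (simp_all add: dcharacterD(3)[OF \<chi>])
    then have "\<chi> k \<noteq> 0" "\<chi> k * \<chi> m = \<chi> k * \<chi> n" by auto
    then show ?thesis by simp
  qed
  define r where "r = (\<lambda>n. SOME m. [m = n] (mod d) \<and> coprime m q)"
  have r: "[r n = n] (mod d)" "coprime (r n) q" if "coprime n d" for n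
    using someI_ex[OF ex_coprime_in_class[OF that q]] unfolding r_def by blast+
  define \<psi> where "\<psi> = (\<lambda>n. if coprime n d then \<chi> (r n) else 0)"
  have \<psi>: "\<psi> n = \<chi> m" if "coprime m q" "[m = n] (mod d)" "coprime n d" for m n
  proof -
    have "[r n = m] (mod d)" using cong_trans[OF r(1)[OF that(3)] cong_sym[OF that(2)]] .
    then show ?thesis using eq[OF r(2)[OF that(3)] that(1)] that(3) by (simp add: \<psi>_def)
  qed
  have "dcharacter d \<psi>"
    unfolding dcharacter_def
  proof (intro conjI allI)
    fix n
    show "\<psi> (n + d) = \<psi> n"
    proof (cases "coprime n d")
      case True
      have "[r n = n + d] (mod d)"
        using r(1)[OF True] by (simp add: cong_mod_iff)
      then have "\<psi> (n + d) = \<chi> (r n)" using \<psi>[of "r n" "n + d"] r(2)[OF True] True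
        by (simp add: coprime_add_self)
      then show ?thesis using True by (simp add: \<psi>_def)
    qed (simp add: \<psi>_def coprime_add_self)
    show "\<psi> n \<noteq> 0 \<longleftrightarrow> coprime n d"
      unfolding \<psi>_def using r(2)[of n] dcharacterD(4)[OF \<chi>] by auto
  next
    fix m n
    show "\<psi> (m * n) = \<psi> m * \<psi> n"
    proof (cases "coprime m d \<and> coprime n d")
      case True
      then have "\<psi> (m * n) = \<chi> (r m * r n)"
        by (intro \<psi> cong_mult r) (auto simp: r)
      then show ?thesis using True by (simp add: \<psi>_def dcharacterD(3)[OF \<chi>])
    qed (auto simp: \<psi>_def)
  qed (rule d0)
  moreover have "\<chi> n = \<psi> n" if "coprime n q" for n
    using \<psi>[of n n] that d by (metis cong_refl coprime_divisors dvd_refl)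
  ultimately show ?thesis using d \<chi> unfolding induced_by_def by blast
qed

definition primitives :: "nat \<Rightarrow> (nat \<Rightarrow> complex) set" where
  "primitives r = {\<psi>. primitive_dcharacter r \<psi>}"

lemma primitives_subset: "primitives r \<subseteq> dchars r"
  by (auto simp: primitives_def primitive_dcharacter_def dchars_def)

lemma finite_primitives [simp]: "finite (primitives r)"
  using primitives_subset finite_dchars finite_subset by blast

lemma primitivesD: "\<psi> \<in> primitives r \<Longrightarrow> dcharacter r \<psi>"
  using primitives_subset by (auto simp: dchars_def)

section \<open>Additive characters and Gauss sums\<close>

definition add_char :: "nat \<Rightarrow> nat \<Rightarrow> complex" where
  "add_char r n = cis (2 * pi * n / r)"

lemma add_char_add: "add_char r (m + n) = add_char r m * add_char r n"
  by (simp add: add_char_def cis_mult add_divide_distrib distrib_left)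

lemma add_char_mult_self: "add_char r (r * k) = 1"
proof (cases "r = 0")
  case False
  then have "2 * pi * real (r * k) / real r = 2 * pi * real k" by simp
  then show ?thesis unfolding add_char_def by (simp only: cis_multiple_2pi[OF Ints_of_nat])
qed (simp add: add_char_def)

lemma add_char_mod: "add_char r (n mod r) = add_char r n"
  using add_char_add[of r "r * (n div r)" "n mod r"] add_char_mult_self[of r "n div r"] by simp

lemma add_char_cong: "[m = n] (mod r) \<Longrightarrow> add_char r m = add_char r n"
  using add_char_mod[of r m] add_char_mod[of r n] by (simp add: cong_mod_iff)

lemma norm_add_char [simp]: "norm (add_char r n) = 1"
  by (simp add: add_char_def)

definition gauss :: "nat \<Rightarrow> (nat \<Rightarrow> complex) \<Rightarrow> nat \<Rightarrow> complex" where
  "gauss r \<chi> n = (\<Sum>b<r. \<chi> b * add_char r (b * n))"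

lemma gauss_coprime:
  assumes \<chi>: "dcharacter r \<chi>" and n: "coprime n r"
  shows "\<chi> n * gauss r \<chi> n = gauss r \<chi> 1"
proof -
  define F where "F = (\<lambda>b. \<chi> b * add_char r b)"
  have F: "F (b mod r) = F b" for b by (simp add: F_def dcharacter_mod[OF \<chi>] add_char_mod)
  have "\<chi> n * gauss r \<chi> n = (\<Sum>b<r. F (n * b))"
    by (simp add: gauss_def F_def sum_distrib_left dcharacterD(3)[OF \<chi>] mult_ac)
  also have "\<dots> = (\<Sum>b<r. F b)" by (rule sum_mult_mod[where F = F, OF n dcharacterD(1)[OF \<chi>] F])
  also have "\<dots> = gauss r \<chi> 1" by (simp add: gauss_def F_def)
  finally show ?thesis .
qed

text \<open>With \<open>g = gcd n r\<close>, primitivity gives a unit \<open>c\<close> congruent to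
  1 modulo \<open>r div g\<close> with \<open>\<chi> c \<noteq> 1\<close>. Substituting
  \<open>c * b\<close> for \<open>b\<close> leaves the additive factor alone, since
  \<open>c * n\<close> and \<open>n\<close> agree modulo \<open>r\<close>, and multiplies the sum by
  \<open>\<chi> c\<close>.\<close>

lemma gauss_not_coprime:
  assumes prim: "\<chi> \<in> primitives r" and n: "\<not> coprime n r"
  shows "gauss r \<chi> n = 0"
proof -
  have \<chi>: "dcharacter r \<chi>" using primitivesD[OF prim] .
  have r: "r > 0" using dcharacterD(1)[OF \<chi>] .
  define g where "g = gcd n r"
  define d where "d = r div g"
  have g: "g > 1" using n r unfolding g_def by (metis coprime_iff_gcd_eq_1 gcd_eq_0_iff less_one linorder_neqE_nat not_gr_zero)
  have rdg: "r = d * g" unfolding d_def g_def by simp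
  then have d: "d dvd r" "d < r" using g r by auto
  have "\<not> (\<exists>\<psi>. induced_by d \<psi> r \<chi>)"
  proof
    assume "\<exists>\<psi>. induced_by d \<psi> r \<chi>"
    then have "conductor r \<chi> \<le> d" unfolding conductor_def by (rule Least_le)
    then show False using prim d(2) by (simp add: primitives_def primitive_dcharacter_def)
  qed
  then obtain c where c: "coprime c r" "[c = 1] (mod d)" "\<chi> c \<noteq> 1"
    using induced_by_if_trivial_on_kernel[OF \<chi> d(1)] by blast
  have "g dvd n" unfolding g_def by simp
  then obtain n' where n': "n = g * n'" by blast
  have "(c * g) mod (d * g) = (1 * g) mod (d * g)"
    using c(2) by (simp only: mod_mult_mult2 cong_mod_iff)
  then have "[c * g = g] (mod r)" by (simp add: cong_mod_iff rdg)
  then have "[c * g * n' = g * n'] (mod r)" by (intro cong_mult cong_refl)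
  then have cn: "[c * n = n] (mod r)" by (simp add: n' mult_ac)
  define F where "F = (\<lambda>b. \<chi> b * add_char r (b * n))"
  have F: "F (b mod r) = F b" for b
  proof -
    have "add_char r (b mod r * n) = add_char r (b * n)"
      by (rule add_char_cong) (simp add: cong_mod_iff mod_mult_left_eq)
    then show ?thesis by (simp add: F_def dcharacter_mod[OF \<chi>])
  qed
  have "F (c * b) = \<chi> c * F b" for b
  proof -
    have "[c * n * b = n * b] (mod r)" using cn by (intro cong_mult cong_refl)
    then have "add_char r (c * b * n) = add_char r (b * n)" by (intro add_char_cong) (simp add: mult_ac)
    then show ?thesis by (simp add: F_def dcharacterD(3)[OF \<chi>])
  qed
  then have "\<chi> c * (\<Sum>b<r. F b) = (\<Sum>b<r. F (c * b))" by (simp add: sum_distrib_left)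
  also have "\<dots> = (\<Sum>b<r. F b)" by (rule sum_mult_mod[where F = F, OF c(1) r F])
  finally have "(\<chi> c - 1) * (\<Sum>b<r. F b) = 0" by (simp add: algebra_simps)
  then show ?thesis using c(3) by (simp add: gauss_def F_def)
qed

lemma gauss_separable:
  assumes "\<chi> \<in> primitives r"
  shows "gauss r \<chi> n = cnj (\<chi> n) * gauss r \<chi> 1"
proof (cases "coprime n r")
  case True
  have \<chi>: "dcharacter r \<chi>" using primitivesD[OF assms] .
  have "cnj (\<chi> n) * (\<chi> n * gauss r \<chi> n) = gauss r \<chi> n"
    using norm_eq_1_cnj[of "\<chi> n"] norm_dcharacter[OF \<chi>, of n] True by (simp add: mult_ac)
  then show ?thesis using gauss_coprime[OF \<chi> True] by simp
next
  case False
  then show ?thesis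
    using gauss_not_coprime[OF assms False] dcharacterD(4)[OF primitivesD[OF assms], of n] by auto
qed

lemma sum_add_char:
  assumes "r > 0"
  shows "(\<Sum>n<r. add_char r (b * n) * cnj (add_char r (c * n))) = (if [b = c] (mod r) then of_nat r else 0)"
proof -
  define z where "z = add_char r b * cnj (add_char r c)"
  have pw: "add_char r (k * n) = add_char r k ^ n" for k n
    by (induction n) (simp_all add: add_char_add, simp add: add_char_def)
  have "(\<Sum>n<r. add_char r (b * n) * cnj (add_char r (c * n))) = (\<Sum>n<r. z ^ n)"
    by (simp add: pw z_def power_mult_distrib)
  moreover have "z ^ r = 1"
    using add_char_mult_self[of r b] add_char_mult_self[of r c]
    by (simp add: z_def power_mult_distrib flip: pw complex_cnj_power) (simp add: mult_ac)
  moreover have "z = 1 \<longleftrightarrow> [b = c] (mod r)"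
  proof
    assume "[b = c] (mod r)"
    then have "add_char r b = add_char r c" by (rule add_char_cong)
    then show "z = 1" using norm_eq_1_cnj[OF norm_add_char[of r c]] by (simp add: z_def)
  next
    assume "z = 1"
    then have "add_char r b * cnj (add_char r c) * add_char r c = add_char r c" by (simp add: z_def)
    then have e: "add_char r b = add_char r c" using norm_eq_1_cnj[OF norm_add_char[of r c]] by (simp add: mult_ac)
    then have "add_char r (b mod r) = add_char r (c mod r)" by (simp add: add_char_mod)
    moreover have "inj_on (\<lambda>k. cis (2 * pi * real k / real r)) {..<r}"
      using bij_betw_roots_unity[OF assms] by (rule bij_betw_imp_inj_on)
    ultimately show "[b = c] (mod r)"
      using assms unfolding add_char_def by (auto simp: inj_on_def cong_mod_iff)
  qed
  ultimately show ?thesis using geometric_sum[of z r] by auto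
qed

text \<open>Compute the sum over \<open>n\<close> of the squared absolute values of
  \<open>gauss r \<chi> n\<close> in two ways: separability gives \<open>totient r\<close> times the
  wanted quantity, orthogonality of additive characters gives \<open>totient r * r\<close>.\<close>

lemma norm_gauss:
  assumes "\<chi> \<in> primitives r"
  shows "norm (gauss r \<chi> 1) ^ 2 = r"
proof -
  have \<chi>: "dcharacter r \<chi>" using primitivesD[OF assms] .
  have r: "r > 0" using dcharacterD(1)[OF \<chi>] .
  have sn: "(\<Sum>n<r. \<chi> n * cnj (\<chi> n)) = of_nat (totient r)"
  proof -
    have "\<chi> n * cnj (\<chi> n) = (if coprime n r then 1 else 0)" for n
      using norm_eq_1_cnj[of "\<chi> n"] norm_dcharacter[OF \<chi>, of n] by auto
    then have "(\<Sum>n<r. \<chi> n * cnj (\<chi> n)) = of_nat (card {n. n < r \<and> coprime n r})"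
      by (simp add: sum.If_cases Int_def)
    then show ?thesis by (simp add: card_coprime_lessThan)
  qed
  define G where "G = gauss r \<chi> 1"
  have "(\<Sum>n<r. gauss r \<chi> n * cnj (gauss r \<chi> n)) = (\<Sum>n<r. (G * cnj G) * (\<chi> n * cnj (\<chi> n)))"
    by (intro sum.cong refl) (subst (1 2) gauss_separable[OF assms], simp add: G_def mult_ac)
  also have "\<dots> = G * cnj G * of_nat (totient r)" by (simp only: sn flip: sum_distrib_left)
  finally have 1: "(\<Sum>n<r. gauss r \<chi> n * cnj (gauss r \<chi> n)) = G * cnj G * of_nat (totient r)" .
  have "(\<Sum>n<r. gauss r \<chi> n * cnj (gauss r \<chi> n)) =
        (\<Sum>n<r. \<Sum>b<r. \<Sum>c<r. \<chi> b * cnj (\<chi> c) * (add_char r (b * n) * cnj (add_char r (c * n))))"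
    unfolding gauss_def cnj_sum sum_product by (intro sum.cong refl) (simp add: mult_ac)
  also have "\<dots> = (\<Sum>b<r. \<Sum>n<r. \<Sum>c<r. \<chi> b * cnj (\<chi> c) * (add_char r (b * n) * cnj (add_char r (c * n))))"
    by (rule sum.swap)
  also have "\<dots> = (\<Sum>b<r. \<Sum>c<r. \<Sum>n<r. \<chi> b * cnj (\<chi> c) * (add_char r (b * n) * cnj (add_char r (c * n))))"
    by (rule sum.cong[OF refl], rule sum.swap)
  also have "\<dots> = (\<Sum>b<r. \<Sum>c<r. if b = c then \<chi> b * cnj (\<chi> c) * of_nat r else 0)"
    by (intro sum.cong refl)
       (simp only: sum_distrib_left[symmetric] sum_add_char[OF r], auto simp: cong_mod_iff)
  also have "\<dots> = (\<Sum>b<r. \<chi> b * cnj (\<chi> b)) * of_nat r" by (simp add: sum_distrib_right)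
  also have "\<dots> = of_nat (totient r) * of_nat r" by (simp only: sn)
  finally have "G * cnj G * of_nat (totient r) = of_nat r * of_nat (totient r)" using 1 by simp
  then have "G * cnj G = of_nat r" using r by simp
  then have "complex_of_real (norm G ^ 2) = complex_of_real (real r)"
    by (simp only: complex_norm_square of_real_of_nat_eq)
  then show ?thesis unfolding G_def of_real_eq_iff .
qed

section \<open>The additive large sieve\<close>

text \<open>A weak form of Jordan's inequality, with slope \<open>1 / pi\<close> instead of
  \<open>2 / pi\<close>. The cut at \<open>pi / 3\<close> is where \<open>cos\<close> falls to one
  half while \<open>sin\<close> already exceeds it.\<close>

lemma sin_ge_div_pi:
  assumes "0 \<le> s" "s \<le> pi / 2"
  shows "s / pi \<le> sin s"
proof (cases "s \<le> pi / 3")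
  case True
  have "1/2 * s \<le> sin s"
  proof (cases "s = 0")
    case False
    with assms have "s > 0" by simp
    from MVT2[OF this, of sin cos] obtain z where z: "0 < z" "z < s" "sin s - sin 0 = (s - 0) * cos z"
      by auto
    have "cos (pi / 3) \<le> cos z" using z True by (intro cos_monotone_0_pi_le) auto
    then have "1/2 \<le> cos z" by (simp add: cos_60)
    then have "s * (1/2) \<le> s * cos z" using assms by (intro mult_left_mono) auto
    then show ?thesis using z(3) by simp
  qed simp
  moreover have "s / pi \<le> 1/2 * s"
    using assms pi_ge_two mult_right_mono[of 2 pi s] by (simp add: field_simps)
  ultimately show ?thesis by linarith
next
  case False
  have "sin (pi / 3) \<le> sin s" using False assms by (intro sin_monotone_2pi_le) auto
  then have "1/2 \<le> sin s" by (simp add: sin_60 order_trans[rotated])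
  moreover have "s / pi \<le> 1/2" using assms by (simp add: field_simps)
  ultimately show ?thesis by linarith
qed

lemma norm_1_minus_cis:
  assumes "\<bar>u\<bar> \<le> 1/2"
  shows "2 * \<bar>u\<bar> \<le> norm (1 - cis (2 * pi * u))"
proof -
  have c: "cos (2 * pi * u) = 1 - 2 * sin (pi * \<bar>u\<bar>) ^ 2"
  proof -
    have "cos (2 * pi * u) = cos (2 * (pi * \<bar>u\<bar>))" by (cases "u \<ge> 0") (simp_all add: mult.assoc)
    then show ?thesis by (simp only: cos_double_sin)
  qed
  have "norm (1 - cis (2 * pi * u)) ^ 2 = (1 - cos (2 * pi * u))\<^sup>2 + (sin (2 * pi * u))\<^sup>2"
    by (simp add: cmod_power2)
  also have "\<dots> = 2 - 2 * cos (2 * pi * u)"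
    using sin_cos_squared_add[of "2 * pi * u"] by (simp add: power2_eq_square algebra_simps)
  also have "\<dots> = (2 * sin (pi * \<bar>u\<bar>)) ^ 2" by (simp add: c power_mult_distrib)
  finally have eq: "norm (1 - cis (2 * pi * u)) ^ 2 = (2 * sin (pi * \<bar>u\<bar>)) ^ 2" .
  have "pi * \<bar>u\<bar> \<le> pi * (1/2)" using assms by (intro mult_left_mono) auto
  then have s: "\<bar>u\<bar> \<le> sin (pi * \<bar>u\<bar>)" using sin_ge_div_pi[of "pi * \<bar>u\<bar>"] by simp
  then have "norm (1 - cis (2 * pi * u)) = 2 * sin (pi * \<bar>u\<bar>)"
    using power2_eq_imp_eq[OF eq] by simp
  then show ?thesis using s by simp
qed

text \<open>The absolute value of the Dirichlet kernel; it is even and has period 1 in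
  \<open>u\<close>.\<close>

definition dker :: "nat \<Rightarrow> real \<Rightarrow> real" where
  "dker K u = norm (\<Sum>m<K. cis (2 * pi * (real m * u)))"

lemma dker_nonneg: "dker K u \<ge> 0"
  by (simp add: dker_def)

lemma dker_le: "dker K u \<le> K"
  unfolding dker_def by (rule order_trans[OF norm_sum]) simp

lemma dker_uminus: "dker K (- u) = dker K u"
proof -
  have "(\<Sum>m<K. cis (2 * pi * (real m * (- u)))) = cnj (\<Sum>m<K. cis (2 * pi * (real m * u)))"
    by (simp add: cis_cnj)
  then show ?thesis unfolding dker_def by (simp only: complex_mod_cnj)
qed

lemma cis_add_int: "cis (2 * pi * (real m * (u + of_int k))) = cis (2 * pi * (real m * u))"
proof -
  have "cis (2 * pi * (real m * (u + of_int k))) = cis (2 * pi * (real m * u)) * cis (2 * pi * of_int (int m * k))"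
    by (simp add: cis_mult algebra_simps)
  also have "cis (2 * pi * of_int (int m * k)) = 1" by (rule cis_multiple_2pi) simp
  finally show ?thesis by simp
qed

lemma dker_add_int: "dker K (u + of_int k) = dker K u"
  unfolding dker_def by (simp only: cis_add_int)

lemma dker_le_inverse:
  assumes "\<bar>u\<bar> \<le> 1/2" "u \<noteq> 0"
  shows "dker K u \<le> 1 / \<bar>u\<bar>"
proof -
  define z where "z = cis (2 * pi * u)"
  have n: "2 * \<bar>u\<bar> \<le> norm (1 - z)" unfolding z_def by (rule norm_1_minus_cis[OF assms(1)])
  then have "z \<noteq> 1" using assms(2) by auto
  have "(\<Sum>m<K. cis (2 * pi * (real m * u))) = (\<Sum>m<K. z ^ m)"
    by (simp add: z_def DeMoivre mult_ac)
  also have "\<dots> = (z ^ K - 1) / (z - 1)" using geometric_sum[OF \<open>z \<noteq> 1\<close>] .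
  finally have "dker K u = norm (z ^ K - 1) / norm (1 - z)"
    by (simp add: dker_def norm_divide norm_minus_commute)
  also have "norm (z ^ K - 1) \<le> norm (z ^ K) + norm (1::complex)" by (rule norm_triangle_ineq4)
  then have "norm (z ^ K - 1) / norm (1 - z) \<le> 2 / norm (1 - z)"
    by (intro divide_right_mono) (simp_all add: z_def norm_power)
  also have "\<dots> \<le> 2 / (2 * \<bar>u\<bar>)" using n assms(2) by (intro divide_left_mono) (auto intro!: mult_pos_pos)
  finally show ?thesis by simp
qed

lemma sum_inverse_squares: "(\<Sum>n\<in>{1..M}. 1 / real n ^ 2) \<le> 2"
proof -
  have "(\<Sum>n\<in>{1..Suc M}. 1 / real n ^ 2) \<le> 2 - 1 / real (Suc M)"
  proof (induction M)
    case (Suc M)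
    define a where "a = real (Suc M)"
    have a: "a > 0" by (simp add: a_def)
    have "1 / (a + 1) ^ 2 \<le> 1 / (a * (a + 1))"
      using a by (intro divide_left_mono) (auto simp: power2_eq_square)
    also have "\<dots> = 1 / a - 1 / (a + 1)" using a by (simp add: field_simps)
    finally show ?case using Suc by (simp add: a_def add.commute)
  qed simp
  moreover have "(\<Sum>n\<in>{1..M}. 1 / real n ^ 2) \<le> (\<Sum>n\<in>{1..Suc M}. 1 / real n ^ 2)"
    by (intro sum_mono2) auto
  moreover have "0 \<le> 1 / real (Suc M)" by simp
  ultimately show ?thesis by linarith
qed

text \<open>Spacing on the circle of reals modulo 1; ranging over all integers \<open>k\<close>
  stands in for the distance to the nearest integer.\<close>

definition separated :: "real \<Rightarrow> real set \<Rightarrow> bool" where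
  "separated \<delta> T \<longleftrightarrow> (\<forall>\<alpha>\<in>T. \<forall>\<beta>\<in>T. \<alpha> \<noteq> \<beta> \<longrightarrow> (\<forall>k::int. \<delta> \<le> \<bar>\<alpha> - \<beta> - of_int k\<bar>))"

text \<open>Reduce each difference to the interval from -1/2 to 1/2 and cut the line into cells of
  length \<open>\<delta>\<close>. Separation puts at most one point in each cell. The two cells next
  to 0 contribute at most \<open>K ^ 2\<close> each, and the \<open>n\<close>-th further cell on
  either side at most \<open>1 / (\<delta> * n) ^ 2\<close>, which sums to at most
  \<open>2 / \<delta> ^ 2\<close> per side.\<close>

lemma sum_dker_le:
  assumes T: "finite T" "separated \<delta> T" "\<alpha> \<in> T" and \<delta>: "\<delta> > 0"
  shows "(\<Sum>\<beta>\<in>T. dker K (\<alpha> - \<beta>) ^ 2) \<le> 2 * real K ^ 2 + 4 / \<delta> ^ 2"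
proof -
  define u where "u = (\<lambda>\<beta>. (\<alpha> - \<beta>) - of_int (round (\<alpha> - \<beta>)))"
  define t where "t = (\<lambda>\<beta>. \<lfloor>u \<beta> / \<delta>\<rfloor>)"
  define h :: "nat \<Rightarrow> real" where "h = (\<lambda>n. if n = 0 then real K ^ 2 else 1 / (\<delta> * n) ^ 2)"
  \<comment> \<open>The number of whole cells between cell \<open>j\<close> and 0; cells 0 and -1
    both touch 0 and get index 0. It is injective on each half-line, hence the later split by the
    sign of \<open>j\<close>.\<close>
  define idx where "idx = (\<lambda>j::int. if j \<ge> 0 then nat j else nat (- 1 - j))"
  have h0: "h n \<ge> 0" for n by (simp add: h_def)
  have dk: "dker K (\<alpha> - \<beta>) ^ 2 \<le> h (idx (t \<beta>))" for \<beta>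
  proof -
    have "dker K (\<alpha> - \<beta>) = dker K (u \<beta>)"
      using dker_add_int[of K "u \<beta>" "round (\<alpha> - \<beta>)"] by (simp add: u_def)
    moreover have u2: "\<bar>u \<beta>\<bar> \<le> 1/2"
      using of_int_round_abs_le[of "\<alpha> - \<beta>"] by (simp add: u_def abs_minus_commute)
    moreover have "dker K (u \<beta>) ^ 2 \<le> h (idx (t \<beta>))"
    proof (cases "idx (t \<beta>) = 0")
      case True
      then show ?thesis using dker_le[of K "u \<beta>"] dker_nonneg[of K "u \<beta>"]
        by (simp add: h_def power_mono)
    next
      case False
      have "of_int (t \<beta>) \<le> u \<beta> / \<delta>" "u \<beta> / \<delta> < of_int (t \<beta>) + 1"
        unfolding t_def by linarith+
      then have fl: "of_int (t \<beta>) * \<delta> \<le> u \<beta>" "u \<beta> < (of_int (t \<beta>) + 1) * \<delta>"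
        by (simp_all only: pos_le_divide_eq[OF \<delta>] pos_divide_less_eq[OF \<delta>])
      have u: "\<delta> * real (idx (t \<beta>)) \<le> \<bar>u \<beta>\<bar>"
      proof (cases "t \<beta> \<ge> 0")
        case True
        then show ?thesis using fl(1) by (simp add: idx_def mult.commute)
      next
        case neg: False
        then have "real (idx (t \<beta>)) = - (of_int (t \<beta>) + 1)" by (simp add: idx_def)
        then have "\<delta> * real (idx (t \<beta>)) = - ((of_int (t \<beta>) + 1) * \<delta>)"
          by (simp only: minus_mult_left mult.commute)
        then show ?thesis using fl(2) by linarith
      qed
      have pos: "\<delta> * real (idx (t \<beta>)) > 0" using False \<delta> by simp
      then have "u \<beta> \<noteq> 0" using u by auto
      from dker_le_inverse[OF u2 this, of K] have "dker K (u \<beta>) \<le> 1 / \<bar>u \<beta>\<bar>" .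
      also have "\<dots> \<le> 1 / (\<delta> * real (idx (t \<beta>)))"
        using frac_le[OF _ _ pos u, of 1 1] by simp
      finally have "dker K (u \<beta>) ^ 2 \<le> (1 / (\<delta> * real (idx (t \<beta>)))) ^ 2"
        by (intro power_mono dker_nonneg)
      then show ?thesis using False by (simp add: h_def power_divide)
    qed
    ultimately show ?thesis by simp
  qed
  have inj: "inj_on t T"
  proof (rule inj_onI)
    fix \<beta> \<gamma> assume bg: "\<beta> \<in> T" "\<gamma> \<in> T" "t \<beta> = t \<gamma>"
    then have "\<bar>u \<beta> / \<delta> - u \<gamma> / \<delta>\<bar> < 1" unfolding t_def by (intro floor_eq_imp_diff_1)
    then have "\<bar>u \<beta> - u \<gamma>\<bar> < \<delta>" using \<delta> by (simp add: field_simps abs_if split: if_splits)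
    moreover have "u \<beta> - u \<gamma> = \<gamma> - \<beta> - of_int (round (\<alpha> - \<beta>) - round (\<alpha> - \<gamma>))"
      by (simp add: u_def)
    ultimately show "\<beta> = \<gamma>" using T(2) bg(1,2) unfolding separated_def by (metis not_le)
  qed
  define M where "M = Max (insert 0 (idx ` t ` T))"
  have M: "idx (t \<beta>) \<le> M" if "\<beta> \<in> T" for \<beta>
    unfolding M_def using T(1) that by (intro Max_ge) auto
  have hM: "(\<Sum>n\<le>M. h n) \<le> real K ^ 2 + 2 / \<delta> ^ 2"
  proof -
    have "{..M} = insert 0 {1..M}" by auto
    then have "(\<Sum>n\<le>M. h n) = real K ^ 2 + (\<Sum>n\<in>{1..M}. h n)" by (simp add: h_def)
    also have "(\<Sum>n\<in>{1..M}. h n) = (\<Sum>n\<in>{1..M}. 1 / real n ^ 2) / \<delta> ^ 2"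
      unfolding sum_divide_distrib
      by (intro sum.cong refl) (auto simp: h_def power_mult_distrib mult.commute)
    also have "\<dots> \<le> 2 / \<delta> ^ 2" using sum_inverse_squares \<delta> by (intro divide_right_mono) auto
    finally show ?thesis by simp
  qed
  have part: "(\<Sum>j\<in>S. h (idx j)) \<le> real K ^ 2 + 2 / \<delta> ^ 2"
    if "inj_on idx S" "finite S" "S \<subseteq> t ` T" for S
  proof -
    have "(\<Sum>j\<in>S. h (idx j)) = (\<Sum>n\<in>idx ` S. h n)" using sum.reindex[OF that(1), of h] by simp
    also have "\<dots> \<le> (\<Sum>n\<le>M. h n)" using that M h0 by (intro sum_mono2) auto
    finally show ?thesis using hM by simp
  qed
  have "(\<Sum>\<beta>\<in>T. dker K (\<alpha> - \<beta>) ^ 2) \<le> (\<Sum>\<beta>\<in>T. h (idx (t \<beta>)))" by (intro sum_mono dk)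
  also have "\<dots> = (\<Sum>j\<in>t ` T. h (idx j))" using sum.reindex[OF inj, of "\<lambda>j. h (idx j)"] by simp
  also have "\<dots> = (\<Sum>j\<in>{j\<in>t ` T. j \<ge> 0}. h (idx j)) + (\<Sum>j\<in>{j\<in>t ` T. j < 0}. h (idx j))"
    using T(1) by (subst sum.union_disjoint[symmetric]) (auto intro!: sum.cong)
  also have "\<dots> \<le> (real K ^ 2 + 2 / \<delta> ^ 2) + (real K ^ 2 + 2 / \<delta> ^ 2)"
    by (intro add_mono part) (use T(1) in \<open>auto simp: inj_on_def idx_def\<close>)
  finally show ?thesis by simp
qed

lemma complex_norm_square': "complex_of_real (norm z ^ 2) = z * cnj z"
  using complex_norm_square[of z] by simp

text \<open>Squaring the kernel makes it decay like an inverse square, so that its sum over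
  separated points loses no logarithm. The square enters by averaging: every \<open>n\<close> from
  \<open>K\<close> to \<open>2 * K - 1\<close> is \<open>m + m'\<close> with
  \<open>m, m' < 2 * K\<close> in at least \<open>K\<close> ways, so \<open>K\<close> times the sum
  over this window is at most a double sum, whose expansion contains the square of the kernel of
  length \<open>2 * K\<close>. The constant is 12 = 8 + 4, from \<open>2 * (2 * K) ^ 2\<close> and
  \<open>4 / \<delta> ^ 2 \<le> 4 * K ^ 2\<close>.\<close>

lemma dual_large_sieve:
  fixes c :: "real \<Rightarrow> complex"
  assumes T: "finite T" "separated \<delta> T" and \<delta>: "\<delta> > 0" and K: "real K * \<delta> \<ge> 1"
  shows "(\<Sum>n<K. norm (\<Sum>\<alpha>\<in>T. c \<alpha> * cis (2 * pi * (real n * \<alpha>))) ^ 2) \<le> 12 * K * (\<Sum>\<alpha>\<in>T. norm (c \<alpha>) ^ 2)"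
proof -
  define e where "e = (\<lambda>x::real. cis (2 * pi * x))"
  have e_add: "e (x + y) = e x * e y" for x y by (simp add: e_def cis_mult distrib_left)
  \<comment> \<open>The phase moves the window \<open>0..K - 1\<close> to
    \<open>K..2 * K - 1\<close>, which the averaging covers fully, without changing absolute
    values.\<close>
  define d where "d = (\<lambda>\<alpha>. c \<alpha> * e (- (real K * \<alpha>)))"
  define F where "F = (\<lambda>n::nat. \<Sum>\<alpha>\<in>T. d \<alpha> * e (real n * \<alpha>))"
  have FK: "F (K + n) = (\<Sum>\<alpha>\<in>T. c \<alpha> * cis (2 * pi * (real n * \<alpha>)))" for n
  proof -
    have "e (real (K + n) * \<alpha>) = e (real K * \<alpha>) * e (real n * \<alpha>)" for \<alpha> by (simp add: e_add[symmetric] algebra_simps)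
    moreover have "e (- (real K * \<alpha>)) * e (real K * \<alpha>) = 1" for \<alpha> by (simp add: e_add[symmetric]) (simp add: e_def)
    ultimately have "d \<alpha> * e (real (K + n) * \<alpha>) = c \<alpha> * e (real n * \<alpha>)" for \<alpha>
      by (simp add: d_def mult.assoc)
    then show ?thesis by (simp add: F_def e_def)
  qed
  have nd: "norm (d \<alpha>) = norm (c \<alpha>)" for \<alpha> by (simp add: d_def e_def norm_mult)
  define S where "S = (\<Sum>\<alpha>\<in>T. norm (c \<alpha>) ^ 2)"
  define Z where "Z = (\<Sum>n<K. norm (F (K + n)) ^ 2)"
  define W where "W = (\<Sum>m<2*K. \<Sum>m'<2*K. norm (F (m + m')) ^ 2)"
  have "real K * Z = (\<Sum>m<K. Z)" by simp
  also have "\<dots> \<le> (\<Sum>m<K. \<Sum>m'<2*K. norm (F (m + m')) ^ 2)"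
  proof (intro sum_mono)
    fix m assume m: "m \<in> {..<K}"
    have "Z = (\<Sum>m'\<in>{K - m..<2 * K - m}. norm (F (m + m')) ^ 2)"
      unfolding Z_def using m
      by (intro sum.reindex_bij_witness[of _ "\<lambda>i. i + m - K" "\<lambda>n. n + K - m"]) (auto simp: add.commute)
    also have "\<dots> \<le> (\<Sum>m'<2*K. norm (F (m + m')) ^ 2)" by (intro sum_mono2) auto
    finally show "Z \<le> (\<Sum>m'<2*K. norm (F (m + m')) ^ 2)" .
  qed
  also have "\<dots> \<le> W" unfolding W_def by (intro sum_mono2 sum_nonneg) auto
  finally have ZW: "real K * Z \<le> W" .
  define g where "g = (\<lambda>u. \<Sum>m<2*K. e (real m * u))"
  have gsq: "g u ^ 2 = (\<Sum>m<2*K. \<Sum>m'<2*K. e (real m * u) * e (real m' * u))" for u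
    unfolding g_def power2_eq_square by (rule sum_product)
  have ng: "norm (g u) = dker (2 * K) u" for u by (simp add: g_def e_def dker_def)
  have FF: "F n * cnj (F n) = (\<Sum>\<alpha>\<in>T. \<Sum>\<beta>\<in>T. d \<alpha> * cnj (d \<beta>) * e (real n * (\<alpha> - \<beta>)))" for n
    unfolding F_def cnj_sum sum_product
  proof (intro sum.cong refl)
    fix \<alpha> \<beta>
    have "e (real n * (\<alpha> - \<beta>)) = e (real n * \<alpha>) * cnj (e (real n * \<beta>))"
      by (simp add: e_def cis_cnj cis_mult algebra_simps)
    then show "d \<alpha> * e (real n * \<alpha>) * cnj (d \<beta> * e (real n * \<beta>)) = d \<alpha> * cnj (d \<beta>) * e (real n * (\<alpha> - \<beta>))"
      by (simp add: mult_ac)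
  qed
  define U where "U = (\<lambda>\<alpha> \<beta> (m::nat) (m'::nat). d \<alpha> * cnj (d \<beta>) * (e (real m * (\<alpha> - \<beta>)) * e (real m' * (\<alpha> - \<beta>))))"
  have "complex_of_real W = (\<Sum>m<2*K. \<Sum>m'<2*K. F (m + m') * cnj (F (m + m')))"
    unfolding W_def of_real_sum complex_norm_square' ..
  also have "\<dots> = (\<Sum>m<2*K. \<Sum>m'<2*K. \<Sum>\<alpha>\<in>T. \<Sum>\<beta>\<in>T. U \<alpha> \<beta> m m')"
    unfolding FF U_def by (simp add: e_add distrib_right)
  also have "\<dots> = (\<Sum>m<2*K. \<Sum>\<alpha>\<in>T. \<Sum>m'<2*K. \<Sum>\<beta>\<in>T. U \<alpha> \<beta> m m')"
    by (rule sum.cong[OF refl], rule sum.swap)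
  also have "\<dots> = (\<Sum>\<alpha>\<in>T. \<Sum>m<2*K. \<Sum>m'<2*K. \<Sum>\<beta>\<in>T. U \<alpha> \<beta> m m')"
    by (rule sum.swap)
  also have "\<dots> = (\<Sum>\<alpha>\<in>T. \<Sum>m<2*K. \<Sum>\<beta>\<in>T. \<Sum>m'<2*K. U \<alpha> \<beta> m m')"
    by (rule sum.cong[OF refl], rule sum.cong[OF refl], rule sum.swap)
  also have "\<dots> = (\<Sum>\<alpha>\<in>T. \<Sum>\<beta>\<in>T. \<Sum>m<2*K. \<Sum>m'<2*K. U \<alpha> \<beta> m m')"
    by (rule sum.cong[OF refl], rule sum.swap)
  also have "\<dots> = (\<Sum>\<alpha>\<in>T. \<Sum>\<beta>\<in>T. d \<alpha> * cnj (d \<beta>) * g (\<alpha> - \<beta>) ^ 2)"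
    by (simp only: U_def gsq sum_distrib_left)
  finally have "norm (complex_of_real W) \<le> (\<Sum>\<alpha>\<in>T. norm (\<Sum>\<beta>\<in>T. d \<alpha> * cnj (d \<beta>) * g (\<alpha> - \<beta>) ^ 2))"
    by (simp only: norm_sum)
  also have "\<dots> \<le> (\<Sum>\<alpha>\<in>T. \<Sum>\<beta>\<in>T. norm (d \<alpha> * cnj (d \<beta>) * g (\<alpha> - \<beta>) ^ 2))"
    by (intro sum_mono norm_sum)
  \<comment> \<open>The inequality of arithmetic and geometric means decouples the two coefficients;
    as the kernel is even, both halves are the same sum.\<close>
  also have "\<dots> \<le> (\<Sum>\<alpha>\<in>T. \<Sum>\<beta>\<in>T. (norm (c \<alpha>) ^ 2 / 2) * dker (2 * K) (\<alpha> - \<beta>) ^ 2 +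
       (norm (c \<beta>) ^ 2 / 2) * dker (2 * K) (\<beta> - \<alpha>) ^ 2)"
  proof (intro sum_mono)
    fix \<alpha> \<beta>
    have "norm (d \<alpha> * cnj (d \<beta>) * g (\<alpha> - \<beta>) ^ 2) = (norm (c \<alpha>) * norm (c \<beta>)) * dker (2 * K) (\<alpha> - \<beta>) ^ 2"
      by (simp add: norm_mult norm_power nd ng)
    also have "\<dots> \<le> (norm (c \<alpha>) ^ 2 / 2 + norm (c \<beta>) ^ 2 / 2) * dker (2 * K) (\<alpha> - \<beta>) ^ 2"
      using sum_squares_bound[of "norm (c \<alpha>)" "norm (c \<beta>)"] by (intro mult_right_mono) auto
    finally show "norm (d \<alpha> * cnj (d \<beta>) * g (\<alpha> - \<beta>) ^ 2) \<le> (norm (c \<alpha>) ^ 2 / 2) * dker (2 * K) (\<alpha> - \<beta>) ^ 2 +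
       (norm (c \<beta>) ^ 2 / 2) * dker (2 * K) (\<beta> - \<alpha>) ^ 2"
      using dker_uminus[of "2 * K" "\<alpha> - \<beta>"] by (simp add: distrib_right)
  qed
  also have "\<dots> = (\<Sum>\<alpha>\<in>T. \<Sum>\<beta>\<in>T. (norm (c \<alpha>) ^ 2 / 2) * dker (2 * K) (\<alpha> - \<beta>) ^ 2) +
       (\<Sum>\<alpha>\<in>T. \<Sum>\<beta>\<in>T. (norm (c \<beta>) ^ 2 / 2) * dker (2 * K) (\<beta> - \<alpha>) ^ 2)"
    by (simp only: sum.distrib)
  also have "(\<Sum>\<alpha>\<in>T. \<Sum>\<beta>\<in>T. (norm (c \<beta>) ^ 2 / 2) * dker (2 * K) (\<beta> - \<alpha>) ^ 2) =
       (\<Sum>\<alpha>\<in>T. \<Sum>\<beta>\<in>T. (norm (c \<alpha>) ^ 2 / 2) * dker (2 * K) (\<alpha> - \<beta>) ^ 2)"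
    by (rule sum.swap)
  also have "(\<Sum>\<alpha>\<in>T. \<Sum>\<beta>\<in>T. (norm (c \<alpha>) ^ 2 / 2) * dker (2 * K) (\<alpha> - \<beta>) ^ 2) +
       (\<Sum>\<alpha>\<in>T. \<Sum>\<beta>\<in>T. (norm (c \<alpha>) ^ 2 / 2) * dker (2 * K) (\<alpha> - \<beta>) ^ 2) =
       (\<Sum>\<alpha>\<in>T. norm (c \<alpha>) ^ 2 * (\<Sum>\<beta>\<in>T. dker (2 * K) (\<alpha> - \<beta>) ^ 2))"
    by (simp add: sum_distrib_left flip: sum.distrib)
  also have "\<dots> \<le> (\<Sum>\<alpha>\<in>T. norm (c \<alpha>) ^ 2 * (2 * real (2 * K) ^ 2 + 4 / \<delta> ^ 2))"
    by (intro sum_mono mult_left_mono sum_dker_le T \<delta>) auto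
  also have "\<dots> = (2 * real (2 * K) ^ 2 + 4 / \<delta> ^ 2) * S" by (simp add: S_def sum_distrib_right mult.commute[of "_ + _"])
  also have "\<dots> \<le> (12 * real K ^ 2) * S"
  proof (intro mult_right_mono)
    have "(1 / \<delta>) ^ 2 \<le> real K ^ 2" using K \<delta> by (intro power_mono) (auto simp: field_simps)
    then show "2 * real (2 * K) ^ 2 + 4 / \<delta> ^ 2 \<le> 12 * real K ^ 2" by (simp add: power_divide power_mult_distrib)
  qed (simp add: S_def sum_nonneg)
  finally have "W \<le> 12 * real K ^ 2 * S" by simp
  with ZW have "real K * Z \<le> real K * (12 * real K * S)" by (simp add: power2_eq_square mult_ac)
  moreover have "real K > 0" using K \<delta> by (cases "K = 0") auto
  ultimately have "Z \<le> 12 * real K * S" by simp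
  then show ?thesis unfolding Z_def S_def FK .
qed

text \<open>Duality. Writing one factor of each square as a conjugate turns the left side
  \<open>X\<close> into a sum of \<open>a n * B n\<close>. Cauchy-Schwarz and the dual inequality
  with coefficients \<open>cnj (S \<alpha>)\<close> bound \<open>X ^ 2\<close> by the right side
  times \<open>X\<close>, and one \<open>X\<close> cancels.\<close>

lemma additive_large_sieve:
  fixes a :: "nat \<Rightarrow> complex"
  assumes T: "finite T" "separated \<delta> T" and \<delta>: "\<delta> > 0" and K: "real K * \<delta> \<ge> 1"
  shows "(\<Sum>\<alpha>\<in>T. norm (\<Sum>n<K. a n * cis (2 * pi * (real n * \<alpha>))) ^ 2) \<le> 12 * K * (\<Sum>n<K. norm (a n) ^ 2)"
proof -
  define S where "S = (\<lambda>\<alpha>::real. \<Sum>n<K. a n * cis (2 * pi * (real n * \<alpha>)))"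
  define X where "X = (\<Sum>\<alpha>\<in>T. norm (S \<alpha>) ^ 2)"
  define B where "B = (\<lambda>n::nat. \<Sum>\<alpha>\<in>T. cnj (S \<alpha>) * cis (2 * pi * (real n * \<alpha>)))"
  have X0: "X \<ge> 0" unfolding X_def by (intro sum_nonneg) auto
  have "complex_of_real X = (\<Sum>\<alpha>\<in>T. \<Sum>n<K. a n * (cnj (S \<alpha>) * cis (2 * pi * (real n * \<alpha>))))"
    unfolding X_def of_real_sum complex_norm_square'
  proof (intro sum.cong refl)
    fix \<alpha>
    have "S \<alpha> * cnj (S \<alpha>) = (\<Sum>n<K. a n * cis (2 * pi * (real n * \<alpha>))) * cnj (S \<alpha>)" by (simp add: S_def)
    also have "\<dots> = (\<Sum>n<K. a n * (cnj (S \<alpha>) * cis (2 * pi * (real n * \<alpha>))))"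
      unfolding sum_distrib_right by (intro sum.cong refl) (simp add: mult_ac)
    finally show "S \<alpha> * cnj (S \<alpha>) = (\<Sum>n<K. a n * (cnj (S \<alpha>) * cis (2 * pi * (real n * \<alpha>))))" .
  qed
  also have "\<dots> = (\<Sum>n<K. a n * B n)"
    unfolding B_def sum_distrib_left by (rule sum.swap)
  finally have "X = norm (\<Sum>n<K. a n * B n)" using X0 by (metis norm_of_real abs_of_nonneg)
  also have "\<dots> \<le> (\<Sum>n<K. norm (a n * B n))" by (rule norm_sum)
  also have "\<dots> = (\<Sum>n<K. \<bar>norm (a n)\<bar> * \<bar>norm (B n)\<bar>)" by (simp add: norm_mult)
  also have "\<dots> \<le> L2_set (\<lambda>n. norm (a n)) {..<K} * L2_set (\<lambda>n. norm (B n)) {..<K}"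
    by (rule L2_set_mult_ineq)
  finally have "X ^ 2 \<le> (L2_set (\<lambda>n. norm (a n)) {..<K} * L2_set (\<lambda>n. norm (B n)) {..<K}) ^ 2"
    using X0 by (intro power_mono)
  also have "\<dots> = (\<Sum>n<K. norm (a n) ^ 2) * (\<Sum>n<K. norm (B n) ^ 2)"
    by (simp add: L2_set_def power_mult_distrib sum_nonneg)
  also have "(\<Sum>n<K. norm (B n) ^ 2) \<le> 12 * K * X"
    unfolding B_def X_def using dual_large_sieve[OF assms, of "\<lambda>\<alpha>. cnj (S \<alpha>)"] by simp
  then have "(\<Sum>n<K. norm (a n) ^ 2) * (\<Sum>n<K. norm (B n) ^ 2) \<le> (\<Sum>n<K. norm (a n) ^ 2) * (12 * K * X)"
    by (intro mult_left_mono sum_nonneg) auto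
  finally have "X * X \<le> (12 * K * (\<Sum>n<K. norm (a n) ^ 2)) * X" by (simp add: power2_eq_square mult_ac)
  moreover have "0 \<le> 12 * K * (\<Sum>n<K. norm (a n) ^ 2)" by (intro mult_nonneg_nonneg sum_nonneg) auto
  ultimately have "X \<le> 12 * K * (\<Sum>n<K. norm (a n) ^ 2)"
    using X0 by (cases "X = 0") (auto simp: mult_le_cancel_right)
  then show ?thesis by (simp add: X_def S_def)
qed

text \<open>The quantity inside the absolute value is an integer divided by \<open>r * r'\<close>.
  That integer is nonzero, because two distinct points of the half-open unit interval never differ
  by an integer.\<close>

lemma farey_separated:
  fixes r r' b b' R :: nat
  assumes "real b / r \<noteq> real b' / r'" "b < r" "b' < r'" "r \<le> R" "r' \<le> R"
  shows "1 / real R ^ 2 \<le> \<bar>real b / r - real b' / r' - of_int k\<bar>"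
proof -
  define z where "z = int b * int r' - int b' * int r - k * int r * int r'"
  have r: "real r > 0" "real r' > 0" using assms by auto
  have eq: "real b / r - real b' / r' - of_int k = of_int z / (real r * real r')"
    using r by (simp add: z_def field_simps)
  have "z \<noteq> 0"
  proof
    assume "z = 0"
    then have k: "real b / r - real b' / r' = of_int k" using eq by simp
    have "0 \<le> real b / r" "real b / r < 1" "0 \<le> real b' / r'" "real b' / r' < 1"
      using assms by auto
    with k have "\<bar>real_of_int k\<bar> < 1" by linarith
    then have "k = 0" by linarith
    then show False using k assms(1) by simp
  qed
  then have "1 \<le> \<bar>real_of_int z\<bar>" by linarith
  then have "1 / (real r * real r') \<le> \<bar>of_int z / (real r * real r')\<bar>"
    using r by (simp add: abs_divide abs_mult divide_right_mono)
  moreover have "1 / real R ^ 2 \<le> 1 / (real r * real r')"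
    unfolding power2_eq_square using r assms(4,5) by (intro divide_left_mono mult_mono mult_pos_pos) auto
  ultimately show ?thesis unfolding eq by linarith
qed

lemma farey_large_sieve:
  fixes a :: "nat \<Rightarrow> complex"
  assumes R: "R > 0"
  shows "(\<Sum>r\<in>{1..R}. \<Sum>b | b < r \<and> coprime b r. norm (\<Sum>n<N. a n * add_char r (b * n)) ^ 2)
    \<le> 12 * (N + real R ^ 2) * (\<Sum>n<N. norm (a n) ^ 2)"
proof -
  define I where "I = Sigma {1..R} (\<lambda>r. {b. b < r \<and> coprime b r})"
  define v where "v = (\<lambda>(r::nat, b::nat). real b / real r)"
  define T where "T = v ` I"
  \<comment> \<open>Padding with zeros to length \<open>N + R ^ 2\<close> meets the condition
    \<open>K * \<delta> \<ge> 1\<close> for \<open>\<delta> = 1 / R ^ 2\<close>; this is where the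
    factor \<open>N + R ^ 2\<close> comes from.\<close>
  define K where "K = N + R ^ 2"
  define a' where "a' = (\<lambda>n. if n < N then a n else 0)"
  have finI: "finite I" unfolding I_def by auto
  have inj: "inj_on v I"
  proof (rule inj_onI)
    fix x y assume xy: "x \<in> I" "y \<in> I" "v x = v y"
    obtain r b r' b' where x: "x = (r, b)" "y = (r', b')" by (metis surj_pair)
    have pos: "real r > 0" "real r' > 0" using xy x by (auto simp: I_def)
    have "real b * real r' = real b' * real r" using xy(3) pos by (simp add: x v_def field_simps)
    then have eq: "b * r' = b' * r" by (metis of_nat_eq_iff of_nat_mult)
    have c: "coprime b r" "coprime b' r'" using xy x by (auto simp: I_def)
    have "r dvd b * r'" "r' dvd b' * r" using eq by (metis dvd_triv_right)+
    then have "r dvd r'" "r' dvd r"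
      using c by (simp_all add: coprime_dvd_mult_right_iff coprime_commute)
    then have "r = r'" by (rule dvd_antisym)
    then show "x = y" using eq pos x by simp
  qed
  have sep: "separated (1 / real R ^ 2) T"
    unfolding separated_def T_def
  proof (intro ballI impI allI)
    fix \<alpha> \<beta> k assume "\<alpha> \<in> v ` I" "\<beta> \<in> v ` I" "\<alpha> \<noteq> \<beta>"
    then show "1 / real R ^ 2 \<le> \<bar>\<alpha> - \<beta> - real_of_int k\<bar>"
      using farey_separated by (auto simp: v_def I_def)
  qed
  have "(\<Sum>r\<in>{1..R}. \<Sum>b | b < r \<and> coprime b r. norm (\<Sum>n<N. a n * add_char r (b * n)) ^ 2)
      = (\<Sum>x\<in>I. norm (\<Sum>n<K. a' n * cis (2 * pi * (real n * v x))) ^ 2)"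
    unfolding I_def
  proof (subst sum.Sigma, force, force, intro sum.cong refl)
    fix x assume "x \<in> Sigma {1..R} (\<lambda>r. {b. b < r \<and> coprime b r})"
    obtain r b where x: "x = (r, b)" by (metis surj_pair)
    have "(\<Sum>n<K. a' n * cis (2 * pi * (real n * v x))) = (\<Sum>n<N. a' n * cis (2 * pi * (real n * v x)))"
      by (rule sum.mono_neutral_right) (auto simp: K_def a'_def)
    also have "\<dots> = (\<Sum>n<N. a n * add_char r (b * n))"
      by (intro sum.cong refl) (simp add: a'_def x v_def add_char_def mult_ac)
    finally show "(case x of (r, b) \<Rightarrow> (norm (\<Sum>n<N. a n * add_char r (b * n)))\<^sup>2) =
        (norm (\<Sum>n<K. a' n * cis (2 * pi * (real n * v x))))\<^sup>2" by (simp add: x)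
  qed
  also have "\<dots> = (\<Sum>\<alpha>\<in>T. norm (\<Sum>n<K. a' n * cis (2 * pi * (real n * \<alpha>))) ^ 2)"
    unfolding T_def by (subst sum.reindex[OF inj]) simp
  also have "\<dots> \<le> 12 * real K * (\<Sum>n<K. norm (a' n) ^ 2)"
    by (rule additive_large_sieve[OF _ sep]) (use finI R in \<open>auto simp: T_def K_def field_simps\<close>)
  also have "(\<Sum>n<K. norm (a' n) ^ 2) = (\<Sum>n<N. norm (a n) ^ 2)"
    by (rule sum.mono_neutral_cong_right) (auto simp: K_def a'_def)
  finally show ?thesis by (simp add: K_def)
qed

section \<open>The multiplicative large sieve\<close>

lemma dchars_orthogonality':
  assumes "r > 0"
  shows "(\<Sum>\<chi>\<in>dchars r. \<chi> b * cnj (\<chi> c)) = (if coprime b r \<and> [c = b] (mod r) then of_nat (totient r) else 0)"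
proof (cases "coprime b r")
  case False
  have "\<chi> b = 0" if "\<chi> \<in> dchars r" for \<chi>
    using that dcharacterD(4)[of r \<chi> b] False by (auto simp: dchars_def)
  then show ?thesis using False by (simp add: sum.neutral)
qed (simp add: dchars_orthogonality[OF assms])

lemma dchars_parseval:
  assumes "r > 0"
  shows "(\<Sum>\<chi>\<in>dchars r. norm (\<Sum>b<r. \<chi> b * s b) ^ 2) = totient r * (\<Sum>b | b < r \<and> coprime b r. norm (s b) ^ 2)"
proof -
  have "complex_of_real (\<Sum>\<chi>\<in>dchars r. norm (\<Sum>b<r. \<chi> b * s b) ^ 2) =
     (\<Sum>\<chi>\<in>dchars r. \<Sum>b<r. \<Sum>c<r. (s b * cnj (s c)) * (\<chi> b * cnj (\<chi> c)))"
    unfolding of_real_sum complex_norm_square' cnj_sum sum_product by (intro sum.cong refl) (simp add: mult_ac)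
  also have "\<dots> = (\<Sum>b<r. \<Sum>\<chi>\<in>dchars r. \<Sum>c<r. (s b * cnj (s c)) * (\<chi> b * cnj (\<chi> c)))"
    by (rule sum.swap)
  also have "\<dots> = (\<Sum>b<r. \<Sum>c<r. \<Sum>\<chi>\<in>dchars r. (s b * cnj (s c)) * (\<chi> b * cnj (\<chi> c)))"
    by (rule sum.cong[OF refl], rule sum.swap)
  also have "\<dots> = (\<Sum>b<r. \<Sum>c<r. (s b * cnj (s c)) * (if coprime b r \<and> [c = b] (mod r) then of_nat (totient r) else 0))"
    by (simp only: sum_distrib_left[symmetric] dchars_orthogonality'[OF assms])
  also have "\<dots> = (\<Sum>b<r. \<Sum>c<r. if c = b then (if coprime b r then s b * cnj (s b) * of_nat (totient r) else 0) else 0)"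
    by (intro sum.cong refl) (auto simp: cong_mod_iff)
  also have "\<dots> = (\<Sum>b<r. if coprime b r then s b * cnj (s b) * of_nat (totient r) else 0)"
    by simp
  also have "\<dots> = (\<Sum>b | b < r \<and> coprime b r. s b * cnj (s b) * of_nat (totient r))"
    by (rule sum.mono_neutral_cong_right) auto
  also have "\<dots> = complex_of_real (totient r * (\<Sum>b | b < r \<and> coprime b r. norm (s b) ^ 2))"
    unfolding of_real_mult of_real_sum complex_norm_square' sum_distrib_left by (simp add: mult.commute)
  finally show ?thesis by (simp only: of_real_eq_iff)
qed

definition twisted_sum :: "nat \<Rightarrow> (nat \<Rightarrow> complex) \<Rightarrow> (nat \<Rightarrow> complex) \<Rightarrow> complex" where
  "twisted_sum N a \<psi> = (\<Sum>n<N. a n * cnj (\<psi> n))"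

text \<open>For primitive \<open>\<psi>\<close>, separability of the Gauss sum expresses the twisted
  sum, times a factor of absolute value \<open>sqrt r\<close>, through additive twists. Positivity
  allows enlarging the primitive characters to all characters, where Parseval applies.\<close>

lemma primitives_large_sieve:
  assumes "r > 0"
  shows "r / totient r * (\<Sum>\<psi>\<in>primitives r. norm (twisted_sum N a \<psi>) ^ 2)
    \<le> (\<Sum>b | b < r \<and> coprime b r. norm (\<Sum>n<N. a n * add_char r (b * n)) ^ 2)"
proof -
  define s where "s = (\<lambda>b. \<Sum>n<N. a n * add_char r (b * n))"
  have eq: "r * norm (twisted_sum N a \<psi>) ^ 2 = norm (\<Sum>b<r. \<psi> b * s b) ^ 2" if "\<psi> \<in> primitives r" for \<psi>
  proof -
    have "(\<Sum>b<r. \<psi> b * s b) = (\<Sum>n<N. a n * gauss r \<psi> n)"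
      unfolding s_def gauss_def sum_distrib_left by (subst sum.swap) (simp add: mult_ac)
    also have "\<dots> = twisted_sum N a \<psi> * gauss r \<psi> 1"
      unfolding twisted_sum_def sum_distrib_right by (subst gauss_separable[OF that]) (simp add: mult_ac)
    finally show ?thesis using norm_gauss[OF that] by (simp add: norm_mult power_mult_distrib)
  qed
  have "r * (\<Sum>\<psi>\<in>primitives r. norm (twisted_sum N a \<psi>) ^ 2) = (\<Sum>\<psi>\<in>primitives r. norm (\<Sum>b<r. \<psi> b * s b) ^ 2)"
    unfolding sum_distrib_left by (intro sum.cong refl eq)
  also have "\<dots> \<le> (\<Sum>\<psi>\<in>dchars r. norm (\<Sum>b<r. \<psi> b * s b) ^ 2)"
    by (intro sum_mono2 primitives_subset) auto
  also have "\<dots> = totient r * (\<Sum>b | b < r \<and> coprime b r. norm (s b) ^ 2)"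
    by (rule dchars_parseval[OF assms])
  finally show ?thesis using assms unfolding s_def by (simp add: field_simps)
qed

text \<open>The weight \<open>r / totient r\<close> is the one that the multiplicative large sieve
  produces. As a positive linear functional of \<open>F\<close> it allows monotonicity, additivity
  and Cauchy-Schwarz over all conductors at once.\<close>

definition prim_sum :: "nat \<Rightarrow> ((nat \<Rightarrow> complex) \<Rightarrow> real) \<Rightarrow> real" where
  "prim_sum R F = (\<Sum>r\<in>{1..R}. real r / real (totient r) * (\<Sum>\<psi>\<in>primitives r. F \<psi>))"

lemma prim_sum_mono:
  assumes "\<And>r \<psi>. r \<in> {1..R} \<Longrightarrow> \<psi> \<in> primitives r \<Longrightarrow> F \<psi> \<le> G \<psi>"
  shows "prim_sum R F \<le> prim_sum R G"
  unfolding prim_sum_def by (intro sum_mono mult_left_mono assms) auto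

lemma prim_sum_sum: "prim_sum R (\<lambda>\<psi>. \<Sum>i\<in>I. F i \<psi>) = (\<Sum>i\<in>I. prim_sum R (F i))"
proof -
  have "prim_sum R (\<lambda>\<psi>. \<Sum>i\<in>I. F i \<psi>) = (\<Sum>r\<in>{1..R}. real r / real (totient r) * (\<Sum>i\<in>I. \<Sum>\<psi>\<in>primitives r. F i \<psi>))"
    unfolding prim_sum_def by (rule sum.cong[OF refl], rule arg_cong[where f = "\<lambda>x. _ * x"], rule sum.swap)
  also have "\<dots> = (\<Sum>r\<in>{1..R}. \<Sum>i\<in>I. real r / real (totient r) * (\<Sum>\<psi>\<in>primitives r. F i \<psi>))"
    by (rule sum.cong[OF refl], rule sum_distrib_left)
  also have "\<dots> = (\<Sum>i\<in>I. prim_sum R (F i))"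
    unfolding prim_sum_def by (rule sum.swap)
  finally show ?thesis .
qed

lemma prim_sum_add: "prim_sum R (\<lambda>\<psi>. F \<psi> + G \<psi>) = prim_sum R F + prim_sum R G"
  by (simp add: prim_sum_def sum.distrib distrib_left)

lemma prim_sum_nonneg: "(\<And>\<psi>. F \<psi> \<ge> 0) \<Longrightarrow> prim_sum R F \<ge> 0"
  unfolding prim_sum_def by (intro sum_nonneg mult_nonneg_nonneg) auto

lemma prim_sum_cauchy_schwarz:
  "prim_sum R (\<lambda>\<psi>. norm (F \<psi>) * norm (G \<psi>)) \<le> sqrt (prim_sum R (\<lambda>\<psi>. norm (F \<psi>) ^ 2)) * sqrt (prim_sum R (\<lambda>\<psi>. norm (G \<psi>) ^ 2))"
proof -
  define I where "I = Sigma {1..R} primitives"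
  define w where "w = (\<lambda>r::nat. real r / real (totient r))"
  have w: "w r \<ge> 0" for r by (simp add: w_def)
  have eq: "prim_sum R H = (\<Sum>(r,\<psi>)\<in>I. w r * H \<psi>)" for H
    unfolding prim_sum_def I_def w_def sum_distrib_left by (subst sum.Sigma) auto
  have "prim_sum R (\<lambda>\<psi>. norm (F \<psi>) * norm (G \<psi>)) =
      (\<Sum>x\<in>I. \<bar>sqrt (w (fst x)) * norm (F (snd x))\<bar> * \<bar>sqrt (w (fst x)) * norm (G (snd x))\<bar>)"
    unfolding eq by (intro sum.cong refl) (auto simp: w abs_mult mult_ac)
  also have "\<dots> \<le> L2_set (\<lambda>x. sqrt (w (fst x)) * norm (F (snd x))) I * L2_set (\<lambda>x. sqrt (w (fst x)) * norm (G (snd x))) I"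
    by (rule L2_set_mult_ineq)
  also have "\<dots> = sqrt (prim_sum R (\<lambda>\<psi>. norm (F \<psi>) ^ 2)) * sqrt (prim_sum R (\<lambda>\<psi>. norm (G \<psi>) ^ 2))"
    unfolding eq L2_set_def by (simp add: power_mult_distrib w case_prod_unfold)
  finally show ?thesis .
qed

theorem large_sieve:
  assumes "R > 0"
  shows "prim_sum R (\<lambda>\<psi>. norm (twisted_sum N a \<psi>) ^ 2) \<le> 12 * (N + real R ^ 2) * (\<Sum>n<N. norm (a n) ^ 2)"
proof -
  have "prim_sum R (\<lambda>\<psi>. norm (twisted_sum N a \<psi>) ^ 2) \<le>
    (\<Sum>r\<in>{1..R}. \<Sum>b | b < r \<and> coprime b r. norm (\<Sum>n<N. a n * add_char r (b * n)) ^ 2)"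
    unfolding prim_sum_def by (intro sum_mono primitives_large_sieve) auto
  also have "\<dots> \<le> 12 * (N + real R ^ 2) * (\<Sum>n<N. norm (a n) ^ 2)" by (rule farey_large_sieve[OF assms])
  finally show ?thesis .
qed

text \<open>Cauchy-Schwarz against the constant 1, whose total weight is at most
  \<open>R ^ 2\<close> since there are at most \<open>totient r\<close> primitive characters modulo
  \<open>r\<close>. It is meant for sparse coefficients without bilinear structure.\<close>

lemma large_sieve_L1:
  assumes "R > 0"
  shows "prim_sum R (\<lambda>\<psi>. norm (twisted_sum N a \<psi>)) \<le> R * sqrt (12 * (N + real R ^ 2) * (\<Sum>n<N. norm (a n) ^ 2))"
proof -
  have "prim_sum R (\<lambda>\<psi>. norm (1::complex) ^ 2) \<le> (\<Sum>r\<in>{1..R}. real r)"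
    unfolding prim_sum_def
  proof (intro sum_mono)
    fix r assume r: "r \<in> {1..R}"
    have "card (primitives r) \<le> totient r"
      using card_mono[OF finite_dchars primitives_subset, of r] card_dchars[of r] r by simp
    then show "real r / real (totient r) * (\<Sum>\<psi>\<in>primitives r. norm (1::complex) ^ 2) \<le> real r"
      using r by (simp add: field_simps)
  qed
  also have "\<dots> \<le> (\<Sum>r\<in>{1..R}. real R)" by (intro sum_mono) auto
  finally have 1: "prim_sum R (\<lambda>\<psi>. norm (1::complex) ^ 2) \<le> real R ^ 2" by (simp add: power2_eq_square)
  have "prim_sum R (\<lambda>\<psi>. norm (twisted_sum N a \<psi>)) = prim_sum R (\<lambda>\<psi>. norm (1::complex) * norm (twisted_sum N a \<psi>))" by simp
  also have "\<dots> \<le> sqrt (prim_sum R (\<lambda>\<psi>. norm (1::complex) ^ 2)) * sqrt (prim_sum R (\<lambda>\<psi>. norm (twisted_sum N a \<psi>) ^ 2))"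
    by (rule prim_sum_cauchy_schwarz)
  also have "\<dots> \<le> sqrt (real R ^ 2) * sqrt (12 * (N + real R ^ 2) * (\<Sum>n<N. norm (a n) ^ 2))"
    by (intro mult_mono real_sqrt_le_mono 1 large_sieve assms real_sqrt_ge_zero prim_sum_nonneg) auto
  finally show ?thesis by simp
qed

section \<open>Bilinear sums\<close>

text \<open>For \<open>j = h div 2 ^ l\<close> the block is empty if \<open>j\<close> is even, and
  has length \<open>2 ^ l\<close> if \<open>j\<close> is odd, that is, if \<open>h\<close> has the
  binary digit 1 at place \<open>l\<close>. It depends on \<open>h\<close> only through
  \<open>j\<close>.\<close>

definition dyadic_block :: "nat \<Rightarrow> nat \<Rightarrow> nat set" where
  "dyadic_block l j = {2 ^ Suc l * (j div 2)..<2 ^ l * j}"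

text \<open>At a fixed level the blocks of different \<open>j\<close> are therefore disjoint, which
  keeps the total squared norm of the pieces of a sequence from growing.\<close>

lemma dyadic_block_index:
  assumes "m \<in> dyadic_block l j"
  shows "j = Suc (m div 2 ^ l)"
proof -
  have m: "2 ^ l * (2 * (j div 2)) \<le> m" "m < 2 ^ l * j" using assms by (auto simp: dyadic_block_def mult_ac)
  have "m div 2 ^ l < j" using m(2) by (simp add: less_mult_imp_div_less mult.commute)
  moreover have "2 * (j div 2) \<le> m div 2 ^ l" using m(1) by (simp add: less_eq_div_iff_mult_less_eq mult.commute)
  ultimately show ?thesis by linarith
qed

text \<open>The initial segment of length \<open>h\<close> is cut into dyadic blocks, one for each digit 1 of \<open>h\<close>.\<close>

lemma sum_lessThan_dyadic_block:
  fixes g :: "nat \<Rightarrow> complex"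
  assumes "h < 2 ^ J"
  shows "(\<Sum>m<h. g m) = (\<Sum>l<J. \<Sum>m\<in>dyadic_block l (h div 2 ^ l). g m)"
proof -
  have "(\<Sum>m<h. g m) = (\<Sum>l<J. \<Sum>m\<in>dyadic_block l (h div 2 ^ l). g m) + (\<Sum>m<2 ^ J * (h div 2 ^ J). g m)" for J
  proof (induction J)
    case (Suc J)
    define j where "j = h div 2 ^ J"
    have jj: "h div 2 ^ Suc J = j div 2" by (simp add: j_def div_mult2_eq mult.commute[of 2])
    have "2 ^ Suc J * (j div 2) = 2 ^ J * (2 * (j div 2))" by simp
    also have "\<dots> \<le> 2 ^ J * j" by (intro mult_left_mono) auto
    finally have le: "2 ^ Suc J * (j div 2) \<le> 2 ^ J * j" .
    have "{..<b} = {a..<b} \<union> {..<a}" "{a..<b} \<inter> {..<a} = {}" if "a \<le> b" for a b :: nat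
      using that by auto
    from this[OF le] have "{..<2 ^ J * j} = dyadic_block J j \<union> {..<2 ^ Suc J * (j div 2)}"
      "dyadic_block J j \<inter> {..<2 ^ Suc J * (j div 2)} = {}" unfolding dyadic_block_def .
    moreover have "finite (dyadic_block J j)" by (simp add: dyadic_block_def)
    ultimately have "(\<Sum>m<2 ^ J * j. g m) = (\<Sum>m\<in>dyadic_block J j. g m) + (\<Sum>m<2 ^ Suc J * (j div 2). g m)"
      by (simp add: sum.union_disjoint)
    then show ?case using Suc unfolding jj by (simp add: j_def add.assoc)
  qed simp
  from this[of J] show ?thesis using assms by simp
qed

text \<open>The bound \<open>h p\<close> on \<open>m\<close> couples the variables. At digit place
  \<open>l\<close> the block of \<open>h p\<close> depends only on \<open>j = h p div 2 ^ l\<close>,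
  so for fixed \<open>l\<close> and \<open>j\<close> the sum factors into two twisted sums. For
  fixed \<open>l\<close> the classes of \<open>p\<close> and the blocks of \<open>m\<close> are each
  disjoint in \<open>j\<close>, so Cauchy-Schwarz over \<open>j\<close> costs nothing and the only
  loss is the number \<open>J\<close> of digits.\<close>

theorem bilinear_large_sieve:
  fixes a b :: "nat \<Rightarrow> complex" and h :: "nat \<Rightarrow> nat"
  assumes R: "R > 0" and h: "\<And>p. p < M \<Longrightarrow> h p \<le> N" and N: "N < 2 ^ J"
  shows "prim_sum R (\<lambda>\<psi>. norm (\<Sum>p<M. \<Sum>m<h p. a p * b m * cnj (\<psi> (p * m))))
    \<le> J * (12 * sqrt ((M + real R ^ 2) * (N + real R ^ 2)) *
        sqrt ((\<Sum>p<M. norm (a p) ^ 2) * (\<Sum>m<N. norm (b m) ^ 2)))"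
proof -
  define Z where "Z = (\<lambda>\<psi>. (\<Sum>p<M. \<Sum>m<h p. a p * b m * cnj (\<psi> (p * m))))"
  define A where "A = (\<lambda>l j p. if h p div 2 ^ l = j then a p else 0)"
  define B where "B = (\<lambda>l j m. if m \<in> dyadic_block l j then b m else 0)"
  define \<alpha> where "\<alpha> = (\<lambda>l j. \<Sum>p<M. norm (A l j p) ^ 2)"
  define \<beta> where "\<beta> = (\<lambda>l j. \<Sum>m<N. norm (B l j m) ^ 2)"
  define c where "c = 12 * sqrt ((M + real R ^ 2) * (N + real R ^ 2))"
  have \<alpha>0: "\<alpha> l j \<ge> 0" and \<beta>0: "\<beta> l j \<ge> 0" for l j by (auto simp: \<alpha>_def \<beta>_def intro!: sum_nonneg)
  have c0: "c \<ge> 0" unfolding c_def by simp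
  have \<alpha>s: "(\<Sum>j\<le>N. \<alpha> l j) \<le> (\<Sum>p<M. norm (a p) ^ 2)" for l
  proof -
    have "(\<Sum>j\<le>N. \<alpha> l j) = (\<Sum>p<M. \<Sum>j\<le>N. norm (A l j p) ^ 2)" unfolding \<alpha>_def by (rule sum.swap)
    also have "\<dots> \<le> (\<Sum>p<M. norm (a p) ^ 2)"
    proof (intro sum_mono)
      fix p
      have "(\<Sum>j\<le>N. norm (A l j p) ^ 2) = (\<Sum>j\<le>N. if j = h p div 2 ^ l then norm (a p) ^ 2 else 0)"
        by (intro sum.cong refl) (auto simp: A_def)
      also have "\<dots> \<le> norm (a p) ^ 2" by simp
      finally show "(\<Sum>j\<le>N. norm (A l j p) ^ 2) \<le> norm (a p) ^ 2" .
    qed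
    finally show ?thesis .
  qed
  have \<beta>s: "(\<Sum>j\<le>N. \<beta> l j) \<le> (\<Sum>m<N. norm (b m) ^ 2)" for l
  proof -
    have "(\<Sum>j\<le>N. \<beta> l j) = (\<Sum>m<N. \<Sum>j\<le>N. norm (B l j m) ^ 2)" unfolding \<beta>_def by (rule sum.swap)
    also have "\<dots> \<le> (\<Sum>m<N. norm (b m) ^ 2)"
    proof (intro sum_mono)
      fix m
      have "(\<Sum>j\<le>N. norm (B l j m) ^ 2) \<le> (\<Sum>j\<le>N. if j = Suc (m div 2 ^ l) then norm (b m) ^ 2 else 0)"
        by (intro sum_mono) (auto simp: B_def dest: dyadic_block_index)
      also have "\<dots> \<le> norm (b m) ^ 2" by simp
      finally show "(\<Sum>j\<le>N. norm (B l j m) ^ 2) \<le> norm (b m) ^ 2" .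
    qed
    finally show ?thesis .
  qed
  have split: "Z \<psi> =
      (\<Sum>l<J. \<Sum>j\<le>N. twisted_sum M (A l j) \<psi> * twisted_sum N (B l j) \<psi>)" if "dcharacter r \<psi>" for r \<psi>
  proof -
    have "Z \<psi> =
        (\<Sum>p<M. \<Sum>l<J. \<Sum>m\<in>dyadic_block l (h p div 2 ^ l). a p * b m * cnj (\<psi> (p * m)))"
      unfolding Z_def by (rule sum.cong[OF refl], rule sum_lessThan_dyadic_block) (use h N in \<open>auto intro: le_less_trans\<close>)
    also have "\<dots> = (\<Sum>l<J. \<Sum>p<M. \<Sum>m\<in>dyadic_block l (h p div 2 ^ l). a p * b m * cnj (\<psi> (p * m)))"
      by (rule sum.swap)
    also have "\<dots> = (\<Sum>l<J. \<Sum>p<M. \<Sum>j\<le>N. \<Sum>m<N. A l j p * cnj (\<psi> p) * (B l j m * cnj (\<psi> m)))"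
    proof (rule sum.cong[OF refl], rule sum.cong[OF refl])
      fix l p assume "p \<in> {..<M}"
      define j0 where "j0 = h p div 2 ^ l"
      have hp: "h p \<le> N" using h \<open>p \<in> {..<M}\<close> by simp
      have j0: "j0 \<le> N" unfolding j0_def using hp div_le_dividend order_trans by blast
      have "2 ^ l * j0 \<le> h p" unfolding j0_def by simp
      then have sub: "dyadic_block l j0 \<subseteq> {..<N}" using hp by (auto simp: dyadic_block_def)
      have "(\<Sum>j\<le>N. \<Sum>m<N. A l j p * cnj (\<psi> p) * (B l j m * cnj (\<psi> m))) =
          (\<Sum>j\<le>N. if j = j0 then (\<Sum>m<N. a p * cnj (\<psi> p) * (B l j0 m * cnj (\<psi> m))) else 0)"
        by (intro sum.cong refl) (auto simp: A_def j0_def)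
      also have "\<dots> = (\<Sum>m<N. a p * cnj (\<psi> p) * (B l j0 m * cnj (\<psi> m)))" using j0 by simp
      also have "\<dots> = (\<Sum>m\<in>dyadic_block l j0. a p * cnj (\<psi> p) * (b m * cnj (\<psi> m)))"
        by (rule sum.mono_neutral_cong_right) (use sub in \<open>auto simp: B_def\<close>)
      also have "\<dots> = (\<Sum>m\<in>dyadic_block l j0. a p * b m * cnj (\<psi> (p * m)))"
        by (intro sum.cong refl) (simp add: dcharacterD(3)[OF that] mult_ac)
      finally show "(\<Sum>m\<in>dyadic_block l (h p div 2 ^ l). a p * b m * cnj (\<psi> (p * m))) =
        (\<Sum>j\<le>N. \<Sum>m<N. A l j p * cnj (\<psi> p) * (B l j m * cnj (\<psi> m)))" by (simp add: j0_def)
    qed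
    also have "\<dots> = (\<Sum>l<J. \<Sum>j\<le>N. \<Sum>p<M. \<Sum>m<N. A l j p * cnj (\<psi> p) * (B l j m * cnj (\<psi> m)))"
      by (rule sum.cong[OF refl], rule sum.swap)
    finally show ?thesis by (simp add: twisted_sum_def sum_product)
  qed
  have "prim_sum R (\<lambda>\<psi>. norm (Z \<psi>)) \<le>
      prim_sum R (\<lambda>\<psi>. \<Sum>l<J. \<Sum>j\<le>N. norm (twisted_sum M (A l j) \<psi>) * norm (twisted_sum N (B l j) \<psi>))"
  proof (rule prim_sum_mono)
    fix r \<psi> assume "\<psi> \<in> primitives r"
    then have "dcharacter r \<psi>" by (rule primitivesD)
    note eq = split[OF this]
    have "norm (\<Sum>l<J. \<Sum>j\<le>N. twisted_sum M (A l j) \<psi> * twisted_sum N (B l j) \<psi>) \<le> (\<Sum>l<J. norm (\<Sum>j\<le>N. twisted_sum M (A l j) \<psi> * twisted_sum N (B l j) \<psi>))"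
      by (rule norm_sum)
    also have "\<dots> \<le> (\<Sum>l<J. \<Sum>j\<le>N. norm (twisted_sum M (A l j) \<psi> * twisted_sum N (B l j) \<psi>))"
      by (intro sum_mono norm_sum)
    finally show "norm (Z \<psi>) \<le>
      (\<Sum>l<J. \<Sum>j\<le>N. norm (twisted_sum M (A l j) \<psi>) * norm (twisted_sum N (B l j) \<psi>))"
      unfolding eq norm_mult .
  qed
  also have "\<dots> = (\<Sum>l<J. \<Sum>j\<le>N. prim_sum R (\<lambda>\<psi>. norm (twisted_sum M (A l j) \<psi>) * norm (twisted_sum N (B l j) \<psi>)))"
    by (simp add: prim_sum_sum)
  also have "\<dots> \<le> (\<Sum>l<J. \<Sum>j\<le>N. c * (sqrt (\<alpha> l j) * sqrt (\<beta> l j)))"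
  proof (intro sum_mono)
    fix l j
    have "prim_sum R (\<lambda>\<psi>. norm (twisted_sum M (A l j) \<psi>) * norm (twisted_sum N (B l j) \<psi>)) \<le>
      sqrt (prim_sum R (\<lambda>\<psi>. norm (twisted_sum M (A l j) \<psi>) ^ 2)) * sqrt (prim_sum R (\<lambda>\<psi>. norm (twisted_sum N (B l j) \<psi>) ^ 2))"
      by (rule prim_sum_cauchy_schwarz)
    also have "\<dots> \<le> sqrt (12 * (M + real R ^ 2) * \<alpha> l j) * sqrt (12 * (N + real R ^ 2) * \<beta> l j)"
      unfolding \<alpha>_def \<beta>_def
      by (intro mult_mono real_sqrt_le_mono large_sieve R real_sqrt_ge_zero prim_sum_nonneg mult_nonneg_nonneg sum_nonneg) auto
    also have "\<dots> = sqrt (12 * 12) * sqrt ((M + real R ^ 2) * (N + real R ^ 2)) * (sqrt (\<alpha> l j) * sqrt (\<beta> l j))"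
      by (simp only: real_sqrt_mult mult_ac)
    also have "sqrt (12 * 12) = (12::real)" by (rule real_sqrt_unique) simp_all
    finally show "prim_sum R (\<lambda>\<psi>. norm (twisted_sum M (A l j) \<psi>) * norm (twisted_sum N (B l j) \<psi>)) \<le> c * (sqrt (\<alpha> l j) * sqrt (\<beta> l j))"
      by (simp add: c_def)
  qed
  also have "\<dots> \<le> (\<Sum>l<J. c * sqrt ((\<Sum>p<M. norm (a p) ^ 2) * (\<Sum>m<N. norm (b m) ^ 2)))"
  proof (intro sum_mono)
    fix l
    have "(\<Sum>j\<le>N. sqrt (\<alpha> l j) * sqrt (\<beta> l j)) = (\<Sum>j\<le>N. \<bar>sqrt (\<alpha> l j)\<bar> * \<bar>sqrt (\<beta> l j)\<bar>)"
      using \<alpha>0 \<beta>0 by simp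
    also have "\<dots> \<le> L2_set (\<lambda>j. sqrt (\<alpha> l j)) {..N} * L2_set (\<lambda>j. sqrt (\<beta> l j)) {..N}"
      by (rule L2_set_mult_ineq)
    also have "\<dots> = sqrt ((\<Sum>j\<le>N. \<alpha> l j) * (\<Sum>j\<le>N. \<beta> l j))"
      using \<alpha>0 \<beta>0 by (simp add: L2_set_def real_sqrt_mult)
    also have "\<dots> \<le> sqrt ((\<Sum>p<M. norm (a p) ^ 2) * (\<Sum>m<N. norm (b m) ^ 2))"
      by (intro real_sqrt_le_mono mult_mono \<alpha>s \<beta>s sum_nonneg \<beta>0) auto
    finally show "(\<Sum>j\<le>N. c * (sqrt (\<alpha> l j) * sqrt (\<beta> l j))) \<le>
      c * sqrt ((\<Sum>p<M. norm (a p) ^ 2) * (\<Sum>m<N. norm (b m) ^ 2))"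
      using c0 by (simp only: sum_distrib_left[symmetric] mult_left_mono)
  qed
  finally show ?thesis by (simp add: c_def Z_def)
qed

section \<open>Divisor sums, totients and smooth numbers\<close>

lemma half_less_ln_2: "1/2 < ln (2::real)"
proof -
  have "ln (exp (1::real)) < ln 4" using exp_le by (subst ln_less_cancel_iff) auto
  then have "(1::real) < ln 4" by simp
  also have "ln (4::real) = 2 * ln 2" using ln_mult[of 2 "2::real"] by simp
  finally show ?thesis by simp
qed

lemma sum_inverse_le_ln: "(\<Sum>k\<in>{1..N}. 1 / real k) \<le> 1 + ln (real N)"
proof (induction N)
  case (Suc N)
  show ?case
  proof (cases "N = 0")
    case False
    define x where "x = real N"
    have x: "x > 0" using False by (simp add: x_def)
    have "ln (x / (x + 1)) \<le> x / (x + 1) - 1" using x by (intro ln_le_minus_one) simp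
    also have "\<dots> = - (1 / (x + 1))" using x by (simp add: field_simps)
    finally have "1 / (x + 1) \<le> ln (x + 1) - ln x" using x by (simp add: ln_div)
    then show ?thesis using Suc by (simp add: x_def add.commute)
  qed simp
qed simp

text \<open>The substitution \<open>q = d * s\<close>. It serves the divisor count, the sum of
  \<open>1 / totient s\<close>, Ramare's decomposition and the splitting of a modulus into conductor
  and cofactor.\<close>

lemma sum_divisors_swap:
  fixes F :: "nat \<Rightarrow> nat \<Rightarrow> 'a::comm_monoid_add"
  shows "(\<Sum>q\<in>{1..N}. \<Sum>d | d dvd q. F d (q div d)) = (\<Sum>s\<in>{1..N}. \<Sum>d\<in>{1..N div s}. F d s)"
proof -
  have "(\<Sum>q\<in>{1..N}. \<Sum>d | d dvd q. F d (q div d)) =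
      (\<Sum>(q,d)\<in>Sigma {1..N} (\<lambda>q. {d. d dvd q}). F d (q div d))"
    by (rule sum.Sigma) auto
  also have "\<dots> = (\<Sum>(s,d)\<in>Sigma {1..N} (\<lambda>s. {1..N div s}). F d s)"
  proof (rule sum.reindex_bij_witness[of _ "\<lambda>(s,d). (s * d, d)" "\<lambda>(q,d). (q div d, d)"])
    fix x assume "x \<in> Sigma {1..N} (\<lambda>q. {d. d dvd q})"
    then obtain q d where x: "x = (q, d)" "q \<ge> 1" "q \<le> N" "d dvd q" by auto
    have d: "d > 0" using x by (auto intro: Nat.gr0I)
    have q: "q div d * d = q" using x by simp
    then have pos: "q div d > 0" using x(2) by (cases "q div d = 0") auto
    have "d \<le> N div (q div d)" using q x(3) pos by (simp add: less_eq_div_iff_mult_less_eq mult.commute)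
    moreover have "q div d \<le> N" using x(3) div_le_dividend order_trans by blast
    ultimately show "(case x of (q, d) \<Rightarrow> (q div d, d)) \<in> Sigma {1..N} (\<lambda>s. {1..N div s})"
      using x d pos by (simp add: Suc_le_eq)
    show "(case case x of (q, d) \<Rightarrow> (q div d, d) of (s, d) \<Rightarrow> (s * d, d)) = x" using q x by simp
  next
    fix y assume "y \<in> Sigma {1..N} (\<lambda>s. {1..N div s})"
    then obtain s d where y: "y = (s, d)" "s \<ge> 1" "s \<le> N" "d \<ge> 1" "d \<le> N div s" by auto
    then have "d * s \<le> N" using less_eq_div_iff_mult_less_eq[of s d N] by simp
    then show "(case y of (s, d) \<Rightarrow> (s * d, d)) \<in> Sigma {1..N} (\<lambda>q. {d. d dvd q})"
      using y by (simp add: mult.commute)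
    show "(case case y of (s, d) \<Rightarrow> (s * d, d) of (q, d) \<Rightarrow> (q div d, d)) = y" using y by simp
  qed auto
  also have "\<dots> = (\<Sum>s\<in>{1..N}. \<Sum>d\<in>{1..N div s}. F d s)"
    by (rule sum.Sigma[symmetric]) auto
  finally show ?thesis .
qed

lemma sum_card_divisors_le: "(\<Sum>n\<in>{1..N}. real (card {d. d dvd n})) \<le> real N * (1 + ln (real N))"
proof -
  have "(\<Sum>n\<in>{1..N}. real (card {d. d dvd n})) = (\<Sum>n\<in>{1..N}. \<Sum>d | d dvd n. 1)" by simp
  also have "\<dots> = (\<Sum>s\<in>{1..N}. \<Sum>d\<in>{1..N div s}. 1)" by (rule sum_divisors_swap[of "\<lambda>_ _. 1"])
  also have "\<dots> \<le> (\<Sum>s\<in>{1..N}. real N * (1 / real s))"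
    by (intro sum_mono) (use of_nat_div_le_of_nat in simp)
  also have "\<dots> = real N * (\<Sum>s\<in>{1..N}. 1 / real s)" by (simp only: sum_distrib_left)
  also have "\<dots> \<le> real N * (1 + ln (real N))" by (intro mult_left_mono sum_inverse_le_ln) auto
  finally show ?thesis .
qed

section \<open>Squarefree divisors and the ratio of n to its totient\<close>

lemma prod_prime_subset:
  assumes "n > 0" "T \<subseteq> prime_factors (n::nat)"
  shows "\<Prod>T dvd n" "prime_factors n \<inter> {p. p dvd \<Prod>T} = T"
proof -
  have fin: "finite T" using assms(2) finite_subset by blast
  have "\<Prod>T dvd \<Prod>(prime_factors n)" using assms(2) by (intro prod_dvd_prod_subset) auto
  also have "\<dots> dvd (\<Prod>p\<in>prime_factors n. p ^ multiplicity p n)"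
  proof (rule prod_dvd_prod)
    fix p assume "p \<in> prime_factors n"
    then have "multiplicity p n > 0" by (simp add: prime_factors_multiplicity)
    then show "p dvd p ^ multiplicity p n" by (rule dvd_power[OF disjI1])
  qed
  also have "\<dots> = n" using prime_factorization_nat[OF assms(1)] by simp
  finally show "\<Prod>T dvd n" .
  show "prime_factors n \<inter> {p. p dvd \<Prod>T} = T"
  proof
    show "prime_factors n \<inter> {p. p dvd \<Prod>T} \<subseteq> T"
    proof
      fix p assume p: "p \<in> prime_factors n \<inter> {p. p dvd \<Prod>T}"
      then have "prime p" by auto
      then obtain r where "r \<in> T" "p dvd r" using p prime_dvd_prod_iff[OF fin, of p "\<lambda>x. x"] by auto
      moreover have "prime r" using assms(2) \<open>r \<in> T\<close> by auto
      ultimately show "p \<in> T" using \<open>prime p\<close> primes_dvd_imp_eq by blast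
    qed
    show "T \<subseteq> prime_factors n \<inter> {p. p dvd \<Prod>T}" using assms(2) fin by (auto intro: dvd_prodI)
  qed
qed

lemma inj_on_prod_prime_subsets:
  assumes "n > 0"
  shows "inj_on (\<lambda>T. \<Prod>T) (Pow (prime_factors (n::nat)))"
  by (rule inj_onI) (metis PowD assms prod_prime_subset(2))

text \<open>A set of prime factors is recovered from its product as the primes dividing it, so
  distinct subsets give distinct divisors.\<close>

lemma two_power_omega_le:
  assumes "n > 0"
  shows "2 ^ card (prime_factors (n::nat)) \<le> card {d. d dvd n}"
proof -
  have "2 ^ card (prime_factors n) = card ((\<lambda>T. \<Prod>T) ` Pow (prime_factors n))"
    by (simp add: card_image[OF inj_on_prod_prime_subsets[OF assms]] card_Pow)
  also have "\<dots> \<le> card {d. d dvd n}"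
    using prod_prime_subset(1)[OF assms] assms by (intro card_mono) auto
  finally show ?thesis .
qed

text \<open>The product telescopes. Its value exceeds 1/2, and so does the product over any subset
  of the indices, as all factors lie between 0 and 1.\<close>

lemma prod_one_minus_inverse_squares:
  "N \<ge> 1 \<Longrightarrow> (\<Prod>k\<in>{2..N}. 1 - 1 / real k ^ 2) = (real N + 1) / (2 * real N)"
proof (induction N rule: nat_induct_at_least)
  case (Suc N)
  have "{2..Suc N} = insert (Suc N) {2..N}" using Suc by auto
  then have "(\<Prod>k\<in>{2..Suc N}. 1 - 1 / real k ^ 2) = (1 - 1 / real (Suc N) ^ 2) * ((real N + 1) / (2 * real N))"
    using Suc by simp
  also have "\<dots> = (real (Suc N) + 1) / (2 * real (Suc N))"
  proof -
    define x where "x = real N"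
    have "x > 0" using Suc by (simp add: x_def)
    then have "(1 - 1 / (x + 1) ^ 2) * ((x + 1) / (2 * x)) = (x + 1 + 1) / (2 * (x + 1))"
      by (simp add: divide_simps power2_eq_square) (simp add: algebra_simps)
    then show ?thesis by (simp add: x_def add.commute)
  qed
  finally show ?case .
qed simp

text \<open>\<open>n / totient n\<close> is the product of the \<open>1 / (1 - 1 / p)\<close>, and
  each factor equals \<open>(1 + 1 / p) / (1 - 1 / p ^ 2)\<close>. The denominators multiply to at
  least 1/2, which is the 2 in the bound; the expanded numerators form a part of the sum of
  \<open>1 / d\<close>.\<close>

lemma div_totient_le:
  assumes "n > 0"
  shows "real n / real (totient n) \<le> 2 * (\<Sum>d | d dvd n. 1 / real d)"
proof -
  define P where "P = prime_factors n"
  have finP: "finite P" by (simp add: P_def)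
  have P2: "p \<ge> 2" if "p \<in> P" for p using that prime_ge_2_nat[of p] by (auto simp: P_def)
  have Pn: "p \<le> n" if "p \<in> P" for p using that assms by (auto simp: P_def dvd_imp_le)
  have f01: "0 \<le> 1 - 1 / real k ^ 2" "1 - 1 / real k ^ 2 \<le> 1" if "k \<ge> 2" for k :: nat
  proof -
    have "1 \<le> real k ^ 2" using that by (intro one_le_power) simp
    then show "0 \<le> 1 - 1 / real k ^ 2" using that by (simp add: divide_le_eq_1)
  qed simp
  have A: "1/2 \<le> (\<Prod>p\<in>P. 1 - 1 / real p ^ 2)"
  proof -
    have "1/2 \<le> (real n + 1) / (2 * real n)" using assms by (simp add: field_simps)
    also have "\<dots> = (\<Prod>k\<in>{2..n}. 1 - 1 / real k ^ 2)"
      using assms by (subst prod_one_minus_inverse_squares) auto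
    also have "\<dots> = (\<Prod>k\<in>P. 1 - 1 / real k ^ 2) * (\<Prod>k\<in>{2..n} - P. 1 - 1 / real k ^ 2)"
      using P2 Pn by (subst mult.commute, intro prod.subset_diff) auto
    also have "\<dots> \<le> (\<Prod>k\<in>P. 1 - 1 / real k ^ 2) * 1"
    proof (rule mult_left_mono)
      show "(\<Prod>k\<in>{2..n} - P. 1 - 1 / real k ^ 2) \<le> 1"
        by (rule prod_le_1) (use f01 in force)
      show "0 \<le> (\<Prod>k\<in>P. 1 - 1 / real k ^ 2)"
        by (rule prod_nonneg) (use f01 P2 in blast)
    qed
    finally show ?thesis by simp
  qed
  have B: "(\<Prod>p\<in>P. 1 + 1 / real p) \<le> (\<Sum>d | d dvd n. 1 / real d)"
  proof -
    have "(\<Prod>p\<in>P. 1 + 1 / real p) = (\<Prod>p\<in>P. 1 / real p + 1)" by (simp add: add.commute)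
    also have "\<dots> = (\<Sum>T\<in>Pow P. (\<Prod>p\<in>T. 1 / real p))" using prod_add[OF finP, of "\<lambda>p. 1 / real p" "\<lambda>_. 1"] by simp
    also have "\<dots> = (\<Sum>T\<in>Pow P. 1 / real (\<Prod>T))" by (simp add: prod_dividef)
    also have "\<dots> = (\<Sum>d\<in>(\<lambda>T. \<Prod>T) ` Pow P. 1 / real d)"
      unfolding P_def by (subst sum.reindex[OF inj_on_prod_prime_subsets[OF assms]]) simp
    also have "\<dots> \<le> (\<Sum>d | d dvd n. 1 / real d)"
      using prod_prime_subset(1)[OF assms] assms by (intro sum_mono2) (auto simp: P_def)
    finally show ?thesis .
  qed
  define t where "t = (\<Prod>p\<in>P. 1 - 1 / real p)"
  define u where "u = (\<Prod>p\<in>P. 1 + 1 / real p)"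
  have tu: "t * u = (\<Prod>p\<in>P. 1 - 1 / real p ^ 2)"
    unfolding t_def u_def prod.distrib[symmetric]
    by (intro prod.cong refl) (simp add: power2_eq_square algebra_simps)
  have tot: "real (totient n) = real n * t" unfolding t_def P_def by (rule totient_formula2)
  have t: "t > 0" using tot assms by (metis of_nat_0_less_iff totient_gt_0_iff zero_less_mult_pos)
  have "1 \<le> 2 * (t * u)" using A tu by simp
  then have "1 / t \<le> 2 * u" using t by (simp add: field_simps)
  moreover have "real n / real (totient n) = 1 / t" using tot assms by simp
  ultimately show ?thesis using B unfolding u_def by linarith
qed

text \<open>Bounding \<open>s / totient s\<close> by its divisor sum and writing
  \<open>s = d * k\<close> gives terms \<open>2 / (d ^ 2 * k)\<close>. The sum over \<open>d\<close>
  is bounded and that over \<open>k\<close> is harmonic, so a single logarithm remains.\<close>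

lemma sum_inverse_totient_le: "(\<Sum>s\<in>{1..N}. 1 / real (totient s)) \<le> 4 * (1 + ln (real N))"
proof (cases "N = 0")
  case False
  have "(\<Sum>s\<in>{1..N}. 1 / real (totient s)) \<le> (\<Sum>s\<in>{1..N}. \<Sum>d | d dvd s. 2 * (1 / real d ^ 2 * (1 / real (s div d))))"
  proof (intro sum_mono)
    fix s assume s: "s \<in> {1..N}"
    have "1 / real (totient s) = (1 / real s) * (real s / real (totient s))" using s by simp
    also have "\<dots> \<le> (1 / real s) * (2 * (\<Sum>d | d dvd s. 1 / real d))"
      using s by (intro mult_left_mono div_totient_le) auto
    also have "\<dots> = (\<Sum>d | d dvd s. 2 * (1 / real d ^ 2 * (1 / real (s div d))))"
      unfolding sum_distrib_left
    proof (intro sum.cong refl)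
      fix d assume "d \<in> {d. d dvd s}"
      then have "real (s div d) = real s / real d" "d > 0" using s by (auto simp: real_of_nat_div intro: Nat.gr0I)
      then show "1 / real s * (2 * (1 / real d)) = 2 * (1 / real d ^ 2 * (1 / real (s div d)))"
        by (simp add: power2_eq_square)
    qed
    finally show "1 / real (totient s) \<le> (\<Sum>d | d dvd s. 2 * (1 / real d ^ 2 * (1 / real (s div d))))" .
  qed
  also have "\<dots> = (\<Sum>s\<in>{1..N}. \<Sum>d\<in>{1..N div s}. 2 * (1 / real d ^ 2 * (1 / real s)))"
    by (rule sum_divisors_swap[of "\<lambda>d k. 2 * (1 / real d ^ 2 * (1 / real k))"])
  also have "\<dots> = (\<Sum>s\<in>{1..N}. 2 * (1 / real s) * (\<Sum>d\<in>{1..N div s}. 1 / real d ^ 2))"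
    by (simp add: sum_distrib_left mult_ac)
  also have "\<dots> \<le> (\<Sum>s\<in>{1..N}. 2 * (1 / real s) * 2)"
    by (intro sum_mono mult_left_mono sum_inverse_squares) auto
  also have "\<dots> = 4 * (\<Sum>s\<in>{1..N}. 1 / real s)" by (simp add: sum_distrib_left)
  also have "\<dots> \<le> 4 * (1 + ln (real N))" by (intro mult_left_mono sum_inverse_le_ln) auto
  finally show ?thesis .
qed simp

section \<open>Integers with large square divisors and smooth integers\<close>

lemma card_multiples_le:
  assumes "d > 0"
  shows "real (card {n\<in>{1..N}. d dvd n}) \<le> real N / real d"
proof -
  have "{n\<in>{1..N}. d dvd n} \<subseteq> (\<lambda>k. d * k) ` {1..N div d}"
  proof
    fix n assume "n \<in> {n\<in>{1..N}. d dvd n}"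
    then obtain k where k: "n = d * k" "1 \<le> n" "n \<le> N" by auto
    then have "k \<ge> 1" "k \<le> N div d"
      using assms by (auto simp: less_eq_div_iff_mult_less_eq mult.commute Suc_le_eq intro: Nat.gr0I)
    then show "n \<in> (\<lambda>k. d * k) ` {1..N div d}" using k by auto
  qed
  then have "card {n\<in>{1..N}. d dvd n} \<le> N div d"
    using surj_card_le[of "{1..N div d}"] by simp
  then show ?thesis using of_nat_div_le_of_nat[of N d, where ?'a = real] by linarith
qed

lemma sum_inverse_squares_tail:
  assumes "W \<ge> 1"
  shows "(\<Sum>n\<in>{Suc W..N}. 1 / real n ^ 2) \<le> 1 / real W"
proof (cases "N \<ge> W")
  case True
  then have "(\<Sum>n\<in>{Suc W..N}. 1 / real n ^ 2) \<le> 1 / real W - 1 / real N"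
  proof (induction N rule: dec_induct)
    case (step N)
    define x where "x = real N"
    have x: "x > 0" using step assms by (simp add: x_def)
    have "1 / (x + 1) ^ 2 \<le> 1 / (x * (x + 1))"
      using x by (intro divide_left_mono) (auto simp: power2_eq_square)
    also have "\<dots> = 1 / x - 1 / (x + 1)" using x by (simp add: field_simps)
    finally have "1 / real (Suc N) ^ 2 \<le> 1 / real N - 1 / real (Suc N)" by (simp add: x_def add.commute)
    moreover have "{Suc W..Suc N} = insert (Suc N) {Suc W..N}" using step by auto
    ultimately show ?case using step by simp
  qed simp
  moreover have "0 \<le> 1 / real N" by simp
  ultimately show ?thesis by linarith
qed simp

lemma card_square_divisible_le:
  assumes "W \<ge> 1"
  shows "real (card {n\<in>{1..N}. \<exists>p. W < p \<and> p ^ 2 dvd n}) \<le> real N / real W"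
proof -
  have "{n\<in>{1..N}. \<exists>p. W < p \<and> p ^ 2 dvd n} \<subseteq> (\<Union>p\<in>{Suc W..N}. {n\<in>{1..N}. p ^ 2 dvd n})"
  proof
    fix n assume "n \<in> {n\<in>{1..N}. \<exists>p. W < p \<and> p ^ 2 dvd n}"
    then obtain p where p: "n \<ge> 1" "n \<le> N" "W < p" "p ^ 2 dvd n" by auto
    then have "p ^ 2 \<le> N" using dvd_imp_le[OF p(4)] by simp
    moreover have "p \<le> p ^ 2" by (simp add: power2_eq_square)
    ultimately show "n \<in> (\<Union>p\<in>{Suc W..N}. {n\<in>{1..N}. p ^ 2 dvd n})" using p by auto
  qed
  then have "card {n\<in>{1..N}. \<exists>p. W < p \<and> p ^ 2 dvd n} \<le> card (\<Union>p\<in>{Suc W..N}. {n\<in>{1..N}. p ^ 2 dvd n})"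
    by (intro card_mono) auto
  also have "\<dots> \<le> (\<Sum>p\<in>{Suc W..N}. card {n\<in>{1..N}. p ^ 2 dvd n})" by (intro card_UN_le) auto
  finally have "real (card {n\<in>{1..N}. \<exists>p. W < p \<and> p ^ 2 dvd n}) \<le> (\<Sum>p\<in>{Suc W..N}. real (card {n\<in>{1..N}. p ^ 2 dvd n}))"
    by (simp only: of_nat_sum[symmetric] of_nat_le_iff)
  also have "\<dots> \<le> (\<Sum>p\<in>{Suc W..N}. real N / real (p ^ 2))"
    by (intro sum_mono card_multiples_le) auto
  also have "\<dots> = real N * (\<Sum>p\<in>{Suc W..N}. 1 / real p ^ 2)" by (simp add: sum_distrib_left)
  also have "\<dots> \<le> real N * (1 / real W)" by (intro mult_left_mono sum_inverse_squares_tail assms) auto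
  finally show ?thesis by simp
qed

text \<open>Such an integer is a product of at most \<open>k\<close> prime powers
  \<open>p ^ e\<close> with \<open>p \<le> W\<close> and \<open>e \<le> E\<close>; with 1 standing
  for an absent factor there are at most \<open>W * E + 1\<close> choices for each. The induction
  splits off one full prime power.\<close>

lemma card_smooth_few_primes:
  assumes "N < 2 ^ E"
  shows "card {n\<in>{1..N}. (\<forall>p\<in>prime_factors n. p \<le> W) \<and> card (prime_factors n) \<le> k} \<le> (W * E + 1) ^ k"
proof (induction k)
  case 0
  have "{n\<in>{1..N}. (\<forall>p\<in>prime_factors n. p \<le> W) \<and> card (prime_factors n) \<le> 0} \<subseteq> {1}"
  proof
    fix n assume n: "n \<in> {n\<in>{1..N}. (\<forall>p\<in>prime_factors n. p \<le> W) \<and> card (prime_factors n) \<le> 0}"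
    then have "prime_factors n = {}" "n > 0" by simp_all
    then have "\<not> (\<exists>p. prime p \<and> p dvd n)" by (metis empty_iff in_prime_factors_iff not_gr_zero)
    then have "n = 1" using prime_factor_nat[of n] by blast
    then show "n \<in> {1}" by simp
  qed
  from card_mono[OF _ this] show ?case by simp
next
  case (Suc k)
  define S where "S = (\<lambda>k. {n\<in>{1..N}. (\<forall>p\<in>prime_factors n. p \<le> W) \<and> card (prime_factors n) \<le> k})"
  define Q where "Q = insert 1 ((\<lambda>(p,e). p ^ e) ` ({1..W} \<times> {1..E}))"
  have finQ: "finite Q" unfolding Q_def by simp
  have cQ: "card Q \<le> W * E + 1"
  proof -
    have "card Q \<le> Suc (card ((\<lambda>(p,e). p ^ e) ` ({1..W} \<times> {1..E})))" unfolding Q_def by (rule card_insert_le_m1) auto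
    also have "\<dots> \<le> Suc (card ({1..W} \<times> {1..E}))" by (intro Suc_le_mono[THEN iffD2] card_image_le) auto
    finally show ?thesis by simp
  qed
  have "S (Suc k) \<subseteq> (\<lambda>(c,m). c * m) ` (Q \<times> S k)"
  proof
    fix n assume n: "n \<in> S (Suc k)"
    show "n \<in> (\<lambda>(c,m). c * m) ` (Q \<times> S k)"
    proof (cases "n = 1")
      case True
      then have "n \<in> S k" using n by (auto simp: S_def)
      then have "(1, n) \<in> Q \<times> S k" by (simp add: Q_def)
      then show ?thesis by (force intro: rev_image_eqI)
    next
      case False
      then obtain p where p: "prime p" "p dvd n" using prime_factor_nat by blast
      have n0: "n > 0" using n by (simp add: S_def)
      have pn: "p \<in> prime_factors n" using p n0 by (simp add: prime_factors_dvd)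
      define v where "v = multiplicity p n"
      obtain m where m: "n = p ^ v * m" "\<not> p dvd m"
        using multiplicity_decompose'[of n p] n0 p(1) unfolding v_def by (metis not_prime_unit not_gr_zero)
      have v: "v \<ge> 1" using m p(2) by (cases "v = 0") auto
      have m0: "m > 0" using m n0 by (auto intro: Nat.gr0I)
      have "2 ^ v \<le> p ^ v" using prime_ge_2_nat[OF p(1)] by (intro power_mono) auto
      also have "\<dots> \<le> n" using m m0 by simp
      also have "\<dots> < 2 ^ E" using n assms by (simp add: S_def)
      finally have "v \<le> E" by simp
      then have "p ^ v \<in> Q"
        using v pn n p(1) prime_gt_0_nat[OF p(1)] by (auto simp: Q_def S_def Suc_le_eq)
      moreover have "m \<in> S k"
      proof -
        have "prime_factors m \<subseteq> prime_factors n - {p}"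
          using m m0 n0 by (auto simp: prime_factors_dvd)
        then have sub: "prime_factors m \<subseteq> prime_factors n" "card (prime_factors m) \<le> card (prime_factors n - {p})"
          by (auto intro: card_mono)
        have "card (prime_factors n - {p}) = card (prime_factors n) - 1" using pn by simp
        moreover have "m \<le> n" using m(1) n0 by (metis dvd_imp_le dvd_triv_right)
        ultimately show ?thesis using n sub m0 by (auto simp: S_def)
      qed
      ultimately show ?thesis using m(1) by (auto intro!: rev_image_eqI[of "(p ^ v, m)"])
    qed
  qed
  then have "card (S (Suc k)) \<le> card ((\<lambda>(c,m). c * m) ` (Q \<times> S k))"
    using finQ by (intro card_mono) (auto simp: S_def)
  also have "\<dots> \<le> card (Q \<times> S k)" using finQ by (intro card_image_le) (auto simp: S_def)
  also have "\<dots> = card Q * card (S k)" by (rule card_cartesian_product)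
  also have "\<dots> \<le> (W * E + 1) * (W * E + 1) ^ k" using Suc cQ unfolding S_def by (intro mult_mono) auto
  finally show ?case by (simp add: S_def)
qed

text \<open>Split by the number of distinct prime factors. More than \<open>k\<close> of them force
  at least \<open>2 ^ k\<close> divisors, which the mean of the divisor function allows only rarely;
  the remaining integers are counted directly.\<close>

lemma card_smooth_le:
  assumes "N < 2 ^ E"
  shows "real (card {n\<in>{1..N}. \<forall>p\<in>prime_factors n. p \<le> W}) \<le> real (W * E + 1) ^ k + real N * (1 + ln (real N)) / 2 ^ k"
proof -
  define X where "X = {n\<in>{1..N}. card (prime_factors n) > k}"
  have "2 ^ k * real (card X) = (\<Sum>n\<in>X. 2 ^ k)" by simp
  also have "\<dots> \<le> (\<Sum>n\<in>X. real (card {d. d dvd n}))"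
  proof (intro sum_mono)
    fix n assume n: "n \<in> X"
    have "(2::nat) ^ k \<le> 2 ^ card (prime_factors n)" using n by (intro power_increasing) (auto simp: X_def)
    also have "\<dots> \<le> card {d. d dvd n}" using n by (intro two_power_omega_le) (auto simp: X_def)
    finally show "2 ^ k \<le> real (card {d. d dvd n})" by (metis of_nat_le_iff of_nat_numeral of_nat_power)
  qed
  also have "\<dots> \<le> (\<Sum>n\<in>{1..N}. real (card {d. d dvd n}))" by (intro sum_mono2) (auto simp: X_def)
  also have "\<dots> \<le> real N * (1 + ln (real N))" by (rule sum_card_divisors_le)
  finally have X: "real (card X) \<le> real N * (1 + ln (real N)) / 2 ^ k" by (simp add: field_simps)
  have "{n\<in>{1..N}. \<forall>p\<in>prime_factors n. p \<le> W} \<subseteq>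
     {n\<in>{1..N}. (\<forall>p\<in>prime_factors n. p \<le> W) \<and> card (prime_factors n) \<le> k} \<union> X"
    by (auto simp: X_def)
  then have "card {n\<in>{1..N}. \<forall>p\<in>prime_factors n. p \<le> W} \<le>
     card ({n\<in>{1..N}. (\<forall>p\<in>prime_factors n. p \<le> W) \<and> card (prime_factors n) \<le> k} \<union> X)"
    by (intro card_mono) (auto simp: X_def)
  also have "\<dots> \<le> (W * E + 1) ^ k + card X"
    using card_Un_le card_smooth_few_primes[OF assms] by (meson add_right_mono order_trans)
  finally have "real (card {n\<in>{1..N}. \<forall>p\<in>prime_factors n. p \<le> W}) \<le> real ((W * E + 1) ^ k + card X)"
    by (simp only: of_nat_le_iff)
  then show ?thesis using X by simp
qed

lemma smooth_count_aux:
  fixes c K :: real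
  assumes "c > 0"
  shows "eventually (\<lambda>x. sqrt x + x * (1 + ln x) * 2 * 2 powr (- (ln x / (c * ln (ln x)))) \<le> x / ln x powr K) at_top"
  using assms by real_asymp

text \<open>The threshold \<open>k\<close> for the number of prime factors is about
  \<open>ln x / (2 * (C + 2) * ln (ln x))\<close>: since \<open>W * E + 1\<close> is at most
  \<open>ln x powr (C + 2)\<close>, its \<open>k\<close>-th power stays below \<open>sqrt x\<close>,
  while \<open>2 ^ k\<close> still grows faster than any power of \<open>ln x\<close>.\<close>

lemma smooth_count:
  fixes C K :: real
  assumes C: "C > 0"
  shows "eventually (\<lambda>x. real (card {n\<in>{1..nat \<lfloor>x\<rfloor>}. \<forall>p. prime p \<and> p dvd n \<longrightarrow> real p \<le> ln x powr C})
    \<le> x / ln x powr K) at_top"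
proof -
  define c where "c = 2 * (C + 2)"
  have c: "c > 0" using C by (simp add: c_def)
  have ev1: "eventually (\<lambda>x::real. ln x powr C * (2 * ln x + 1) + 1 \<le> ln x powr (C + 2)) at_top"
    using C by real_asymp
  have ev2: "eventually (\<lambda>x::real. ln x > 1) at_top" by real_asymp
  show ?thesis
    using smooth_count_aux[OF c, of K] ev1 ev2 eventually_gt_at_top[of 1]
  proof eventually_elim
    case (elim x)
    define N where "N = nat \<lfloor>x\<rfloor>"
    define W where "W = nat \<lfloor>ln x powr C\<rfloor>"
    define E where "E = nat \<lceil>2 * ln x\<rceil>"
    define t where "t = ln x / (c * ln (ln x))"
    define k where "k = nat \<lfloor>t\<rfloor>"
    have lx: "ln x > 1" and x: "x > 1" using elim by auto
    have llx: "ln (ln x) > 0" using lx by simp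
    have t: "t > 0" unfolding t_def using lx llx c by simp
    have k: "real k \<le> t" "t - 1 < real k" unfolding k_def using t by linarith+
    have N1: "real N \<le> x" "N \<ge> 1" unfolding N_def using x by linarith+
    have E: "2 * ln x \<le> real E" "real E \<le> 2 * ln x + 1" unfolding E_def using lx by linarith+
    have W: "real W \<le> ln x powr C" unfolding W_def by simp
    have "real N < 2 ^ E"
    proof -
      have "ln x * 1 < ln x * (2 * ln 2)" using lx half_less_ln_2 by (intro mult_strict_left_mono) auto
      then have "exp (ln x) < exp (2 * ln x * ln 2)" by (subst exp_less_cancel_iff) (simp add: mult_ac)
      also have "\<dots> = 2 powr (2 * ln x)" by (simp add: powr_def)
      also have "\<dots> \<le> 2 powr real E" using E by (intro powr_mono) auto
      also have "\<dots> = 2 ^ E" by (simp add: powr_realpow)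
      finally have "x < 2 ^ E" using x by simp
      then show ?thesis by (rule le_less_trans[OF N1(1)])
    qed
    then have NE: "N < 2 ^ E" by (metis of_nat_less_iff of_nat_numeral of_nat_power)
    have sub: "{n\<in>{1..N}. \<forall>p. prime p \<and> p dvd n \<longrightarrow> real p \<le> ln x powr C} \<subseteq> {n\<in>{1..N}. \<forall>p\<in>prime_factors n. p \<le> W}"
      unfolding W_def by (auto simp: le_nat_floor)
    have "real (card {n\<in>{1..N}. \<forall>p. prime p \<and> p dvd n \<longrightarrow> real p \<le> ln x powr C}) \<le>
        real (card {n\<in>{1..N}. \<forall>p\<in>prime_factors n. p \<le> W})"
      using sub by (intro of_nat_mono card_mono) auto
    also have "\<dots> \<le> real (W * E + 1) ^ k + real N * (1 + ln (real N)) / 2 ^ k"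
      by (rule card_smooth_le[OF NE])
    also have "real (W * E + 1) ^ k \<le> sqrt x"
    proof -
      have "real W * real E \<le> ln x powr C * (2 * ln x + 1)" using W E by (intro mult_mono) auto
      then have "real (W * E + 1) \<le> ln x powr (C + 2)" using elim by simp
      then have "real (W * E + 1) ^ k \<le> (ln x powr (C + 2)) ^ k" by (intro power_mono) auto
      also have "\<dots> = exp ((C + 2) * ln (ln x) * real k)"
        using lx by (simp add: powr_def exp_of_nat_mult[symmetric] mult_ac)
      also have "\<dots> \<le> exp ((C + 2) * ln (ln x) * t)"
        using C llx k by (subst exp_le_cancel_iff, intro mult_left_mono) auto
      also have "(C + 2) * ln (ln x) * t = ln x / 2"
      proof -
        have "d * l * (a / (2 * d * l)) = a / 2" if "d > 0" "l > 0" for a d l :: real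
          using that by (simp add: field_simps)
        from this[of "C + 2" "ln (ln x)" "ln x"] show ?thesis unfolding t_def c_def using C llx by simp
      qed
      also have "exp (ln x / 2) = sqrt x" using x by (simp add: ln_sqrt[symmetric])
      finally show ?thesis .
    qed
    \<comment> \<open>Since \<open>k\<close> exceeds \<open>t - 1\<close>, replacing
      \<open>2 ^ k\<close> by \<open>2 powr t\<close> costs a factor 2.\<close>
    also have "real N * (1 + ln (real N)) / 2 ^ k \<le> x * (1 + ln x) * 2 * 2 powr (- t)"
    proof -
      have "2 powr (t - 1) \<le> 2 powr real k" using k by (intro powr_mono) auto
      also have "2 powr real k = 2 ^ k" by (simp add: powr_realpow)
      finally have k2: "2 powr (t - 1) \<le> (2::real) ^ k" .
      have "real N * (1 + ln (real N)) \<le> x * (1 + ln x)"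
        using N1 x by (intro mult_mono) auto
      then have "real N * (1 + ln (real N)) / 2 ^ k \<le> x * (1 + ln x) / 2 powr (t - 1)"
        using k2 x by (intro frac_le) auto
      also have "\<dots> = x * (1 + ln x) * 2 * 2 powr (- t)"
        by (simp add: powr_diff powr_minus field_simps)
      finally show ?thesis .
    qed
    finally show ?case using elim unfolding N_def t_def by linarith
  qed
qed

text \<open>In the second alternative \<open>p\<close> is any integer above \<open>w\<close>; the
  tail of the sum of \<open>1 / p ^ 2\<close> bounds these cases without information on
  primes.\<close>

definition exceptional :: "nat \<Rightarrow> real \<Rightarrow> nat set" where
  "exceptional N w = {n\<in>{1..N}. (\<forall>p. prime p \<and> p dvd n \<longrightarrow> real p \<le> w) \<or> (\<exists>p. w < real p \<and> p ^ 2 dvd n)}"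

lemma exceptional_count:
  assumes "w \<ge> 1"
  shows "real (card (exceptional N w))
    \<le> real (card {n\<in>{1..N}. \<forall>p. prime p \<and> p dvd n \<longrightarrow> real p \<le> w}) + 2 * real N / w"
proof -
  define W where "W = nat \<lfloor>w\<rfloor>"
  have "W \<ge> 1" "w < real W + 1" unfolding W_def using assms by linarith+
  then have W: "W \<ge> 1" "w \<le> 2 * real W" by linarith+
  define X where "X = {n\<in>{1..N}. \<forall>p. prime p \<and> p dvd n \<longrightarrow> real p \<le> w}"
  define Y where "Y = {n\<in>{1..N}. \<exists>p. W < p \<and> p ^ 2 dvd n}"
  have "exceptional N w \<subseteq> X \<union> Y"
  proof
    fix n assume n: "n \<in> exceptional N w"
    show "n \<in> X \<union> Y"
    proof (cases "\<exists>p. w < real p \<and> p ^ 2 dvd n")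
      case True
      then obtain p where p: "w < real p" "p ^ 2 dvd n" by blast
      then have "W < p" unfolding W_def using assms by linarith
      then show ?thesis using n p by (auto simp: Y_def exceptional_def)
    next
      case False
      then show ?thesis using n by (auto simp: X_def exceptional_def)
    qed
  qed
  then have "card (exceptional N w) \<le> card (X \<union> Y)"
    by (intro card_mono) (auto simp: X_def Y_def)
  also have "\<dots> \<le> card X + card Y" by (rule card_Un_le)
  finally have "real (card (exceptional N w))
     \<le> real (card X) + real (card Y)" by linarith
  also have "real (card Y) \<le> real N / real W" unfolding Y_def by (rule card_square_divisible_le[OF W(1)])
  also have "real N / real W \<le> 2 * real N / w"
    using W assms mult_left_mono[OF W(2), of "real N"] by (simp add: field_simps)
  finally show ?thesis by (simp add: X_def)
qed

section \<open>Mean values of smooth-supported functions over characters\<close>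

definition prime_count :: "nat set \<Rightarrow> nat \<Rightarrow> nat" where
  "prime_count P n = card {p\<in>P. p dvd n}"

text \<open>The value 0 at \<open>m = 0\<close> lets later sums over \<open>m\<close> start at
  0.\<close>

definition cofactor :: "nat set \<Rightarrow> (nat \<Rightarrow> complex) \<Rightarrow> nat \<Rightarrow> complex" where
  "cofactor P g m = (if m = 0 then 0 else g m / of_nat (1 + prime_count P m))"

text \<open>By the identity of Ramare, \<open>ramare_error\<close> vanishes at every \<open>n\<close> that has a prime
  factor in \<open>P\<close>, and whose prime factors in \<open>P\<close> are all simple.\<close>

definition ramare_error :: "nat set \<Rightarrow> (nat \<Rightarrow> complex) \<Rightarrow> nat \<Rightarrow> complex" where
  "ramare_error P g n = g n - (\<Sum>p\<in>{p\<in>P. p dvd n}. g p * cofactor P g (n div p))"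

lemma norm_cofactor_le:
  assumes "\<And>n. n \<ge> 1 \<Longrightarrow> norm (g n) \<le> 1"
  shows "norm (cofactor P g m) \<le> 1"
proof (cases "m = 0")
  case False
  then have "norm (g m) \<le> 1" using assms by simp
  then have "norm (g m) \<le> real (1 + prime_count P m)" by simp
  then show ?thesis using False by (simp add: cofactor_def norm_divide divide_le_eq_1 del: of_nat_Suc of_nat_add)
qed (simp add: cofactor_def)

lemma prime_count_mult:
  assumes P: "finite P" "\<And>p. p \<in> P \<Longrightarrow> prime p" and p: "p \<in> P" and m: "m > 0"
  shows "prime_count P (p * m) \<le> 1 + prime_count P m" "\<not> p dvd m \<Longrightarrow> prime_count P (p * m) = 1 + prime_count P m"
proof -
  have eq: "{q\<in>P. q dvd p * m} = insert p {q\<in>P. q dvd m}"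
  proof -
    have "q dvd p \<longleftrightarrow> q = p" if "q \<in> P" for q
      using primes_dvd_imp_eq[OF P(2)[OF that] P(2)[OF p]] by auto
    then show ?thesis using P(2) p by (auto simp: prime_dvd_mult_iff)
  qed
  show "prime_count P (p * m) \<le> 1 + prime_count P m"
    unfolding prime_count_def eq using P(1) by (simp add: card_insert_if)
  show "prime_count P (p * m) = 1 + prime_count P m" if "\<not> p dvd m"
    unfolding prime_count_def eq using P(1) that by (subst card_insert_disjoint) auto
qed

text \<open>Dividing \<open>n\<close> by a prime \<open>p\<close> lowers the number of its primes in
  \<open>P\<close> by at most one, so each of the \<open>card S\<close> terms has absolute value at
  most \<open>1 / card S\<close>. This covers the case that \<open>p ^ 2\<close> divides
  \<open>n\<close>, so the error is bounded everywhere.\<close>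

lemma norm_ramare_error_le:
  assumes P: "finite P" "\<And>p. p \<in> P \<Longrightarrow> prime p"
    and g: "\<And>n. n \<ge> 1 \<Longrightarrow> norm (g n) \<le> 1" and n: "n \<ge> 1"
  shows "norm (ramare_error P g n) \<le> 2"
proof -
  define S where "S = {p\<in>P. p dvd n}"
  have "norm (\<Sum>p\<in>S. g p * cofactor P g (n div p)) \<le> (\<Sum>p\<in>S. 1 / real (card S))"
  proof (rule order_trans[OF norm_sum sum_mono])
    fix p assume p: "p \<in> S"
    then have pP: "p \<in> P" "p dvd n" by (auto simp: S_def)
    obtain m where m: "n = p * m" using pP by blast
    have p0: "p > 0" using P(2)[OF pP(1)] prime_gt_0_nat by blast
    have m0: "m > 0" using m n by (auto intro: Nat.gr0I)
    have "card S \<le> 1 + prime_count P m" using prime_count_mult(1)[OF P pP(1) m0] m by (simp add: S_def prime_count_def)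
    moreover have "card S > 0" using p P(1) by (auto simp: card_gt_0_iff S_def)
    ultimately have le: "1 / real (1 + prime_count P m) \<le> 1 / real (card S)" by (intro divide_left_mono) auto
    have "norm (g p * cofactor P g (n div p)) = norm (g p) * (norm (g m) / real (1 + prime_count P m))"
      using m p0 m0 by (simp add: norm_mult cofactor_def norm_divide del: of_nat_Suc of_nat_add)
    also have "\<dots> \<le> 1 * (1 / real (1 + prime_count P m))"
      using g[of p] g[of m] p0 m0 by (intro mult_mono divide_right_mono) auto
    finally show "norm (g p * cofactor P g (n div p)) \<le> 1 / real (card S)" using le by linarith
  qed
  also have "\<dots> \<le> 1" by simp
  finally have "norm (\<Sum>p\<in>S. g p * cofactor P g (n div p)) \<le> 1" .
  then show ?thesis unfolding ramare_error_def S_def[symmetric]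
    using g[OF n] norm_triangle_ineq4[of "g n" "\<Sum>p\<in>S. g p * cofactor P g (n div p)"] by linarith
qed

text \<open>When \<open>p\<close> divides \<open>n\<close> exactly once,
  \<open>g p * g (n div p) = g n\<close>, and \<open>1 + prime_count P (n div p)\<close> is the
  number of primes of \<open>P\<close> dividing \<open>n\<close>. All terms are then equal and add
  up to \<open>g n\<close>.\<close>

lemma ramare_error_eq_0:
  assumes P: "finite P" "\<And>p. p \<in> P \<Longrightarrow> prime p"
    and mult: "\<And>m n. m > 0 \<Longrightarrow> n > 0 \<Longrightarrow> coprime m n \<Longrightarrow> g (m * n) = g m * g n"
    and n: "n \<ge> 1" and ex: "\<exists>p\<in>P. p dvd n" and sq: "\<And>p. p \<in> P \<Longrightarrow> \<not> p ^ 2 dvd n"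
  shows "ramare_error P g n = 0"
proof -
  define S where "S = {p\<in>P. p dvd n}"
  have cS: "card S > 0" using ex P(1) by (auto simp: card_gt_0_iff S_def)
  have "(\<Sum>p\<in>S. g p * cofactor P g (n div p)) = (\<Sum>p\<in>S. g n / of_nat (card S))"
  proof (intro sum.cong refl)
    fix p assume "p \<in> S"
    then have pP: "p \<in> P" "p dvd n" by (auto simp: S_def)
    obtain m where m: "n = p * m" using pP by blast
    have pp: "prime p" using P(2) pP(1) .
    have p0: "p > 0" using pp prime_gt_0_nat by blast
    have m0: "m > 0" using m n by (auto intro: Nat.gr0I)
    have ndvd: "\<not> p dvd m" using sq[OF pP(1)] m by (auto simp: power2_eq_square)
    have "card S = 1 + prime_count P m" using prime_count_mult(2)[OF P pP(1) m0 ndvd] m by (simp add: S_def prime_count_def)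
    moreover have "g n = g p * g m"
      unfolding m using p0 m0 pp ndvd by (intro mult) (auto intro: prime_imp_coprime)
    ultimately show "g p * cofactor P g (n div p) = g n / of_nat (card S)"
      using m p0 m0 by (simp add: cofactor_def)
  qed
  also have "\<dots> = g n" using cS by simp
  finally show ?thesis unfolding ramare_error_def S_def[symmetric] by simp
qed

section \<open>The mean value over primitive characters\<close>

lemma sum_sqrt2_powers: "(\<Sum>i\<le>m. sqrt 2 ^ i) \<le> 4 * sqrt 2 ^ m"
proof (induction m)
  case (Suc m)
  \<comment> \<open>This is the condition \<open>4 + sqrt 2 \<le> 4 * sqrt 2\<close> under which the
    constant 4 survives the induction step.\<close>
  have "(4::real)/3 \<le> sqrt 2" by (rule real_le_rsqrt) (simp add: power2_eq_square)
  then have "4 * sqrt 2 ^ m \<le> 3 * sqrt 2 * sqrt 2 ^ m" by (intro mult_right_mono) auto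
  with Suc have "(\<Sum>i\<le>m. sqrt 2 ^ i) \<le> 3 * (sqrt 2 * sqrt 2 ^ m)" by (simp only: mult.assoc)
  then show ?case by simp
qed simp

text \<open>A sum of square roots of dyadic scales is dominated by its largest term, so no factor
  for the number of scales is lost.\<close>

lemma sum_sqrt2_powers_le:
  assumes "finite I" "\<And>i. i \<in> I \<Longrightarrow> sqrt 2 ^ i \<le> Y" "Y \<ge> 0"
  shows "(\<Sum>i\<in>I. sqrt 2 ^ i) \<le> 4 * Y"
proof (cases "I = {}")
  case False
  have "(\<Sum>i\<in>I. sqrt 2 ^ i) \<le> (\<Sum>i\<le>Max I. sqrt 2 ^ i)" using assms(1) by (intro sum_mono2) auto
  also have "\<dots> \<le> 4 * sqrt 2 ^ Max I" by (rule sum_sqrt2_powers)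
  also have "\<dots> \<le> 4 * Y" using assms(2)[OF Max_in[OF assms(1) False]] by simp
  finally show ?thesis .
qed (use assms in simp)

lemma sqrt_add_mult_le:
  assumes "u \<ge> 0" "v \<ge> 0" "R \<ge> 0"
  shows "sqrt ((u + R ^ 2) * (v + R ^ 2)) \<le> (sqrt u + R) * (sqrt v + R)"
proof -
  have "sqrt (u + R ^ 2) \<le> sqrt u + R" if "u \<ge> 0" for u
    using sqrt_add_le_add_sqrt[of u "R ^ 2"] that assms(3) by simp
  then show ?thesis unfolding real_sqrt_mult using assms by (intro mult_mono) auto
qed

text \<open>For primes of size about \<open>T\<close> the bilinear large sieve gives
  \<open>(sqrt (2 * T) + R) * (sqrt (2 * N / T) + R) * sqrt N\<close>. Two of the four products do
  not depend on \<open>T\<close>; the one with \<open>sqrt T\<close> sums geometrically and is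
  governed by \<open>T \<le> y\<close>, the one with \<open>1 / sqrt T\<close> by
  \<open>T > w / 2\<close>. The bound is kept as a quadratic polynomial in \<open>R\<close>, ready
  for partial summation over the conductor.\<close>

lemma mean_value:
  fixes g :: "nat \<Rightarrow> complex" and w y :: real
  assumes mult: "\<And>m n. m > 0 \<Longrightarrow> n > 0 \<Longrightarrow> coprime m n \<Longrightarrow> g (m * n) = g m * g n"
    and g: "\<And>n. n \<ge> 1 \<Longrightarrow> norm (g n) \<le> 1"
    and supp: "\<And>n. n \<ge> 1 \<Longrightarrow> g n \<noteq> 0 \<Longrightarrow> smooth y n"
    and R: "R > 0" "R ^ 2 \<le> N" and J: "N + 1 < 2 ^ J" and w: "w \<ge> 1" and y: "y \<le> real N" "y \<ge> 0"
    and E: "real (card (exceptional N w)) \<le> \<epsilon>"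
  shows "prim_sum R (\<lambda>\<psi>. norm (\<Sum>n\<in>{1..N}. g n * cnj (\<psi> n))) \<le>
    24 * real J ^ 2 * N + (12 * J * (6 * sqrt (N * y) + 2 * J * N / sqrt w) + 12 * sqrt (N * \<epsilon>)) * R
      + 12 * real J ^ 2 * sqrt N * real R ^ 2"
proof -
  define P where "P = {p. prime p \<and> w < real p \<and> real p \<le> y}"
  have "P \<subseteq> {..nat \<lfloor>y\<rfloor>}" unfolding P_def using le_nat_floor by blast
  then have finP: "finite P" using finite_subset by blast
  have prP: "prime p" if "p \<in> P" for p using that by (simp add: P_def)
  have "0 < R ^ 2" using R(1) by simp
  then have N1: "real N \<ge> 1" using R(2) by linarith
  define b where "b = cofactor P g"
  define e where "e = (\<lambda>n. if n = 0 then 0 else ramare_error P g n)"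
  \<comment> \<open>The dyadic scale of \<open>p\<close>, the integer part of its binary
    logarithm.\<close>
  define il where "il = (\<lambda>p::nat. SOME i. 2 ^ i \<le> p \<and> p < 2 ^ (i + 1))"
  have il: "2 ^ il p \<le> p" "p < 2 ^ Suc (il p)" if "p \<in> P" for p
  proof -
    have "p \<ge> 1" using prime_ge_1_nat[OF prP[OF that]] .
    then have "\<exists>i. 2 ^ i \<le> p \<and> p < 2 ^ (i + 1)" by (intro ex_power_ivl1) auto
    then have "2 ^ il p \<le> p \<and> p < 2 ^ (il p + 1)" unfolding il_def by (rule someI_ex)
    then show "2 ^ il p \<le> p" "p < 2 ^ Suc (il p)" by auto
  qed
  define I where "I = il ` P"
  have finI: "finite I" using finP by (simp add: I_def)
  have Iy: "2 ^ i \<le> y" "w < 2 * 2 ^ i" if i: "i \<in> I" for i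
  proof -
    obtain p where p: "p \<in> P" "i = il p" using i by (auto simp: I_def)
    have "real (2 ^ i) \<le> real p" using il(1)[OF p(1)] p(2) by (simp only: of_nat_le_iff)
    also have "real p \<le> y" using p(1) by (simp add: P_def)
    finally show "2 ^ i \<le> y" by simp
    have "w < real p" using p(1) by (simp add: P_def)
    also have "real p < real (2 ^ Suc i)" using il(2)[OF p(1)] p(2) by (simp only: of_nat_less_iff)
    finally show "w < 2 * 2 ^ i" by simp
  qed
  have IN: "2 ^ i \<le> N" if "i \<in> I" for i
  proof -
    have "real (2 ^ i) \<le> y" using Iy(1)[OF that] by simp
    then have "real (2 ^ i) \<le> real N" using y(1) by linarith
    then show ?thesis by (simp only: of_nat_le_iff)
  qed
  have "I \<subseteq> {..<J}"
  proof
    fix i assume "i \<in> I"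
    have "(2::nat) ^ i < 2 ^ J" using IN[OF \<open>i \<in> I\<close>] J by linarith
    then show "i \<in> {..<J}" by simp
  qed
  then have cI: "card I \<le> J" using card_mono[of "{..<J}" I] by simp
  define a where "a = (\<lambda>i p. if p \<in> P \<and> il p = i then g p else 0)"
  \<comment> \<open>Outside the scale \<open>i\<close> the range is empty. The \<open>Suc\<close>
    turns \<open>m \<le> N div p\<close> into a strict bound; the extra index \<open>m = 0\<close>
    is harmless because \<open>b 0 = 0\<close>.\<close>
  define h where "h = (\<lambda>i p. if p \<in> P \<and> il p = i then Suc (N div p) else 0)"
  define Z where "Z = (\<lambda>i \<psi>. \<Sum>p<2 ^ Suc i. \<Sum>m<h i p. a i p * b m * cnj (\<psi> (p * m)))"
  have split: "(\<Sum>n\<in>{1..N}. g n * cnj (\<psi> n)) = (\<Sum>i\<in>I. Z i \<psi>) + twisted_sum (Suc N) e \<psi>" for \<psi> :: "nat \<Rightarrow> complex"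
  proof -
    have "(\<Sum>n\<in>{1..N}. g n * cnj (\<psi> n)) =
      (\<Sum>n\<in>{1..N}. (\<Sum>p\<in>{p\<in>P. p dvd n}. g p * b (n div p) * cnj (\<psi> n)) + e n * cnj (\<psi> n))"
    proof (intro sum.cong refl)
      fix n assume "n \<in> {1..N}"
      then have "g n = (\<Sum>p\<in>{p\<in>P. p dvd n}. g p * b (n div p)) + e n"
        by (simp add: e_def ramare_error_def b_def)
      then show "g n * cnj (\<psi> n) = (\<Sum>p\<in>{p\<in>P. p dvd n}. g p * b (n div p) * cnj (\<psi> n)) + e n * cnj (\<psi> n)"
        by (simp only: distrib_right sum_distrib_right)
    qed
    also have "\<dots> = (\<Sum>n\<in>{1..N}. \<Sum>p\<in>{p\<in>P. p dvd n}. g p * b (n div p) * cnj (\<psi> n)) + (\<Sum>n\<in>{1..N}. e n * cnj (\<psi> n))"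
      by (rule sum.distrib)
    also have "(\<Sum>n\<in>{1..N}. e n * cnj (\<psi> n)) = twisted_sum (Suc N) e \<psi>"
      unfolding twisted_sum_def by (rule sum.mono_neutral_left) (auto simp: e_def)
    also have "(\<Sum>n\<in>{1..N}. \<Sum>p\<in>{p\<in>P. p dvd n}. g p * b (n div p) * cnj (\<psi> n)) =
      (\<Sum>n\<in>{1..N}. \<Sum>p | p dvd n. (if p \<in> P then g p * b (n div p) * cnj (\<psi> (p * (n div p))) else 0))"
      by (rule sum.cong[OF refl], rule sum.mono_neutral_cong_left) auto
    also have "\<dots> = (\<Sum>m\<in>{1..N}. \<Sum>p\<in>{1..N div m}. (if p \<in> P then g p * b m * cnj (\<psi> (p * m)) else 0))"
      by (rule sum_divisors_swap[of "\<lambda>p m. if p \<in> P then g p * b m * cnj (\<psi> (p * m)) else 0"])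
    also have "\<dots> = (\<Sum>p\<in>P. \<Sum>m\<in>{1..N div p}. g p * b m * cnj (\<psi> (p * m)))"
    proof -
      have p0: "p > 0" if "p \<in> P" for p using prP[OF that] prime_gt_0_nat by blast
      have pN: "p \<le> N" if "p \<in> P" for p using that y(1) by (auto simp: P_def)
      have "(\<Sum>m\<in>{1..N}. \<Sum>p\<in>{1..N div m}. (if p \<in> P then g p * b m * cnj (\<psi> (p * m)) else 0))
        = (\<Sum>m\<in>{1..N}. \<Sum>p\<in>P. (if m \<le> N div p then g p * b m * cnj (\<psi> (p * m)) else 0))"
      proof (rule sum.cong[OF refl])
        fix m assume m: "m \<in> {1..N}"
        have iff: "p \<le> N div m \<longleftrightarrow> m \<le> N div p" if "p \<in> P" for p
          using m p0[OF that] by (simp add: less_eq_div_iff_mult_less_eq mult.commute)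
        have "(\<Sum>p\<in>{1..N div m}. (if p \<in> P then g p * b m * cnj (\<psi> (p * m)) else 0)) =
          (\<Sum>p\<in>{p\<in>P. p \<le> N div m}. g p * b m * cnj (\<psi> (p * m)))"
          by (rule sum.mono_neutral_cong_right) (use p0 in \<open>auto simp: Suc_le_eq\<close>)
        also have "\<dots> = (\<Sum>p\<in>P. (if m \<le> N div p then g p * b m * cnj (\<psi> (p * m)) else 0))"
          by (rule sum.mono_neutral_cong_left) (use finP iff in auto)
        finally show "(\<Sum>p\<in>{1..N div m}. (if p \<in> P then g p * b m * cnj (\<psi> (p * m)) else 0)) =
          (\<Sum>p\<in>P. (if m \<le> N div p then g p * b m * cnj (\<psi> (p * m)) else 0))" .
      qed
      also have "\<dots> = (\<Sum>p\<in>P. \<Sum>m\<in>{1..N}. (if m \<le> N div p then g p * b m * cnj (\<psi> (p * m)) else 0))"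
        by (rule sum.swap)
      also have "\<dots> = (\<Sum>p\<in>P. \<Sum>m\<in>{1..N div p}. g p * b m * cnj (\<psi> (p * m)))"
      proof (rule sum.cong[OF refl], rule sum.mono_neutral_cong_right)
        fix p assume "p \<in> P"
        show "{1..N div p} \<subseteq> {1..N}" using div_le_dividend[of N p] by auto
      qed auto
      finally show ?thesis .
    qed
    also have "\<dots> = (\<Sum>i\<in>I. \<Sum>p\<in>{p\<in>P. il p = i}. \<Sum>m\<in>{1..N div p}. g p * b m * cnj (\<psi> (p * m)))"
      by (rule sum.group[symmetric]) (use finP finI in \<open>auto simp: I_def\<close>)
    also have "\<dots> = (\<Sum>i\<in>I. Z i \<psi>)"
    proof (rule sum.cong[OF refl])
      fix i assume "i \<in> I"
      show "(\<Sum>p\<in>{p\<in>P. il p = i}. \<Sum>m\<in>{1..N div p}. g p * b m * cnj (\<psi> (p * m))) = Z i \<psi>"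
        unfolding Z_def
      proof (rule sum.mono_neutral_cong_left)
        show "{p\<in>P. il p = i} \<subseteq> {..<2 ^ Suc i}" using il(2) by auto
        fix p assume p: "p \<in> {p\<in>P. il p = i}"
        have "(\<Sum>m\<in>{1..N div p}. g p * b m * cnj (\<psi> (p * m))) = (\<Sum>m<Suc (N div p). g p * b m * cnj (\<psi> (p * m)))"
          by (rule sum.mono_neutral_left) (auto simp: b_def cofactor_def)
        then show "(\<Sum>m\<in>{1..N div p}. g p * b m * cnj (\<psi> (p * m))) = (\<Sum>m<h i p. a i p * b m * cnj (\<psi> (p * m)))"
          using p by (simp add: h_def a_def)
      qed (auto simp: h_def)
    qed
    finally show ?thesis .
  qed
  have main: "prim_sum R (\<lambda>\<psi>. norm (Z i \<psi>)) \<le>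
     12 * J * (2 * N + (sqrt (2 * N) * sqrt 2 ^ i) * R + (2 * N / sqrt w) * R + sqrt N * real R ^ 2)"
    if i: "i \<in> I" for i
  proof -
    define T :: real where "T = 2 ^ i"
    have T: "T > 0" "w < 2 * T" using Iy(2)[OF i] by (simp_all add: T_def)
    have TN: "T \<le> real N" using Iy(1)[OF i] y(1) unfolding T_def by (rule order_trans)
    define Ni where "Ni = Suc (N div 2 ^ i)"
    have Ni: "real Ni \<le> 2 * N / T"
    proof -
      have "real Ni \<le> real N / T + 1" using of_nat_div_le_of_nat[of N "2 ^ i", where ?'a = real]
        by (simp add: Ni_def T_def)
      also have "1 \<le> real N / T" using T TN by simp
      finally show ?thesis by simp
    qed
    have "prim_sum R (\<lambda>\<psi>. norm (Z i \<psi>)) \<le> J * (12 * sqrt ((real (2 ^ Suc i) + real R ^ 2) * (Ni + real R ^ 2)) *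
        sqrt ((\<Sum>p<2 ^ Suc i. norm (a i p) ^ 2) * (\<Sum>m<Ni. norm (b m) ^ 2)))"
      unfolding Z_def
    proof (rule bilinear_large_sieve[OF R(1)])
      fix p :: nat
      show "h i p \<le> Ni"
        unfolding h_def Ni_def using il(1)[of p] div_le_mono2[of "2 ^ i" p N] by auto
      have "Ni \<le> Suc N" unfolding Ni_def by simp
      then show "Ni < 2 ^ J" using J by simp
    qed
    also have "\<dots> \<le> J * (12 * ((sqrt (2 * T) + R) * (sqrt (2 * N / T) + R)) * sqrt N)"
    proof (intro mult_left_mono mult_mono)
      have "sqrt ((real (2 ^ Suc i) + real R ^ 2) * (Ni + real R ^ 2)) \<le> sqrt ((2 * T + real R ^ 2) * (2 * N / T + real R ^ 2))"
        using Ni T by (intro real_sqrt_le_mono mult_mono) (auto simp: T_def)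
      also have "\<dots> \<le> (sqrt (2 * T) + R) * (sqrt (2 * N / T) + R)"
        using T by (intro sqrt_add_mult_le) auto
      finally show "sqrt ((real (2 ^ Suc i) + real R ^ 2) * (Ni + real R ^ 2)) \<le> (sqrt (2 * T) + R) * (sqrt (2 * N / T) + R)" .
      have "(\<Sum>p<2 ^ Suc i. norm (a i p) ^ 2) \<le> (\<Sum>p\<in>{2 ^ i..<2 ^ Suc i::nat}. 1)"
      proof -
        have "(\<Sum>p<2 ^ Suc i. norm (a i p) ^ 2) = (\<Sum>p\<in>{2 ^ i..<2 ^ Suc i}. norm (a i p) ^ 2)"
          by (rule sum.mono_neutral_right) (use il(1) in \<open>auto simp: a_def\<close>)
        also have "\<dots> \<le> (\<Sum>p\<in>{2 ^ i..<2 ^ Suc i::nat}. 1)"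
        proof (rule sum_mono)
          fix p :: nat assume "p \<in> {2 ^ i..<2 ^ Suc i}"
          then have "p \<ge> 1" using one_le_power[of "2::nat" i] by simp
          then show "norm (a i p) ^ 2 \<le> 1" using g[of p] by (auto simp: a_def power_le_one)
        qed
        finally show ?thesis .
      qed
      then have A: "(\<Sum>p<2 ^ Suc i. norm (a i p) ^ 2) \<le> T" by (simp add: T_def)
      \<comment> \<open>As \<open>b 0 = 0\<close>, only \<open>N div 2 ^ i\<close> terms remain,
        which gives \<open>N / T\<close> with no extra 1; its product with the bound
        \<open>T\<close> for the other factor is exactly \<open>N\<close>.\<close>
      have "(\<Sum>m<Ni. norm (b m) ^ 2) = (\<Sum>m\<in>{1..<Ni}. norm (b m) ^ 2)"
        by (rule sum.mono_neutral_right) (auto simp: b_def cofactor_def Suc_le_eq)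
      also have "\<dots> \<le> (\<Sum>m\<in>{1..<Ni}. 1)"
        unfolding b_def by (intro sum_mono power_le_one norm_cofactor_le g) auto
      also have "\<dots> \<le> real N / T" using of_nat_div_le_of_nat[of N "2 ^ i", where ?'a = real]
        by (simp add: Ni_def T_def)
      finally have B: "(\<Sum>m<Ni. norm (b m) ^ 2) \<le> real N / T" .
      have "(\<Sum>p<2 ^ Suc i. norm (a i p) ^ 2) * (\<Sum>m<Ni. norm (b m) ^ 2) \<le> T * (real N / T)"
        using A B T by (intro mult_mono sum_nonneg) auto
      then show "sqrt ((\<Sum>p<2 ^ Suc i. norm (a i p) ^ 2) * (\<Sum>m<Ni. norm (b m) ^ 2)) \<le> sqrt N"
        using T by (intro real_sqrt_le_mono) simp
    qed (use T in \<open>auto intro!: sum_nonneg mult_nonneg_nonneg\<close>)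
    also have "\<dots> \<le> 12 * J * (2 * N + (sqrt (2 * N) * sqrt 2 ^ i) * R + (2 * N / sqrt w) * R + sqrt N * real R ^ 2)"
    proof -
      have sT: "sqrt T = sqrt 2 ^ i" by (simp add: T_def real_sqrt_power)
      have e1: "sqrt (2 * T) * sqrt (2 * N / T) * sqrt N = 2 * N"
        using T by (simp add: real_sqrt_mult[symmetric] mult_ac) (simp add: real_sqrt_mult)
      have e2: "sqrt (2 * T) * sqrt N = sqrt (2 * N) * sqrt 2 ^ i"
        by (simp add: real_sqrt_mult sT mult_ac)
      have e3: "sqrt (2 * N / T) * sqrt N \<le> 2 * N / sqrt w"
      proof -
        have "sqrt (2 * N / T) \<le> sqrt (4 * N / w)"
          using T w N1 by (intro real_sqrt_le_mono) (simp add: field_simps mult_left_mono)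
        then have "sqrt (2 * N / T) * sqrt N \<le> sqrt (4 * N / w) * sqrt N" by (intro mult_right_mono) auto
        also have "\<dots> = 2 * N / sqrt w" by (simp add: real_sqrt_mult real_sqrt_divide)
        finally show ?thesis .
      qed
      have "(sqrt (2 * T) + R) * (sqrt (2 * N / T) + R) * sqrt N =
        sqrt (2 * T) * sqrt (2 * N / T) * sqrt N + (sqrt (2 * T) * sqrt N) * R +
        (sqrt (2 * N / T) * sqrt N) * R + sqrt N * real R ^ 2"
        by (simp add: algebra_simps power2_eq_square)
      also have "\<dots> \<le> 2 * N + (sqrt (2 * N) * sqrt 2 ^ i) * R + (2 * N / sqrt w) * R + sqrt N * real R ^ 2"
        unfolding e1 e2 using e3 by (intro add_mono mult_right_mono) auto
      finally have "12 * real J * ((sqrt (2 * T) + R) * (sqrt (2 * N / T) + R) * sqrt N) \<le>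
         12 * real J * (2 * N + (sqrt (2 * N) * sqrt 2 ^ i) * R + (2 * N / sqrt w) * R + sqrt N * real R ^ 2)"
        by (rule mult_left_mono) simp
      then show ?thesis by (simp add: mult_ac)
    qed
    finally show ?thesis .
  qed
  have err: "prim_sum R (\<lambda>\<psi>. norm (twisted_sum (Suc N) e \<psi>)) \<le> 12 * sqrt (N * \<epsilon>) * R"
  proof -
    define X where "X = exceptional N w"
    \<comment> \<open>An \<open>n\<close> outside \<open>X\<close> has a prime factor above
      \<open>w\<close>. If none of its prime factors lies in \<open>P\<close>, that factor exceeds
      \<open>y\<close>, so \<open>g n = 0\<close> by the support and Ramare's sum is empty;
      otherwise the identity applies.\<close>
    have e0: "e n = 0" if n: "n \<in> {1..N}" "n \<notin> X" for n
    proof -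
      obtain p where p: "prime p" "p dvd n" "real p > w" using n by (auto simp: X_def exceptional_def not_le)
      have sq: "\<not> q ^ 2 dvd n" if "q \<in> P" for q using n that by (auto simp: X_def exceptional_def P_def)
      show ?thesis
      proof (cases "\<exists>p\<in>P. p dvd n")
        case True
        then show ?thesis
          using ramare_error_eq_0[OF finP prP mult _ True sq] n by (auto simp: e_def)
      next
        case False
        then have "\<not> smooth y n" using p by (auto simp: smooth_def P_def)
        then have g0: "g n = 0" using supp[of n] n by auto
        have P0: "{p\<in>P. p dvd n} = {}" using False by auto
        have "ramare_error P g n = 0" unfolding ramare_error_def P0 g0 by simp
        then show ?thesis by (simp add: e_def)
      qed
    qed
    have "(\<Sum>n<Suc N. norm (e n) ^ 2) = (\<Sum>n\<in>X. norm (e n) ^ 2)"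
    proof (rule sum.mono_neutral_right)
      show "\<forall>n\<in>{..<Suc N} - X. norm (e n) ^ 2 = 0"
      proof
        fix n assume "n \<in> {..<Suc N} - X"
        then show "norm (e n) ^ 2 = 0" using e0[of n] by (cases "n = 0") (auto simp: e_def)
      qed
    qed (auto simp: X_def exceptional_def)
    also have "\<dots> \<le> (\<Sum>n\<in>X. 4)"
    proof (rule sum_mono)
      fix n assume "n \<in> X"
      then have "norm (e n) \<le> 2"
        using norm_ramare_error_le[OF finP prP g, where n = n] by (auto simp: e_def X_def exceptional_def)
      then have "norm (e n) ^ 2 \<le> 2 ^ 2" by (intro power_mono) auto
      then show "norm (e n) ^ 2 \<le> 4" by simp
    qed
    also have "\<dots> \<le> 4 * \<epsilon>" using E by (simp add: X_def)
    finally have en: "(\<Sum>n<Suc N. norm (e n) ^ 2) \<le> 4 * \<epsilon>" .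
    have "prim_sum R (\<lambda>\<psi>. norm (twisted_sum (Suc N) e \<psi>)) \<le> R * sqrt (12 * (Suc N + real R ^ 2) * (\<Sum>n<Suc N. norm (e n) ^ 2))"
      by (rule large_sieve_L1[OF R(1)])
    also have "\<dots> \<le> R * sqrt (12 * (3 * real N) * (4 * \<epsilon>))"
    proof (intro mult_left_mono real_sqrt_le_mono mult_mono en)
      have "real R ^ 2 \<le> real N" using R(2) by (metis of_nat_le_iff of_nat_power)
      then show "real (Suc N) + real R ^ 2 \<le> 3 * real N" using N1 unfolding of_nat_Suc by linarith
    qed (auto intro!: sum_nonneg simp del: sum.lessThan_Suc)
    \<comment> \<open>The 12 of the large sieve, the 3 from \<open>Suc N + R ^ 2 \<le> 3 * N\<close>
      and the 4 from the squared bound 2 for the error multiply to \<open>12 ^ 2\<close>.\<close>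
    also have "sqrt (12 * (3 * real N) * (4 * \<epsilon>)) = sqrt (12 ^ 2 * (real N * \<epsilon>))" by simp
    also have "\<dots> = 12 * sqrt (N * \<epsilon>)" by (subst real_sqrt_mult, subst real_sqrt_abs) simp
    finally show ?thesis by (simp add: mult_ac)
  qed
  have "prim_sum R (\<lambda>\<psi>. norm (\<Sum>n\<in>{1..N}. g n * cnj (\<psi> n))) \<le>
      prim_sum R (\<lambda>\<psi>. (\<Sum>i\<in>I. norm (Z i \<psi>)) + norm (twisted_sum (Suc N) e \<psi>))"
  proof (rule prim_sum_mono)
    fix \<psi> :: "nat \<Rightarrow> complex"
    have "norm (\<Sum>i\<in>I. Z i \<psi>) \<le> (\<Sum>i\<in>I. norm (Z i \<psi>))" by (rule norm_sum)
    then show "norm (\<Sum>n\<in>{1..N}. g n * cnj (\<psi> n)) \<le> (\<Sum>i\<in>I. norm (Z i \<psi>)) + norm (twisted_sum (Suc N) e \<psi>)"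
      unfolding split using norm_triangle_ineq[of "\<Sum>i\<in>I. Z i \<psi>" "twisted_sum (Suc N) e \<psi>"] by linarith
  qed
  also have "\<dots> = (\<Sum>i\<in>I. prim_sum R (\<lambda>\<psi>. norm (Z i \<psi>))) + prim_sum R (\<lambda>\<psi>. norm (twisted_sum (Suc N) e \<psi>))"
    by (simp only: prim_sum_add prim_sum_sum)
  also have "\<dots> \<le> (\<Sum>i\<in>I. 12 * J * (2 * N + (sqrt (2 * N) * sqrt 2 ^ i) * R + (2 * N / sqrt w) * R + sqrt N * real R ^ 2))
      + 12 * sqrt (N * \<epsilon>) * R"
    by (intro add_mono sum_mono main err)
  also have "(\<Sum>i\<in>I. 12 * J * (2 * N + (sqrt (2 * N) * sqrt 2 ^ i) * R + (2 * N / sqrt w) * R + sqrt N * real R ^ 2))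
     = 12 * J * (card I * (2 * N + (2 * N / sqrt w) * R + sqrt N * real R ^ 2) + sqrt (2 * N) * R * (\<Sum>i\<in>I. sqrt 2 ^ i))"
    by (simp add: sum.distrib sum_distrib_left[symmetric] algebra_simps) (simp add: sum_distrib_left sum_distrib_right mult_ac)
  also have "\<dots> \<le> 12 * J * (J * (2 * N + (2 * N / sqrt w) * R + sqrt N * real R ^ 2) + 6 * sqrt (N * y) * R)"
  proof (intro mult_left_mono add_mono mult_right_mono)
    show "real (card I) \<le> real J" using cI by simp
    show "0 \<le> 2 * N + (2 * N / sqrt w) * R + sqrt N * real R ^ 2" using w by simp
    have "(\<Sum>i\<in>I. sqrt 2 ^ i) \<le> 4 * sqrt y"
    proof (rule sum_sqrt2_powers_le[OF finI])
      fix i assume "i \<in> I"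
      have "sqrt 2 ^ i = sqrt (2 ^ i)" by (simp add: real_sqrt_power)
      also have "\<dots> \<le> sqrt y" using Iy(1)[OF \<open>i \<in> I\<close>] by (rule real_sqrt_le_mono)
      finally show "sqrt 2 ^ i \<le> sqrt y" .
    qed (use y in simp)
    then have "sqrt (2 * N) * R * (\<Sum>i\<in>I. sqrt 2 ^ i) \<le> sqrt (2 * N) * R * (4 * sqrt y)"
      by (intro mult_left_mono) auto
    also have "\<dots> = (4 * sqrt 2) * (sqrt (N * y) * R)" by (simp add: real_sqrt_mult)
    also have "\<dots> \<le> 6 * (sqrt (N * y) * R)"
    proof (rule mult_right_mono)
      have "sqrt 2 \<le> (3/2 :: real)" by (rule real_le_lsqrt) (simp_all add: power2_eq_square)
      then show "4 * sqrt 2 \<le> (6::real)" by simp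
    qed (use y in simp)
    finally show "sqrt (2 * N) * R * (\<Sum>i\<in>I. sqrt 2 ^ i) \<le> 6 * sqrt (N * y) * R" by simp
  qed simp
  finally show ?thesis by (simp add: algebra_simps power2_eq_square)
qed

section \<open>Reduction of the discrepancy to primitive characters\<close>

text \<open>Abel summation, arranged as an induction on the upper end. Passing from \<open>k\<close>
  to \<open>k + 1\<close> costs \<open>V' k * (1 / k - 1 / (k + 1))\<close>; after inserting the
  quadratic bound, the constant part telescopes to at most \<open>\<alpha> / z\<close>, the linear
  part is harmonic and the square part contributes at most \<open>\<kappa>\<close> each
  time.\<close>

lemma partial_summation_le:
  fixes v :: "nat \<Rightarrow> real"
  assumes v: "\<And>r. v r \<ge> 0" and V: "\<And>k. 1 \<le> k \<Longrightarrow> k \<le> R \<Longrightarrow> (\<Sum>r\<in>{1..k}. v r) \<le> \<alpha> + \<beta> * k + \<kappa> * real k ^ 2"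
    and nn: "\<alpha> \<ge> 0" "\<beta> \<ge> 0" "\<kappa> \<ge> 0" and z: "z > 0" and R: "R \<ge> 1"
  shows "(\<Sum>r\<in>{1..R}. if z < real r then v r / r else 0) \<le> \<alpha> / z + \<beta> * (2 + ln R) + 2 * \<kappa> * R"
proof -
  define v' where "v' = (\<lambda>r. if z < real r then v r else 0)"
  define V' where "V' = (\<lambda>k. \<Sum>r\<in>{1..k}. v' r)"
  define T where "T = (\<lambda>k. \<Sum>r\<in>{1..k}. v' r / real r)"
  define H where "H = (\<lambda>k. \<Sum>r\<in>{1..k}. 1 / real r)"
  have v'0: "v' r \<ge> 0" for r using v by (simp add: v'_def)
  have V'S: "V' (Suc k) = V' k + v' (Suc k)" and TS: "T (Suc k) = T k + v' (Suc k) / real (Suc k)"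
    and HS: "H (Suc k) = H k + 1 / real (Suc k)" for k by (simp_all add: V'_def T_def H_def)
  have H0: "H k \<ge> 0" for k unfolding H_def by (intro sum_nonneg) auto
  have V'V: "V' k \<le> \<alpha> + \<beta> * k + \<kappa> * real k ^ 2" if "1 \<le> k" "k \<le> R" for k
  proof -
    have "V' k \<le> (\<Sum>r\<in>{1..k}. v r)" unfolding V'_def v'_def using v by (intro sum_mono) auto
    then show ?thesis using V[OF that] by linarith
  qed
  have small: "T k = 0" "V' k = 0" if "real k \<le> z" for k
    unfolding T_def V'_def using that by (auto intro!: sum.neutral simp: v'_def)
  \<comment> \<open>The bound is claimed only beyond \<open>z\<close>, where
    \<open>1 / z - 1 / k\<close> is positive; up to \<open>z\<close> the truncated sums
    vanish.\<close>
  have main: "k \<le> R \<Longrightarrow> z < real k \<Longrightarrow> T k \<le> V' k / real k + \<alpha> * (1 / z - 1 / real k) + \<beta> * H k + \<kappa> * real k" if "1 \<le> k" for k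
    using that
  proof (induction k rule: nat_induct_at_least)
    case base
    have "\<alpha> * (1 / z - 1) \<ge> 0" using nn z base by (intro mult_nonneg_nonneg) (auto simp: field_simps)
    then show ?case using nn by (simp add: T_def V'_def H_def)
  next
    case (Suc k)
    define a where "a = real k"
    have a: "a \<ge> 1" using Suc by (simp add: a_def)
    have Sk: "real (Suc k) = a + 1" by (simp add: a_def)
    show ?case
    proof (cases "real k \<le> z")
      case True
      have "\<alpha> * (1 / z - 1 / (a + 1)) \<ge> 0"
        using nn z Suc(4) a by (intro mult_nonneg_nonneg) (auto simp: field_simps a_def)
      moreover have "\<beta> * H (Suc k) \<ge> 0" "\<kappa> * (a + 1) \<ge> 0" using nn H0 a by auto
      ultimately show ?thesis using small[OF True] unfolding V'S TS Sk by simp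
    next
      case False
      then have IH: "T k \<le> V' k / a + \<alpha> * (1 / z - 1 / a) + \<beta> * H k + \<kappa> * a"
        using Suc by (simp add: a_def)
      have "V' k \<le> \<alpha> + \<beta> * a + \<kappa> * a ^ 2" using V'V[of k] Suc by (simp add: a_def)
      then have "V' k * (1 / a - 1 / (a + 1)) \<le> (\<alpha> + \<beta> * a + \<kappa> * a ^ 2) * (1 / a - 1 / (a + 1))"
        using a by (intro mult_right_mono) (auto simp: field_simps)
      also have "\<dots> = \<alpha> * (1 / a - 1 / (a + 1)) + \<beta> * (a * (1 / a - 1 / (a + 1))) + \<kappa> * (a ^ 2 * (1 / a - 1 / (a + 1)))"
        by (simp add: algebra_simps)
      also have h: "a * (1 / a - 1 / (a + 1)) = 1 / (a + 1)" using a by (simp add: right_diff_distrib) (simp add: field_simps)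
      also have "a ^ 2 * (1 / a - 1 / (a + 1)) = a / (a + 1)" by (simp only: power2_eq_square mult.assoc h) simp
      also have "\<kappa> * (a / (a + 1)) \<le> \<kappa> * 1" using nn a by (intro mult_left_mono) auto
      finally have "V' k * (1 / a - 1 / (a + 1)) \<le> \<alpha> * (1 / a - 1 / (a + 1)) + \<beta> * (1 / (a + 1)) + \<kappa>" by simp
      then have "V' k / a \<le> V' k / (a + 1) + \<alpha> * (1 / a - 1 / (a + 1)) + \<beta> / (a + 1) + \<kappa>"
        by (simp add: right_diff_distrib)
      then show ?thesis using IH unfolding V'S TS HS Sk
        by (simp add: add_divide_distrib right_diff_distrib distrib_left)
    qed
  qed
  have eq: "(\<Sum>r\<in>{1..R}. if z < real r then v r / r else 0) = T R"
    unfolding T_def v'_def by (intro sum.cong refl) auto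
  show ?thesis
  proof (cases "z < real R")
    case True
    have "V' R / R \<le> (\<alpha> + \<beta> * R + \<kappa> * real R ^ 2) / R" using V'V[of R] R by (intro divide_right_mono) auto
    also have "\<dots> = \<alpha> / R + \<beta> + \<kappa> * R" using R by (simp add: add_divide_distrib power2_eq_square)
    finally have "V' R / R \<le> \<alpha> / R + \<beta> + \<kappa> * R" .
    moreover have "\<beta> * H R \<le> \<beta> * (1 + ln R)" unfolding H_def using nn by (intro mult_left_mono sum_inverse_le_ln)
    moreover have "T R \<le> V' R / real R + \<alpha> * (1 / z - 1 / real R) + \<beta> * H R + \<kappa> * real R"
      using main[OF R] True by simp
    ultimately show ?thesis unfolding eq by (simp add: right_diff_distrib distrib_left)
  next
    case False
    have "0 \<le> \<alpha> / z" "0 \<le> \<beta> * (2 + ln R)" "0 \<le> 2 * \<kappa> * R" using nn z R by auto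
    then show ?thesis unfolding eq using small(1)[of R] False by simp
  qed
qed

section \<open>From residue classes to primitive characters\<close>

lemma induced_set_subset: "induced_set \<Xi> q \<subseteq> dchars q"
  by (auto simp: induced_set_def induced_by_def dchars_def)

lemma norm_Delta_le:
  assumes "q > 0" "coprime a q"
  shows "norm (Delta \<Xi> f x q a) \<le> 1 / totient q * (\<Sum>\<chi>\<in>dchars q - induced_set \<Xi> q. norm (char_sum f x \<chi>))"
proof -
  define N where "N = nat \<lfloor>x\<rfloor>"
  have t: "totient q > 0" using assms(1) by simp
  have "(\<Sum>n\<in>{n\<in>{1..N}. [n = a] (mod q)}. f n) = (\<Sum>n\<in>{1..N}. f n * (if [n = a] (mod q) then 1 else 0))"
    by (rule sum.mono_neutral_cong_left) auto
  also have "\<dots> = (\<Sum>n\<in>{1..N}. 1 / of_nat (totient q) * (\<Sum>\<chi>\<in>dchars q. \<chi> a * (f n * cnj (\<chi> n))))"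
  proof (intro sum.cong refl)
    fix n
    have "(\<Sum>\<chi>\<in>dchars q. \<chi> a * (f n * cnj (\<chi> n))) = f n * (\<Sum>\<chi>\<in>dchars q. \<chi> a * cnj (\<chi> n))"
      by (simp add: sum_distrib_left mult_ac)
    then show "f n * (if [n = a] (mod q) then 1 else 0) = 1 / of_nat (totient q) * (\<Sum>\<chi>\<in>dchars q. \<chi> a * (f n * cnj (\<chi> n)))"
      unfolding dchars_orthogonality[OF assms] using t by simp
  qed
  also have "\<dots> = 1 / of_nat (totient q) * (\<Sum>n\<in>{1..N}. \<Sum>\<chi>\<in>dchars q. \<chi> a * (f n * cnj (\<chi> n)))"
    by (simp only: sum_distrib_left)
  also have "(\<Sum>n\<in>{1..N}. \<Sum>\<chi>\<in>dchars q. \<chi> a * (f n * cnj (\<chi> n))) = (\<Sum>\<chi>\<in>dchars q. \<chi> a * char_sum f x \<chi>)"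
    unfolding char_sum_def N_def[symmetric] sum_distrib_left by (rule sum.swap)
  finally have "Delta \<Xi> f x q a = 1 / of_nat (totient q) * ((\<Sum>\<chi>\<in>dchars q. \<chi> a * char_sum f x \<chi>)
      - (\<Sum>\<chi>\<in>induced_set \<Xi> q. \<chi> a * char_sum f x \<chi>))"
    unfolding Delta_def N_def by (simp only: right_diff_distrib)
  also have "(\<Sum>\<chi>\<in>dchars q. \<chi> a * char_sum f x \<chi>) - (\<Sum>\<chi>\<in>induced_set \<Xi> q. \<chi> a * char_sum f x \<chi>) =
      (\<Sum>\<chi>\<in>dchars q - induced_set \<Xi> q. \<chi> a * char_sum f x \<chi>)"
    by (rule sum_diff[OF finite_dchars induced_set_subset, symmetric])
  finally have "norm (Delta \<Xi> f x q a) = 1 / totient q * norm (\<Sum>\<chi>\<in>dchars q - induced_set \<Xi> q. \<chi> a * char_sum f x \<chi>)"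
    by (simp only: norm_mult norm_divide norm_one norm_of_nat)
  also have "\<dots> \<le> 1 / totient q * (\<Sum>\<chi>\<in>dchars q - induced_set \<Xi> q. norm (char_sum f x \<chi>))"
  proof (rule mult_left_mono)
    have "norm (\<chi> a * char_sum f x \<chi>) \<le> norm (char_sum f x \<chi>)" if "\<chi> \<in> dchars q" for \<chi>
      using norm_dcharacter_le[of q \<chi> a] that mult_right_mono[of "norm (\<chi> a)" 1 "norm (char_sum f x \<chi>)"]
      by (simp add: norm_mult dchars_def)
    then show "norm (\<Sum>\<chi>\<in>dchars q - induced_set \<Xi> q. \<chi> a * char_sum f x \<chi>) \<le>
      (\<Sum>\<chi>\<in>dchars q - induced_set \<Xi> q. norm (char_sum f x \<chi>))"
      by (intro sum_norm_le) auto
  qed simp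
  finally show ?thesis .
qed

text \<open>At most \<open>totient q\<close> characters contribute, each with at most
  \<open>x\<close> terms of absolute value at most 1. This serves the bounded range of
  \<open>x\<close> in the final theorem.\<close>

lemma norm_Delta_trivial:
  assumes "q > 0" "coprime a q" "x \<ge> 0" "\<And>n. n \<ge> 1 \<Longrightarrow> norm (f n) \<le> 1"
  shows "norm (Delta \<Xi> f x q a) \<le> x"
proof -
  have cs: "norm (char_sum f x \<chi>) \<le> x" if "\<chi> \<in> dchars q" for \<chi>
  proof -
    have "norm (char_sum f x \<chi>) \<le> (\<Sum>n\<in>{1..nat \<lfloor>x\<rfloor>}. 1)"
      unfolding char_sum_def
    proof (rule sum_norm_le)
      fix n assume n: "n \<in> {1..nat \<lfloor>x\<rfloor>}"
      have "norm (f n) * norm (\<chi> n) \<le> 1 * 1"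
        using assms(4)[of n] n norm_dcharacter_le[of q \<chi> n] that by (intro mult_mono) (auto simp: dchars_def)
      then show "norm (f n * cnj (\<chi> n)) \<le> 1" by (simp add: norm_mult)
    qed
    also have "\<dots> \<le> x" using assms(3) by simp
    finally show ?thesis .
  qed
  have t: "totient q > 0" using assms(1) by simp
  have "(\<Sum>\<chi>\<in>dchars q - induced_set \<Xi> q. norm (char_sum f x \<chi>)) \<le> (\<Sum>\<chi>\<in>dchars q. norm (char_sum f x \<chi>))"
    by (intro sum_mono2) auto
  also have "\<dots> \<le> (\<Sum>\<chi>\<in>dchars q. x)" by (intro sum_mono cs)
  also have "\<dots> = totient q * x" using card_dchars[OF assms(1)] by simp
  finally have "1 / totient q * (\<Sum>\<chi>\<in>dchars q - induced_set \<Xi> q. norm (char_sum f x \<chi>)) \<le> 1 / totient q * (totient q * x)"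
    by (rule mult_left_mono) simp
  then show ?thesis using norm_Delta_le[OF assms(1,2), of \<Xi> f x] t by simp
qed

definition restricted_sum :: "nat \<Rightarrow> (nat \<Rightarrow> complex) \<Rightarrow> nat \<Rightarrow> (nat \<Rightarrow> complex) \<Rightarrow> complex" where
  "restricted_sum N f s \<psi> = (\<Sum>n\<in>{1..N}. (if coprime n s then f n else 0) * cnj (\<psi> n))"

text \<open>Send each character to a primitive character inducing it, together with the modulus
  \<open>d\<close> of the latter. With \<open>q\<close> this pair determines the character, and
  \<open>d > z\<close> because otherwise the character would belong to the induced set. Coprimality
  to \<open>q\<close> means coprimality to both \<open>d\<close> and \<open>q div d\<close>; the
  former is encoded in \<open>\<psi>\<close>, so only the latter is left for
  \<open>restricted_sum\<close>.\<close>

lemma sum_non_induced_le: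
  assumes q: "q > 0"
  shows "(\<Sum>\<chi>\<in>dchars q - induced_set (primitives_upto z) q. norm (char_sum f x \<chi>)) \<le>
    (\<Sum>d | d dvd q. if z < real d then (\<Sum>\<psi>\<in>primitives d. norm (restricted_sum (nat \<lfloor>x\<rfloor>) f (q div d) \<psi>)) else 0)"
proof -
  define rs where "rs = restricted_sum (nat \<lfloor>x\<rfloor>) f"
  define X where "X = dchars q - induced_set (primitives_upto z) q"
  define Y where "Y = Sigma {d. d dvd q} (\<lambda>d. {\<psi>\<in>primitives d. z < real d})"
  define sel where "sel = (\<lambda>\<chi>. SOME (d,\<psi>). induced_by d \<psi> q \<chi> \<and> primitive_dcharacter d \<psi>)"
  have sel: "induced_by (fst (sel \<chi>)) (snd (sel \<chi>)) q \<chi> \<and> primitive_dcharacter (fst (sel \<chi>)) (snd (sel \<chi>))"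
    if \<chi>: "\<chi> \<in> dchars q" for \<chi>
  proof -
    obtain d \<psi> where "induced_by d \<psi> q \<chi> \<and> primitive_dcharacter d \<psi>"
      using ex_inducing_primitive[of q \<chi>] \<chi> by (auto simp: dchars_def)
    then have "case sel \<chi> of (d,\<psi>) \<Rightarrow> induced_by d \<psi> q \<chi> \<and> primitive_dcharacter d \<psi>"
      unfolding sel_def by (intro someI_ex[of "\<lambda>(d,\<psi>). induced_by d \<psi> q \<chi> \<and> primitive_dcharacter d \<psi>"]) auto
    then show ?thesis by (simp add: case_prod_unfold)
  qed
  have val: "\<chi> n = (if coprime n q then snd (sel \<chi>) n else 0)" if "\<chi> \<in> dchars q" for \<chi> n
    using sel[OF that] that dcharacterD(4)[of q \<chi> n] by (auto simp: induced_by_def dchars_def)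
  have inj: "inj_on sel X"
  proof (rule inj_onI)
    fix \<chi> \<chi>' assume "\<chi> \<in> X" "\<chi>' \<in> X" "sel \<chi> = sel \<chi>'"
    then show "\<chi> = \<chi>'" using val[of \<chi>] val[of \<chi>'] by (auto simp: X_def fun_eq_iff)
  qed
  have selY: "sel ` X \<subseteq> Y"
  proof
    fix p assume "p \<in> sel ` X"
    then obtain \<chi> where \<chi>: "\<chi> \<in> X" "p = sel \<chi>" by blast
    obtain d \<psi> where p: "p = (d, \<psi>)" by (metis surj_pair)
    have i: "induced_by d \<psi> q \<chi>" "primitive_dcharacter d \<psi>" using sel[of \<chi>] \<chi>(1) unfolding \<chi>(2)[symmetric] p by (simp_all add: X_def)
    have "z < real d"
    proof (rule ccontr)
      assume "\<not> z < real d"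
      then have "\<psi> \<in> primitives_upto z" using i(2) by (auto simp: primitives_upto_def primitive_dcharacter_def)
      then have "\<chi> \<in> induced_set (primitives_upto z) q" using i by (auto simp: induced_set_def)
      then show False using \<chi> by (simp add: X_def)
    qed
    then show "p \<in> Y" using i p by (auto simp: Y_def primitives_def induced_by_def)
  qed
  have cs: "char_sum f x \<chi> = rs (q div fst (sel \<chi>)) (snd (sel \<chi>))" if \<chi>: "\<chi> \<in> X" for \<chi>
    unfolding char_sum_def rs_def restricted_sum_def
  proof (intro sum.cong refl)
    fix n
    define d where "d = fst (sel \<chi>)"
    define \<psi> where "\<psi> = snd (sel \<chi>)"
    have \<chi>': "\<chi> \<in> dchars q" using \<chi> by (simp add: X_def)
    have d: "d dvd q" "dcharacter d \<psi>" using sel[OF \<chi>'] by (auto simp: induced_by_def d_def \<psi>_def)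
    have cop: "coprime n q \<longleftrightarrow> coprime n d \<and> coprime n (q div d)"
      using d(1) coprime_mult_right_iff[of n d "q div d"] by simp
    have "cnj (\<chi> n) = (if coprime n (q div d) then 1 else 0) * cnj (\<psi> n)"
      using val[OF \<chi>', of n] cop dcharacterD(4)[OF d(2), of n] by (auto simp: \<psi>_def)
    then show "f n * cnj (\<chi> n) = (if coprime n (q div fst (sel \<chi>)) then f n else 0) * cnj (snd (sel \<chi>) n)"
      by (simp add: d_def \<psi>_def)
  qed
  have finY: "finite Y" unfolding Y_def using q by (intro finite_SigmaI) auto
  have "(\<Sum>\<chi>\<in>X. norm (char_sum f x \<chi>)) = (\<Sum>\<chi>\<in>X. norm (rs (q div fst (sel \<chi>)) (snd (sel \<chi>))))"
    by (intro sum.cong refl) (simp add: cs)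
  also have "\<dots> = (\<Sum>p\<in>sel ` X. norm (rs (q div fst p) (snd p)))"
    by (subst sum.reindex[OF inj]) simp
  also have "\<dots> \<le> (\<Sum>p\<in>Y. norm (rs (q div fst p) (snd p)))"
    by (intro sum_mono2 finY selY) auto
  also have "\<dots> = (\<Sum>d | d dvd q. \<Sum>\<psi>\<in>{\<psi>\<in>primitives d. z < real d}. norm (rs (q div d) \<psi>))"
    unfolding Y_def using q by (subst sum.Sigma) (auto simp: case_prod_unfold)
  also have "\<dots> = (\<Sum>d | d dvd q. if z < real d then (\<Sum>\<psi>\<in>primitives d. norm (rs (q div d) \<psi>)) else 0)"
    by (intro sum.cong refl) auto
  finally show ?thesis unfolding X_def rs_def .
qed

lemma totient_super_mult: "totient a * totient b \<le> totient (a * b)"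
proof (cases "a = 0 \<or> b = 0")
  case False
  define g where "g = gcd a b"
  have g: "g > 0" using False by (simp add: g_def)
  have "totient a * totient b * g = totient (a * b) * totient g" unfolding g_def by (rule totient_gcd[symmetric])
  also have "\<dots> \<le> totient (a * b) * g" by (intro mult_left_mono totient_le) auto
  finally show ?thesis using g by simp
qed auto

text \<open>With \<open>q = d * s\<close> and \<open>totient d * totient s \<le> totient q\<close>,
  the sum over moduli splits into one of \<open>1 / totient s\<close>, which costs a logarithm, and
  one over conductors \<open>d > z\<close>, handled by partial summation. The hypothesis is uniform
  in \<open>s\<close> because \<open>s\<close> enters the restricted sums.\<close>

lemma sum_max_Delta_le:
  fixes f :: "nat \<Rightarrow> complex" and x z :: real
  assumes z: "z > 0" and nn: "\<alpha> \<ge> 0" "\<beta> \<ge> 0" "\<kappa> \<ge> 0" and Q: "Q \<ge> 1"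
    and V: "\<And>k s. 1 \<le> k \<Longrightarrow> k \<le> Q \<Longrightarrow> 1 \<le> s \<Longrightarrow>
      prim_sum k (\<lambda>\<psi>. norm (restricted_sum (nat \<lfloor>x\<rfloor>) f s \<psi>)) \<le> \<alpha> + \<beta> * k + \<kappa> * real k ^ 2"
  shows "(\<Sum>q\<in>{1..Q}. Max {norm (Delta (primitives_upto z) f x q a) | a. a \<in> totatives q}) \<le>
    4 * (1 + ln Q) * (\<alpha> / z + \<beta> * (2 + ln Q) + 2 * \<kappa> * Q)"
proof -
  define G where "G = (\<lambda>s d. \<Sum>\<psi>\<in>primitives d. norm (restricted_sum (nat \<lfloor>x\<rfloor>) f s \<psi>))"
  have G0: "G s d \<ge> 0" for s d unfolding G_def by (intro sum_nonneg) auto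
  define F where "F = (\<lambda>d s. 1 / real (totient s) * (if z < real d then G s d / real (totient d) else 0))"
  have F0: "F d s \<ge> 0" for d s using G0 by (simp add: F_def)
  define B where "B = \<alpha> / z + \<beta> * (2 + ln Q) + 2 * \<kappa> * Q"
  have one: "Max {norm (Delta (primitives_upto z) f x q a) | a. a \<in> totatives q} \<le> (\<Sum>d | d dvd q. F d (q div d))"
    if q: "q \<in> {1..Q}" for q
  proof -
    have q0: "q > 0" using q by simp
    have "norm (Delta (primitives_upto z) f x q a) \<le> (\<Sum>d | d dvd q. F d (q div d))" if "a \<in> totatives q" for a
    proof -
      have "coprime a q" using that by (simp add: in_totatives_iff)
      from norm_Delta_le[OF q0 this]
      have "norm (Delta (primitives_upto z) f x q a) \<le>
        1 / totient q * (\<Sum>\<chi>\<in>dchars q - induced_set (primitives_upto z) q. norm (char_sum f x \<chi>))" .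
      also have "\<dots> \<le> 1 / totient q * (\<Sum>d | d dvd q. if z < real d then G (q div d) d else 0)"
        unfolding G_def by (intro mult_left_mono sum_non_induced_le q0) auto
      also have "\<dots> = (\<Sum>d | d dvd q. 1 / totient q * (if z < real d then G (q div d) d else 0))"
        by (rule sum_distrib_left)
      also have "\<dots> \<le> (\<Sum>d | d dvd q. F d (q div d))"
      proof (rule sum_mono)
        fix d assume "d \<in> {d. d dvd q}"
        then have dq: "q = d * (q div d)" by simp
        have pos: "d > 0" "q div d > 0" using dq q0 by (metis mult_is_0 neq0_conv)+
        have "real (totient d) * real (totient (q div d)) \<le> real (totient q)"
          using totient_super_mult[of d "q div d"] dq by (metis of_nat_le_iff of_nat_mult)
        then have "1 / real (totient q) \<le> 1 / (real (totient d) * real (totient (q div d)))"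
          using pos by (intro divide_left_mono mult_pos_pos) (auto simp: q0)
        then have "1 / real (totient q) * G (q div d) d \<le> 1 / (real (totient d) * real (totient (q div d))) * G (q div d) d"
          by (intro mult_right_mono G0)
        then show "1 / totient q * (if z < real d then G (q div d) d else 0) \<le> F d (q div d)"
          by (simp add: F_def mult.commute)
      qed
      finally show ?thesis .
    qed
    moreover have "finite {norm (Delta (primitives_upto z) f x q a) | a. a \<in> totatives q}"
      by (simp add: setcompr_eq_image)
    moreover have "{norm (Delta (primitives_upto z) f x q a) | a. a \<in> totatives q} \<noteq> {}"
      using q0 one_in_totatives by blast
    ultimately show ?thesis by (subst Max_le_iff) auto
  qed
  have inner: "(\<Sum>d\<in>{1..Q div s}. F d s) \<le> 1 / real (totient s) * B" if s: "s \<in> {1..Q}" for s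
  proof -
    have "(\<Sum>d\<in>{1..Q div s}. F d s) \<le> (\<Sum>d\<in>{1..Q}. F d s)"
      using F0 div_le_dividend[of Q s] by (intro sum_mono2) auto
    \<comment> \<open>Writing \<open>1 / totient d\<close> as \<open>(d / totient d) / d\<close>
      exhibits the weight of \<open>prim_sum\<close> and leaves \<open>1 / d\<close> for partial
      summation.\<close>
    also have "\<dots> = 1 / real (totient s) * (\<Sum>d\<in>{1..Q}. if z < real d then (real d / real (totient d) * G s d) / real d else 0)"
      unfolding F_def sum_distrib_left by (intro sum.cong refl) auto
    also have "\<dots> \<le> 1 / real (totient s) * B"
      unfolding B_def
    proof (intro mult_left_mono partial_summation_le nn z Q)
      fix k assume "1 \<le> k" "k \<le> Q"
      then show "(\<Sum>r\<in>{1..k}. real r / real (totient r) * G s r) \<le> \<alpha> + \<beta> * k + \<kappa> * real k ^ 2"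
        using V[of k s] s by (simp add: prim_sum_def G_def)
    qed (use G0 in auto)
    finally show ?thesis .
  qed
  have B0: "B \<ge> 0" unfolding B_def using nn z Q by auto
  have "(\<Sum>q\<in>{1..Q}. Max {norm (Delta (primitives_upto z) f x q a) | a. a \<in> totatives q}) \<le>
      (\<Sum>q\<in>{1..Q}. \<Sum>d | d dvd q. F d (q div d))" by (intro sum_mono one)
  also have "\<dots> = (\<Sum>s\<in>{1..Q}. \<Sum>d\<in>{1..Q div s}. F d s)" by (rule sum_divisors_swap)
  also have "\<dots> \<le> (\<Sum>s\<in>{1..Q}. 1 / real (totient s) * B)" by (intro sum_mono inner)
  also have "\<dots> = (\<Sum>s\<in>{1..Q}. 1 / real (totient s)) * B" by (simp only: sum_distrib_right)
  also have "\<dots> \<le> 4 * (1 + ln Q) * B" by (intro mult_right_mono sum_inverse_totient_le B0)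
  finally show ?thesis unfolding B_def .
qed

text \<open>Strong induction through the convolution identity: its terms add up to at most the
  divisor sum of the von Mangoldt function, which is \<open>ln n\<close>, and \<open>ln n\<close>
  cancels.\<close>

lemma class_C_norm_le_1:
  assumes "f \<in> class_C" "n \<ge> 1"
  shows "norm (f n) \<le> 1"
  using assms(2)
proof (induction n rule: less_induct)
  case (less n)
  have f1: "f 1 = 1" and L: "\<And>n. n \<ge> 1 \<Longrightarrow> norm (Lambda_of f n) \<le> (mangoldt n :: real)"
    using assms(1) by (auto simp: class_C_def multiplicative_def)
  show ?case
  proof (cases "n = 1")
    case False
    then have n: "n \<ge> 2" using less.prems by simp
    have "norm (f n) * ln (real n) = norm (f n * complex_of_real (ln (real n)))"
      using n by (simp add: norm_mult)
    also have "\<dots> = norm (\<Sum>d | d dvd n. Lambda_of f d * f (n div d))"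
      using Lambda_of_conv[where f = f, OF f1 less.prems] by simp
    also have "\<dots> \<le> (\<Sum>d | d dvd n. (mangoldt d :: real))"
    proof (rule sum_norm_le)
      fix d assume d: "d \<in> {d. d dvd n}"
      then have d1: "d \<ge> 1" using n by (auto intro: Nat.gr0I simp: Suc_le_eq)
      show "norm (Lambda_of f d * f (n div d)) \<le> (mangoldt d :: real)"
      \<comment> \<open>The term \<open>d = 1\<close> contains \<open>f n\<close> itself, which the
        induction hypothesis does not cover, but \<open>Lambda_of f 1\<close> vanishes since the von
        Mangoldt function is 0 at 1.\<close>
      proof (cases "d = 1")
        case True
        then show ?thesis using L[of 1] by (simp add: norm_mult)
      next
        case False
        then have "n div d < n" "n div d \<ge> 1" using d d1 n by (auto simp: Suc_le_eq div_greater_zero_iff dvd_imp_le)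
        then have "norm (f (n div d)) \<le> 1" using less.IH by blast
        then have "norm (Lambda_of f d) * norm (f (n div d)) \<le> mangoldt d * 1"
          using L[OF d1] by (intro mult_mono) (auto simp: mangoldt_nonneg)
        then show ?thesis by (simp add: norm_mult)
      qed
    qed
    also have "\<dots> = ln (real n)" using mangoldt_sum[of n, where ?'a = real] n by simp
    finally show ?thesis using n by simp
  qed (use f1 in simp)
qed

section \<open>The mean value over moduli\<close>

theorem theorem2p2:
  fixes A B \<gamma> :: real
  assumes "A \<ge> 0" and "B > A + 5" and "\<gamma> > 2 * A + 6"
  shows "\<exists>C::real. \<forall>x::real. \<forall>f::nat \<Rightarrow> complex. x \<ge> 2 \<longrightarrow>
    (let Q = x powr (1/2) / (ln x) powr B;
         y = x / (ln x) powr \<gamma>;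
         \<A> = primitives_upto ((ln x) powr B)
     in f \<in> class_C \<and> (\<forall>n\<ge>1. f n \<noteq> 0 \<longrightarrow> smooth y n) \<longrightarrow>
        (\<Sum>q \<in> {1..nat \<lfloor>Q\<rfloor>}. Max {norm (Delta \<A> f x q a) | a. a \<in> totatives q})
          \<le> C * (x / (ln x) powr A))"
proof -
  define T where "T = (\<lambda>f x. \<Sum>q\<in>{1..nat \<lfloor>x powr (1/2) / ln x powr B\<rfloor>}.
    Max {norm (Delta (primitives_upto (ln x powr B)) f x q a) | a. a \<in> totatives q})"
  \<comment> \<open>The term \<open>J ^ 2 * N / sqrt w\<close> is of order
    \<open>x * ln x powr (2 - c / 2)\<close>. Two more logarithms follow, from partial summation and
    from the sum of \<open>1 / totient s\<close>, so \<open>c\<close> is chosen with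
    \<open>4 - c / 2 = -A\<close>.\<close>
  define c where "c = 2 * A + 8"
  have c: "c > 0" using assms by (simp add: c_def)
  have ev: "eventually (\<lambda>x::real. x + 2 < x powr (3/2) \<and> 2 \<le> ln x \<and> 2 \<le> x \<and>
     real (card {n\<in>{1..nat \<lfloor>x\<rfloor>}. \<forall>p. prime p \<and> p dvd n \<longrightarrow> real p \<le> ln x powr c}) \<le> x / ln x powr c) at_top"
    by (intro eventually_conj smooth_count[OF c]; real_asymp)
  then obtain x0 where x0: "\<And>x. x \<ge> x0 \<Longrightarrow> x + 2 < x powr (3/2) \<and> 2 \<le> ln x \<and> 2 \<le> x \<and>
     real (card {n\<in>{1..nat \<lfloor>x\<rfloor>}. \<forall>p. prime p \<and> p dvd n \<longrightarrow> real p \<le> ln x powr c}) \<le> x / ln x powr c"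
    unfolding eventually_at_top_linorder by blast
  define x1 where "x1 = max x0 2"
  \<comment> \<open>For \<open>x \<le> x1\<close> the trivial bound \<open>x\<close> for each of at
    most \<open>Q\<close> moduli suffices. The first two factors bound \<open>Q\<close>, the last
    one absorbs \<open>ln x powr A\<close>.\<close>
  define C1 where "C1 = sqrt x1 * ln 2 powr (-B) * ln x1 powr A"
  have small: "T f x
      \<le> C1 * (x / ln x powr A)"
    if x: "2 \<le> x" "x \<le> x1" and f: "f \<in> class_C" for x and f :: "nat \<Rightarrow> complex"
  proof -
    define Q where "Q = x powr (1/2) / ln x powr B"
    have lx: "ln 2 \<le> ln x" "ln x \<le> ln x1" "0 < ln x" using x by auto
    have ln2: "ln (2::real) > 0" by simp
    have "(\<Sum>q\<in>{1..nat \<lfloor>Q\<rfloor>}. Max {norm (Delta (primitives_upto (ln x powr B)) f x q a) | a. a \<in> totatives q}) \<le> (\<Sum>q\<in>{1..nat \<lfloor>Q\<rfloor>}. x)"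
    proof (rule sum_mono)
      fix q assume q: "q \<in> {1..nat \<lfloor>Q\<rfloor>}"
      have "norm (Delta (primitives_upto (ln x powr B)) f x q a) \<le> x" if "a \<in> totatives q" for a
        using that q x class_C_norm_le_1[OF f] by (intro norm_Delta_trivial) (auto simp: in_totatives_iff)
      moreover have "finite {norm (Delta (primitives_upto (ln x powr B)) f x q a) | a. a \<in> totatives q}"
        by (simp add: setcompr_eq_image)
      moreover have "{norm (Delta (primitives_upto (ln x powr B)) f x q a) | a. a \<in> totatives q} \<noteq> {}"
        using q one_in_totatives[of q] by auto
      ultimately show "Max {norm (Delta (primitives_upto (ln x powr B)) f x q a) | a. a \<in> totatives q} \<le> x"
        by (subst Max_le_iff) auto
    qed
    also have "\<dots> = real (nat \<lfloor>Q\<rfloor>) * x" by simp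
    also have "\<dots> \<le> Q * x" using x by (intro mult_right_mono) (auto simp: Q_def)
    also have "Q \<le> C1 / ln x powr A"
    proof -
      have "Q = sqrt x * ln x powr (-B)" using x by (simp add: Q_def powr_half_sqrt powr_minus field_simps)
      also have "\<dots> \<le> sqrt x1 * ln 2 powr (-B)"
      proof (intro mult_mono)
        show "ln x powr (-B) \<le> ln 2 powr (-B)" using lx ln2 assms by (intro powr_mono2') auto
      qed (use x in auto)
      also have "\<dots> = sqrt x1 * ln 2 powr (-B) * 1" by simp
      also have "\<dots> \<le> sqrt x1 * ln 2 powr (-B) * (ln x1 powr A / ln x powr A)"
      proof (intro mult_left_mono)
        have "ln x powr A \<le> ln x1 powr A" using lx assms by (intro powr_mono2) auto
        then show "1 \<le> ln x1 powr A / ln x powr A" using lx by simp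
      qed (use x in simp)
      finally show ?thesis by (simp add: C1_def)
    qed
    then have "Q * x \<le> C1 / ln x powr A * x" using x by (intro mult_right_mono) auto
    finally show ?thesis by (simp add: T_def Q_def)
  qed
  have large: "T f x
      \<le> 17280 * (x / ln x powr A)"
    if x: "x \<ge> x0" and f: "f \<in> class_C" and supp: "\<And>n. n \<ge> 1 \<Longrightarrow> f n \<noteq> 0 \<Longrightarrow> smooth (x / ln x powr \<gamma>) n" for x and f :: "nat \<Rightarrow> complex"
  proof -
    define L where "L = ln x"
    define N where "N = nat \<lfloor>x\<rfloor>"
    \<comment> \<open>Since \<open>ln 2 > 1/2\<close>, this makes \<open>2 ^ J\<close> at least
      \<open>x powr (3/2)\<close>, which exceeds \<open>N + 1\<close>, while \<open>J\<close> stays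
      below \<open>4 * L\<close>, up to equality.\<close>
    define J where "J = nat \<lceil>3 * L\<rceil>"
    define w where "w = L powr c"
    define y where "y = x / L powr \<gamma>"
    \<comment> \<open>One share \<open>x / L powr c\<close> for the smooth integers and two for
      those with a large square divisor.\<close>
    define \<epsilon> where "\<epsilon> = 3 * x / L powr c"
    define z where "z = L powr B"
    define Q where "Q = nat \<lfloor>x powr (1/2) / L powr B\<rfloor>"
    have X: "x + 2 < x powr (3/2)" "2 \<le> L" "2 \<le> x"
      "real (card {n\<in>{1..N}. \<forall>p. prime p \<and> p dvd n \<longrightarrow> real p \<le> w}) \<le> x / L powr c"
      using x0[OF x] by (auto simp: L_def N_def w_def)
    have N: "real N \<le> x" "x - 1 < real N" "real N \<ge> 1" unfolding N_def using X(3) by linarith+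
    have J: "3 * L \<le> real J" "real J \<le> 4 * L" unfolding J_def using X(2) by linarith+
    have Lge1: "1 \<le> L powr a" if "a \<ge> 0" for a using X(2) that by (intro ge_one_powr_ge_zero) auto
    have Lpos: "L powr a > 0" for a using X(2) by simp
    have pw: "L powr a \<le> L powr b" if "a \<le> b" for a b using X(2) that by (intro powr_mono) auto
    show ?thesis
    proof (cases "Q \<ge> 1")
      case False
      then show ?thesis using X(3) by (simp add: T_def Q_def L_def)
    next
      case Q1: True
      have Qx: "real Q \<le> sqrt x * L powr (-B)"
      proof -
        have "real Q \<le> x powr (1/2) / L powr B" unfolding Q_def using X(3) by simp
        then show ?thesis using X(3) by (simp add: powr_half_sqrt powr_minus field_simps)
      qed
      also have "\<dots> \<le> sqrt x * 1"
        using Lge1[of B] assms X(2,3) by (intro mult_left_mono) (auto simp: powr_minus divide_simps)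
      finally have Qs: "real Q \<le> sqrt x" by simp
      have lnQ: "ln (real Q) \<le> L"
      proof -
        have "sqrt x * 1 \<le> sqrt x * sqrt x" using X(3) by (intro mult_left_mono) auto
        then have "real Q \<le> x" using Qs X(3) by simp
        then show ?thesis unfolding L_def using Q1 by simp
      qed
      have lnQ0: "ln (real Q) \<ge> 0" using Q1 by simp
      have J2: "N + 1 < 2 ^ J"
      proof -
        have "real (N + 1) < x powr (3/2)" using N X(1) by simp
        also have "\<dots> = exp (3 * L * (1/2))" using X(3) by (simp add: powr_def L_def)
        also have "\<dots> \<le> exp (3 * L * ln 2)"
          using half_less_ln_2 X(2) by (subst exp_le_cancel_iff, intro mult_left_mono) auto
        also have "\<dots> = 2 powr (3 * L)" by (simp add: powr_def)
        also have "\<dots> \<le> 2 powr real J" using J by (intro powr_mono) auto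
        also have "\<dots> = real (2 ^ J)" by (simp add: powr_realpow)
        finally show ?thesis by (simp only: of_nat_less_iff)
      qed
      have w1: "w \<ge> 1" unfolding w_def using c by (intro Lge1) simp
      have y0: "y \<ge> 0" unfolding y_def using X(3) by simp
      have yN: "y \<le> real N"
      proof -
        have "2 \<le> L powr 1" using X(2) by simp
        also have "\<dots> \<le> L powr \<gamma>" using assms by (intro pw) auto
        finally have "y \<le> x / 2" unfolding y_def using X(3) by (intro divide_left_mono) auto
        then show ?thesis using N(2) X(3) by linarith
      qed
      have E: "real (card (exceptional N w)) \<le> \<epsilon>"
      proof -
        have "2 * real N / w \<le> 2 * x / w" using N(1) w1 by (intro divide_right_mono) auto
        moreover have "\<epsilon> = x / L powr c + 2 * x / w" by (simp add: \<epsilon>_def w_def add_divide_distrib[symmetric])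
        ultimately show ?thesis using exceptional_count[OF w1, of N] X(4) by linarith
      qed
      define \<alpha> where "\<alpha> = 24 * real J ^ 2 * N"
      define \<beta> where "\<beta> = 12 * real J * (6 * sqrt (N * y) + 2 * real J * real N / sqrt w) + 12 * sqrt (N * \<epsilon>)"
      define \<kappa> where "\<kappa> = 12 * real J ^ 2 * sqrt N"
      have e0: "\<epsilon> \<ge> 0" using X(3) by (simp add: \<epsilon>_def)
      have nn: "\<alpha> \<ge> 0" "\<beta> \<ge> 0" "\<kappa> \<ge> 0" using y0 w1 e0 by (auto simp: \<alpha>_def \<beta>_def \<kappa>_def)
      have "multiplicative f" using f by (simp add: class_C_def)
      then have mult: "f (m * n) = f m * f n" if "m > 0" "n > 0" "coprime m n" for m n
        using that by (auto simp: multiplicative_def)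
      \<comment> \<open>Restricting \<open>f\<close> to the integers coprime to \<open>s\<close>
        keeps multiplicativity, the bound 1 and the support, so the mean value estimate applies with
        constants independent of \<open>s\<close>.\<close>
      have V: "prim_sum k (\<lambda>\<psi>. norm (restricted_sum (nat \<lfloor>x\<rfloor>) f s \<psi>)) \<le> \<alpha> + \<beta> * k + \<kappa> * real k ^ 2"
        if k: "1 \<le> k" "k \<le> Q" "1 \<le> s" for k s
        unfolding restricted_sum_def N_def[symmetric] \<alpha>_def \<beta>_def \<kappa>_def
      proof (rule mean_value[OF _ _ _ _ _ J2 w1 yN y0 E])
        have "real k ^ 2 \<le> sqrt x ^ 2" using k Qs by (intro power_mono) auto
        then have "real (k ^ 2) \<le> x" using X(3) by simp
        then show "k ^ 2 \<le> N" unfolding N_def by (rule le_nat_floor)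
        show "k > 0" using k by simp
      next
        fix m n :: nat assume "m > 0" "n > 0" "coprime m n"
        then show "(if coprime (m * n) s then f (m * n) else 0) = (if coprime m s then f m else 0) * (if coprime n s then f n else 0)"
          using mult by auto
      next
        fix n :: nat assume "n \<ge> 1"
        then show "norm (if coprime n s then f n else 0) \<le> 1" using class_C_norm_le_1[OF f] by auto
      next
        fix n :: nat assume "n \<ge> 1" "(if coprime n s then f n else 0) \<noteq> 0"
        then show "smooth y n" using supp[of n] by (auto simp: y_def L_def split: if_splits)
      qed
      have Lp: "L * L powr a = L powr (a + 1)" "L ^ 2 * L powr a = L powr (a + 2)" for a
        using X(2) by (simp_all add: powr_add power2_eq_square mult_ac powr_numeral)
      have J4: "real J ^ 2 \<le> 16 * L ^ 2"
      proof -
        have "real J ^ 2 \<le> (4 * L) ^ 2" using J by (intro power_mono) auto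
        then show ?thesis by (simp add: power_mult_distrib)
      qed
      \<comment> \<open>The common target is \<open>x * L powr (-A-1)\<close>, since the factor
        \<open>1 + ln Q\<close> in front costs one more logarithm.\<close>
      have b1: "\<alpha> / z \<le> 384 * (x * L powr (-A-1))"
      proof -
        have "\<alpha> \<le> 24 * (16 * L ^ 2) * x" unfolding \<alpha>_def using J4 N by (intro mult_mono) auto
        then have "\<alpha> / z \<le> 24 * (16 * L ^ 2) * x / z" by (intro divide_right_mono) (auto simp: z_def)
        also have "\<dots> = 384 * (x * (L ^ 2 * L powr (-B)))" by (simp add: z_def powr_minus field_simps)
        also have "\<dots> \<le> 384 * (x * L powr (-A-1))"
          unfolding Lp using assms X(3) by (intro mult_left_mono pw) auto
        finally show ?thesis .
      qed
      have sq: "sqrt (L powr a) = L powr (a / 2)" for a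
        using X(2) by (simp add: powr_half_sqrt[symmetric] powr_powr)
      \<comment> \<open>The target is one logarithm lower here because \<open>2 + ln Q\<close> still
        multiplies \<open>\<beta>\<close>. The term with \<open>y\<close> has exponent
        \<open>1 - \<gamma> / 2\<close>, where \<open>\<gamma> > 2 * A + 6\<close> enters; the term
        with \<open>sqrt w\<close> has exponent \<open>2 - c / 2\<close>, equal to the
        target.\<close>
      have b2: "\<beta> \<le> 696 * (x * L powr (-A-2))"
      proof -
        have "sqrt (N * y) \<le> sqrt (x ^ 2 * L powr (-\<gamma>))"
        proof (rule real_sqrt_le_mono)
          have "real N * y \<le> x * y" using N(1) y0 by (rule mult_right_mono)
          also have "\<dots> = x ^ 2 * L powr (-\<gamma>)" by (simp add: y_def power2_eq_square powr_minus divide_inverse)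
          finally show "real N * y \<le> x ^ 2 * L powr (-\<gamma>)" .
        qed
        also have "\<dots> = x * L powr (-\<gamma>/2)" using X(3) by (simp add: real_sqrt_mult sq)
        finally have t1: "sqrt (N * y) \<le> x * L powr (-\<gamma>/2)" .
        have "2 * real J * real N / sqrt w \<le> 2 * (4 * L) * x / sqrt w"
          using J N w1 X(2) by (intro divide_right_mono mult_mono) auto
        also have "\<dots> = 8 * (x * (L * L powr (-c/2)))"
          using X(2) by (simp add: w_def sq powr_minus field_simps)
        finally have t2: "2 * real J * real N / sqrt w \<le> 8 * (x * (L * L powr (-c/2)))" .
        have "sqrt (N * \<epsilon>) \<le> sqrt ((2 * x) ^ 2 * L powr (-c))"
        proof (rule real_sqrt_le_mono)
          have "\<epsilon> \<le> 4 * x / L powr c" unfolding \<epsilon>_def using X(3) by (intro divide_right_mono) auto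
          then have "real N * \<epsilon> \<le> x * (4 * x / L powr c)" using N(1) e0 X(3) by (intro mult_mono) auto
          also have "\<dots> = (2 * x) ^ 2 * L powr (-c)" by (simp add: power2_eq_square powr_minus divide_inverse)
          finally show "real N * \<epsilon> \<le> (2 * x) ^ 2 * L powr (-c)" .
        qed
        also have "\<dots> = 2 * (x * L powr (-c/2))" using X(3) by (simp add: real_sqrt_mult sq)
        finally have t3: "sqrt (N * \<epsilon>) \<le> 2 * (x * L powr (-c/2))" .
        have "\<beta> \<le> 12 * (4 * L) * (6 * (x * L powr (-\<gamma>/2)) + 8 * (x * (L * L powr (-c/2)))) + 12 * (2 * (x * L powr (-c/2)))"
          unfolding \<beta>_def using J t1 t2 t3 X(2,3) y0 w1 e0 by (intro add_mono mult_mono mult_nonneg_nonneg add_nonneg_nonneg) auto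
        also have "\<dots> = 288 * (x * (L * L powr (-\<gamma>/2))) + 384 * (x * (L ^ 2 * L powr (-c/2))) + 24 * (x * L powr (-c/2))"
          by (simp add: algebra_simps power2_eq_square)
        also have "\<dots> \<le> 288 * (x * L powr (-A-2)) + 384 * (x * L powr (-A-2)) + 24 * (x * L powr (-A-2))"
          unfolding Lp using assms X(3) by (intro add_mono mult_left_mono pw) (auto simp: c_def field_simps)
        finally show ?thesis by simp
      qed
      have b3: "\<beta> * (2 + ln Q) \<le> 1392 * (x * L powr (-A-1))"
      proof -
        have "\<beta> * (2 + ln Q) \<le> 696 * (x * L powr (-A-2)) * (2 * L)"
          using b2 nn lnQ lnQ0 X(2,3) by (intro mult_mono) auto
        also have "\<dots> = 1392 * (x * (L * L powr (-A-2)))" by simp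
        also have "\<dots> = 1392 * (x * L powr (-A-1))" unfolding Lp by (simp add: algebra_simps)
        finally show ?thesis .
      qed
      have b4: "2 * \<kappa> * Q \<le> 384 * (x * L powr (-A-1))"
      proof -
        have "\<kappa> \<le> 12 * (16 * L ^ 2) * sqrt x" unfolding \<kappa>_def using J4 N by (intro mult_mono) auto
        then have "2 * \<kappa> * Q \<le> 2 * (12 * (16 * L ^ 2) * sqrt x) * (sqrt x * L powr (-B))"
          using Qx nn X(3) by (intro mult_mono) auto
        also have "\<dots> = 384 * ((sqrt x * sqrt x) * (L ^ 2 * L powr (-B)))" by simp
        also have "sqrt x * sqrt x = x" using X(3) by simp
        also have "384 * (x * (L ^ 2 * L powr (-B))) \<le> 384 * (x * L powr (-A-1))"
          unfolding Lp using assms X(3) by (intro mult_left_mono pw) auto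
        finally show ?thesis .
      qed
      have "(\<Sum>q\<in>{1..Q}. Max {norm (Delta (primitives_upto z) f x q a) | a. a \<in> totatives q}) \<le>
        4 * (1 + ln Q) * (\<alpha> / z + \<beta> * (2 + ln Q) + 2 * \<kappa> * Q)"
        by (rule sum_max_Delta_le[OF _ nn Q1 V]) (use Lpos in \<open>auto simp: z_def\<close>)
      \<comment> \<open>2160 = 384 + 1392 + 384, and 8 times this is the constant 17280.\<close>
      also have "\<dots> \<le> 4 * (2 * L) * (2160 * (x * L powr (-A-1)))"
      proof (rule mult_mono)
        show "4 * (1 + ln (real Q)) \<le> 4 * (2 * L)" using lnQ X(2) by simp
        show "\<alpha> / z + \<beta> * (2 + ln Q) + 2 * \<kappa> * Q \<le> 2160 * (x * L powr (-A-1))" using b1 b3 b4 by linarith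
        show "0 \<le> 4 * (2 * L)" using X(2) by simp
        show "0 \<le> \<alpha> / z + \<beta> * (2 + ln Q) + 2 * \<kappa> * Q" using nn lnQ0 by (auto simp: z_def)
      qed
      also have "\<dots> = 17280 * (x * (L * L powr (-A-1)))" by simp
      also have "\<dots> = 17280 * (x / L powr A)" unfolding Lp by (simp add: powr_minus divide_inverse)
      finally show ?thesis by (simp add: T_def Q_def z_def L_def)
    qed
  qed
  have "\<forall>x f. 2 \<le> x \<longrightarrow> f \<in> class_C \<and> (\<forall>n\<ge>1. f n \<noteq> 0 \<longrightarrow> smooth (x / ln x powr \<gamma>) n) \<longrightarrow>
    T f x \<le> max C1 17280 * (x / ln x powr A)"
  proof (intro allI impI)
    fix x :: real and f :: "nat \<Rightarrow> complex"
    assume x: "2 \<le> x" and f: "f \<in> class_C \<and> (\<forall>n\<ge>1. f n \<noteq> 0 \<longrightarrow> smooth (x / ln x powr \<gamma>) n)"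
    have pos: "0 \<le> x / ln x powr A" using x by simp
    show "T f x \<le> max C1 17280 * (x / ln x powr A)"
    proof (cases "x \<le> x1")
      case True
      have "C1 * (x / ln x powr A) \<le> max C1 17280 * (x / ln x powr A)" using pos by (intro mult_right_mono) auto
      then show ?thesis using small[OF x True] f by (blast intro: order_trans)
    next
      case False
      then have "x \<ge> x0" by (simp add: x1_def)
      have "17280 * (x / ln x powr A) \<le> max C1 17280 * (x / ln x powr A)" using pos by (intro mult_right_mono) auto
      then show ?thesis using large[OF \<open>x \<ge> x0\<close>, of f] f by (blast intro: order_trans)
    qed
  qed
  then show ?thesis unfolding T_def Let_def by (rule exI[of _ "max C1 17280"])
qed

end
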